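(* Let $N\ge 2$ and let $\Omega$ be an open bounded polyhedral domain of $\mathbb{R}^N$. Let $p,s,m$ be real numbers such that either $1\le p<N$ and $1\le s\le m\le p^*=\frac{pN}{N-p}$, or $p\ge N$ and $1\le s\le m<+\infty$. Let $$\theta=\frac{\frac1s-\frac1m}{\frac1s+\frac1N-\frac1p}.$$ Then there exists a constant $C>0$ depending only on $p$, $s$, $m$, $N$ and $\Omega$ such that, for every mesh $\mathfrak{M}$ of $\Omega$ satisfying the regularity constraint with parameter $\xi>0$, $$\|u\|_{0,m}\le \frac{C}{\xi^{(p-1)\theta/p}}\,\|u\|_{1,p,\mathfrak{M}}^{\theta}\,\|u\|_{0,s}^{1-\theta}\qquad\text{for all } u\in X(\mathfrak{M}).$$
   Context: Standing assumption: $\Omega$ is a Lipschitz domain; $\Gamma=\partial\Omega$. $\mathrm{d}$ is the Euclidean distance in $\mathbb{R}^N$ and $\mathrm{m}(\cdot)$ is the Lebesgue measure in $\mathbb{R}^N$ or the $(N-1)$-dimensional measure on hyperplanes. A mesh of $\Omega$ is given by a finite family $\mathfrak{M}$ of control volumes (open polyhedral subsets of $\Omega$), a family $\mathcal{E}$ of relatively open parts of hyperplanes of $\mathbb{R}^N$ (the faces of the control volumes), and points $(x_K)_{K\in\mathfrak{M}}$ such that: (i) $\overline\Omega=\bigcup_{K\in\mathfrak{M}}\overline K$; (ii) for each $K\in\mathfrak{M}$ there is $\mathcal{E}_K\subset\mathcal{E}$ with $\partial K=\bigcup_{\sigma\in\mathcal{E}_K}\overline\sigma$; (iii) for all $K\ne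 L$ in $\mathfrak{M}$, either $\mathrm{m}(\overline K\cap\overline L)=0$ (as an $(N-1)$-dimensional measure), or $\overline K\cap\overline L=\overline\sigma$ for some $\sigma\in\mathcal{E}$, denoted $\sigma=K|L$; (iv) $x_K\in K$ for all $K$, and $x_K\neq x_L$ if $\sigma=K|L$. $\mathcal{E}_{int}$ denotes the set of interior faces and $\mathcal{E}_{ext}$ the set of boundary faces (those included in $\Gamma$); $\mathcal{E}_{ext,K}=\mathcal{E}_{ext}\cap\mathcal{E}_K$. Set $d_\sigma=\mathrm{d}(x_K,x_L)$ if $\sigma=K|L\in\mathcal{E}_{int}$ and $d_\sigma=\mathrm{d}(x_K,\sigma)$ if $\sigma\in\mathcal{E}_{ext,K}$. Regularity constraint with parameter $\xi>0$: $\mathrm{d}(x_K,\sigma)\ge \xi\, d_\sigma$ for all $K\in\mathfrak{M}$ and all $\sigma\in\mathcal{E}_K$. $X(\mathfrak{M})$ is the set of $u\in L^1(\Omega)$ of the form $u=\sum_{K\in\mathfrak{M}}u_K\mathbf{1}_K$ with $u_K\in\mathbb{R}$. For $u\in X(\mathfrak{M})$ and $p\in[1,\infty)$: $$\|u\|_{0,p}=\Big(\int_\Omega|u|^p\,dx\Big)^{1/p}=\Big(\sum_{K\in\mathfrak{M}}\mathrm{m}(K)|u_K|^p\Big)^{1/p},$$ $$|u|_{1,p,\mathfrak{M}}=\Big(\sum_{\sigma=K|L\in\mathcal{E}_{int}}\frac{\mathrm{m}(\sigma)}{d_\sigma^{p-1}}|u_L-u_K|^p\Big)^{1/p},\qquad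 \|u\|_{1,p,\mathfrak{M}}=\|u\|_{0,p}+|u|_{1,p,\mathfrak{M}}.$$
   Formalization: Each control volume K is additionally assumed star-shaped with respect to x_K (true for convex cells), and d(x_K,σ) is read as the distance from x_K to the hyperplane containing σ; for general polyhedral cells, or with the distance to the set σ, the inequality fails. *)

theory Defs
  imports "HOL-Analysis.Analysis"
begin

(* The library's polyhedra are convex and closed. Here an open polyhedral set is the interior of
   a finite union of them, so it need not be convex. *)
definition open_polyhedral :: "'a::euclidean_space set \<Rightarrow> bool" where
  "open_polyhedral S \<longleftrightarrow>
     open S \<and> interior (closure S) = S \<and>
     (\<exists>P. finite P \<and> (\<forall>Q\<in>P. polyhedron Q) \<and> closure S = \<Union>P)"

(* Near each boundary point the domain is the strict epigraph of a Lipschitz function over the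
   hyperplane orthogonal to a unit vector e; y - (y \<bullet> e) *\<^sub>R e is the projection of y to it. *)
definition lipschitz_domain :: "'a::euclidean_space set \<Rightarrow> bool" where
  "lipschitz_domain \<Omega> \<longleftrightarrow>
     open \<Omega> \<and> connected \<Omega> \<and> \<Omega> \<noteq> {} \<and>
     (\<forall>z\<in>frontier \<Omega>. \<exists>U e C (g :: 'a \<Rightarrow> real).
        open U \<and> z \<in> U \<and> norm e = 1 \<and> C-lipschitz_on UNIV g \<and>
        \<Omega> \<inter> U = {y \<in> U. g (y - (y \<bullet> e) *\<^sub>R e) < y \<bullet> e})"

definition hyperplane :: "'a::euclidean_space set \<Rightarrow> bool" where
  "hyperplane H \<longleftrightarrow> (\<exists>a c. a \<noteq> 0 \<and> H = {y. a \<bullet> y = c})"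

definition orthonormal_frame :: "'a::euclidean_space set \<Rightarrow> 'a \<times> 'a set \<Rightarrow> bool" where
  "orthonormal_frame H zB \<longleftrightarrow>
     pairwise orthogonal (snd zB) \<and> (\<forall>b\<in>snd zB. norm b = 1) \<and>
     H = (\<lambda>v. fst zB + v) ` span (snd zB)"

lemma orthonormal_frame_exists:
  assumes "hyperplane H"
  shows "\<exists>zB. orthonormal_frame H zB"
proof -
  obtain a c where a: "a \<noteq> 0" and H: "H = {y. a \<bullet> y = c}"
    using assms by (auto simp: hyperplane_def)
  define z where "z = (c / (a \<bullet> a)) *\<^sub>R a"
  have z: "a \<bullet> z = c" using a by (simp add: z_def)
  obtain B where B: "pairwise orthogonal B" "\<And>b. b \<in> B \<Longrightarrow> norm b = 1" "span B = {v. a \<bullet> v = 0}"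
    using orthonormal_basis_subspace[OF subspace_hyperplane[of a]] by metis
  have "H = (\<lambda>v. z + v) ` {v. a \<bullet> v = 0}"
  proof
    show "H \<subseteq> (\<lambda>v. z + v) ` {v. a \<bullet> v = 0}"
    proof
      fix y assume "y \<in> H"
      then have "a \<bullet> (y - z) = 0" using z by (simp add: H inner_diff_right)
      then show "y \<in> (\<lambda>v. z + v) ` {v. a \<bullet> v = 0}"
        by (intro image_eqI[of _ _ "y - z"]) auto
    qed
    show "(\<lambda>v. z + v) ` {v. a \<bullet> v = 0} \<subseteq> H"
      using z by (auto simp: H inner_add_right)
  qed
  then have "orthonormal_frame H (z, B)" using B by (simp add: orthonormal_frame_def)
  then show ?thesis by blast
qed

(* The (N-1)-dimensional Lebesgue measure carried by a hyperplane, built from Cartesian coordinates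
   on it in the way lborel is built from the standard ones. It does not depend on the chosen frame,
   and it gives measure 0 to the complement of the hyperplane. *)
definition hyperplane_measure :: "'a::euclidean_space set \<Rightarrow> 'a measure" where
  "hyperplane_measure H =
     (let zB = (SOME zB. orthonormal_frame H zB); z = fst zB; B = snd zB
      in distr (\<Pi>\<^sub>M b\<in>B. lborel) borel (\<lambda>f. z + (\<Sum>b\<in>B. f b *\<^sub>R b)))"

definition face_measure :: "'a::euclidean_space set \<Rightarrow> real" where
  "face_measure \<sigma> = measure (hyperplane_measure (affine hull \<sigma>)) \<sigma>"

(* For a set S that is not contained in a hyperplane, such as the common boundary of two cells.
   For finite unions of polyhedra this says that the (N-1)-dimensional measure of S is 0. *)
definition hyperplane_null :: "'a::euclidean_space set \<Rightarrow> bool" where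
  "hyperplane_null S \<longleftrightarrow> (\<forall>H. hyperplane H \<longrightarrow> emeasure (hyperplane_measure H) S = 0)"

(* The last condition makes a face the full relative interior of its closure. It excludes slits and
   ensures that the face is determined by its closure. *)
definition hyperplane_face :: "'a::euclidean_space set \<Rightarrow> bool" where
  "hyperplane_face \<sigma> \<longleftrightarrow>
     \<sigma> \<noteq> {} \<and> (\<exists>H. hyperplane H \<and> openin (top_of_set H) \<sigma>) \<and> rel_interior (closure \<sigma>) = \<sigma>"

(* "sigma = K|L" *)
definition interface :: "'a::euclidean_space set set \<Rightarrow> 'a set set \<Rightarrow> 'a set \<Rightarrow> 'a set \<Rightarrow> 'a set \<Rightarrow> bool"
  where
  "interface M E K L \<sigma> \<longleftrightarrow>
     K \<in> M \<and> L \<in> M \<and> K \<noteq> L \<and> \<sigma> \<in> E \<and> closure K \<inter> closure L = closure \<sigma>"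

(* M: control volumes, E: faces, EK K: the faces of K, x K: the point of K.
   star_shaped holds for every convex cell. Together with the orthogonal face distance below it is
   the setting in which K is the union of the pyramids with apex x K over its faces, so that the
   sum over sigma in EK K of m(sigma) d(x K, sigma) is N m(K). Without it the inequality fails. *)
locale mesh =
  fixes \<Omega> :: "'a::euclidean_space set"
    and M E :: "'a set set"
    and EK :: "'a set \<Rightarrow> 'a set set"
    and x :: "'a set \<Rightarrow> 'a"
  assumes finite_cells: "finite M"
    and cells: "\<And>K. K \<in> M \<Longrightarrow> K \<subseteq> \<Omega> \<and> open_polyhedral K"
    and faces: "\<And>\<sigma>. \<sigma> \<in> E \<Longrightarrow> hyperplane_face \<sigma>"
    and cover: "closure \<Omega> = (\<Union>K\<in>M. closure K)"
    and cell_faces: "\<And>K. K \<in> M \<Longrightarrow> EK K \<subseteq> E \<and> frontier K = (\<Union>\<sigma>\<in>EK K. closure \<sigma>)"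
    and conforming: "\<And>K L. K \<in> M \<Longrightarrow> L \<in> M \<Longrightarrow> K \<noteq> L \<Longrightarrow>
          hyperplane_null (closure K \<inter> closure L) \<or> (\<exists>\<sigma>. interface M E K L \<sigma>)"
    and interior_or_boundary: "\<And>K \<sigma>. K \<in> M \<Longrightarrow> \<sigma> \<in> EK K \<Longrightarrow>
          \<sigma> \<subseteq> frontier \<Omega> \<or> (\<exists>L. interface M E K L \<sigma>)"
    and interface_faces: "\<And>K L \<sigma>. interface M E K L \<sigma> \<Longrightarrow> \<sigma> \<in> EK K \<and> \<sigma> \<in> EK L"
    and points: "\<And>K. K \<in> M \<Longrightarrow> x K \<in> K"
    and points_distinct: "\<And>K L \<sigma>. interface M E K L \<sigma> \<Longrightarrow> x K \<noteq> x L"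
    and star_shaped: "\<And>K y. K \<in> M \<Longrightarrow> y \<in> K \<Longrightarrow> closed_segment (x K) y \<subseteq> K"

(* The distance from y to the hyperplane that contains the face, i.e. the height of the pyramid
   with apex y over the face. *)
definition face_dist :: "'a::euclidean_space \<Rightarrow> 'a set \<Rightarrow> real" where
  "face_dist y \<sigma> = infdist y (affine hull \<sigma>)"

(* d(x K, sigma) \<ge> \<xi> d_sigma, where d_sigma is d(x K, x L) for sigma = K|L and d(x K, sigma)
   for a boundary face. *)
definition mesh_regular ::
  "'a::euclidean_space set \<Rightarrow> 'a set set \<Rightarrow> 'a set set \<Rightarrow> ('a set \<Rightarrow> 'a set set) \<Rightarrow> ('a set \<Rightarrow> 'a) \<Rightarrow> real \<Rightarrow> bool"
  where
  "mesh_regular \<Omega> M E EK x \<xi> \<longleftrightarrow>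
     (\<forall>K\<in>M. \<forall>\<sigma>\<in>EK K.
        (\<forall>L. interface M E K L \<sigma> \<longrightarrow> face_dist (x K) \<sigma> \<ge> \<xi> * dist (x K) (x L)) \<and>
        (\<sigma> \<subseteq> frontier \<Omega> \<longrightarrow> face_dist (x K) \<sigma> \<ge> \<xi> * face_dist (x K) \<sigma>))"

(* The element of X(M) with cell values uK. *)
definition step_fun :: "'a::euclidean_space set set \<Rightarrow> ('a set \<Rightarrow> real) \<Rightarrow> 'a \<Rightarrow> real" where
  "step_fun M uK = (\<lambda>y. \<Sum>K\<in>M. uK K * indicator K y)"

definition Lp_norm :: "'a::euclidean_space set \<Rightarrow> real \<Rightarrow> ('a \<Rightarrow> real) \<Rightarrow> real" where
  "Lp_norm \<Omega> p u = (LINT y:\<Omega>|lborel. \<bar>u y\<bar> powr p) powr (1 / p)"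

(* Each interior face occurs in the index set twice, as K|L and as L|K, hence the factor 1/2. *)
definition mesh_seminorm ::
  "'a::euclidean_space set set \<Rightarrow> 'a set set \<Rightarrow> ('a set \<Rightarrow> 'a) \<Rightarrow> real \<Rightarrow> ('a set \<Rightarrow> real) \<Rightarrow> real"
  where
  "mesh_seminorm M E x p uK =
     (1 / 2 * (\<Sum>(K, L, \<sigma>)\<in>{(K, L, \<sigma>). interface M E K L \<sigma>}.
        face_measure \<sigma> / dist (x K) (x L) powr (p - 1) * \<bar>uK L - uK K\<bar> powr p)) powr (1 / p)"

definition mesh_norm ::
  "'a::euclidean_space set \<Rightarrow> 'a set set \<Rightarrow> 'a set set \<Rightarrow> ('a set \<Rightarrow> 'a) \<Rightarrow> real \<Rightarrow> ('a set \<Rightarrow> real) \<Rightarrow> real"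
  where
  "mesh_norm \<Omega> M E x p uK = Lp_norm \<Omega> p (step_fun M uK) + mesh_seminorm M E x p uK"

end

theory Submission
  imports Defs
begin

text \<open>
Write $N$ for the dimension, $m(K)$ for the volume of a cell, $m(\sigma)$ for the measure of a
face, and $d_\sigma$ for the distance of $x_K$ and $x_L$ when $\sigma = K|L$. Everything rests
on one inequality for nonnegative step functions $v$, the embedding of BV into $L^{N/(N-1)}$
(\<open>discrete_BV_embedding\<close>): the $L^{N/(N-1)}$ norm of $v$ is at most a constant,
depending only on $\Omega$, times the sum of its $L^1$ norm and of its total variation inside
$\Omega$, which is the sum of $m(\sigma) |v_K - v_L|$ over the interior faces.

Applied to $v = |u|^\gamma$, the embedding gives the Sobolev inequality. Indeed
$| |u_K|^\gamma - |u_L|^\gamma |$ is controlled by $|u_K - u_L| |u_K|^{\gamma-1}$ from the side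
with the larger value, and Hoelder's inequality splits the sum over the faces into the discrete
seminorm and the sum of $m(\sigma) d_\sigma |u_K|^r$ with $r = (\gamma-1) p/(p-1)$. Regularity
of the mesh is used to bound the latter: the pyramids with apex $x_K$ over the faces of $K$
are disjoint subsets of $K$, so the $m(\sigma) d_\sigma$ of one cell add up to at most a multiple
of $m(K)/\xi$ (\<open>sum_pyramids_le_cell\<close>). With $q = \gamma N/(N-1)$ this bounds
$||u||_q^\gamma$ by $\xi^{-(p-1)/p} ||u||_{1,p} ||u||_r^{\gamma-1}$
(\<open>sobolev_power_sum\<close>). The rest is interpolation: the logarithm of the sum of
$m(K) |u_K|^t$ is convex in $t$, and eliminating $r$ and $q$ from three linear inequalities between
such logarithms leaves precisely the exponent $\theta$ (\<open>interpolation_exponents\<close>).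

The embedding itself is a sum over the superlevel sets of $v$
(\<open>layer_cake_inequality\<close>) of an isoperimetric inequality for the union $U$ of a
set of cells: $|U|^{1-1/N}$ is at most a constant times $|U|$ plus the perimeter of $U$ inside
$\Omega$ (\<open>isoperimetric_inequality\<close>). It is proved by averaging translations. A bounded
Lipschitz domain is covered by finitely many open sets $V$, each with a ball of vectors $w$ such
that the segment from $y$ to $y + w$ stays in $\Omega$ for all $y$ in $V \cap \Omega$. The ball may be
scaled down until its volume is $2 |U|$. Since $U$ fills at most half of any translate of such a
ball, translation by an average $w$ moves at most half of $U \cap V$ into $U$; the other half leaves
$U$, and it can do so only across a face that separates $U$ from its complement. The points
that cross a given face $\sigma$ under the translation by $w$ have volume at most $|w| m(\sigma)$
(\<open>emeasure_exit_le_perimeter\<close>). Hence half the volume of $U \cap V$ is at most a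
multiple of $|w|$ times the perimeter, and $|w|$ is of the order of $|U|^{1/N}$.
\<close>

section \<open>Lebesgue measure in orthonormal coordinates\<close>

text \<open>
Haar uniqueness, by the usual double integral: integrating $1_A(x+y) 1_B(y)$ first in $x$ and first
in $y$ gives $\lambda(A) \mu(B) = \mu(A) \lambda(-B)$. The unit ball serves as $B$, because it is
symmetric and both measures agree on it.
\<close>

lemma translation_invariant_eq_lborel:
  fixes \<mu> :: "'a::euclidean_space measure"
  assumes sets[measurable_cong]: "sets \<mu> = sets borel"
    and trans: "\<And>c. distr \<mu> borel ((+) c) = \<mu>"
    and ball: "\<And>r. emeasure \<mu> (ball 0 r) = emeasure lborel (ball (0::'a) r)"
  shows "\<mu> = lborel"
proof -
  have sp: "space \<mu> = UNIV" using sets_eq_imp_space_eq[OF sets] by simp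
  have "sigma_finite_measure \<mu>"
  proof (rule sigma_finite_measure.intro, intro exI[of _ "range (\<lambda>n::nat. ball 0 (real n))"] conjI ballI)
    show "\<Union> (range (\<lambda>n::nat. ball (0::'a) (real n))) = space \<mu>"
      using reals_Archimedean2 by (auto simp: sp)
    fix a assume "a \<in> range (\<lambda>n::nat. ball (0::'a) (real n))"
    then show "emeasure \<mu> a \<noteq> \<infinity>"
      using emeasure_lborel_ball_finite[of "0::'a"] by (auto simp: ball less_top[symmetric])
  qed (auto simp: sets)
  then interpret sigma_finite_measure \<mu> .
  interpret pair_sigma_finite lborel \<mu> ..
  have nn: "(\<integral>\<^sup>+y. g (c + y) \<partial>\<mu>) = (\<integral>\<^sup>+y. g y \<partial>\<mu>)"
    if [measurable]: "g \<in> borel_measurable borel" for g :: "'a \<Rightarrow> ennreal" and c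
    using nn_integral_distr[of "(+) c" \<mu> borel g] by (simp add: trans)
  have nl: "(\<integral>\<^sup>+x. g (x + c) \<partial>lborel) = (\<integral>\<^sup>+x. g x \<partial>lborel)"
    if [measurable]: "g \<in> borel_measurable borel" for g :: "'a \<Rightarrow> ennreal" and c
    using nn_integral_distr[of "(+) c" "lborel" borel g] by (simp add: lborel_distr_plus add.commute)
  let ?B = "ball (0::'a) 1"
  have [measurable]: "?B \<in> sets borel" by simp
  show ?thesis
  proof (rule measure_eqI)
    fix A assume "A \<in> sets \<mu>"
    then have [measurable]: "A \<in> sets borel" by (simp add: sets)
    have "emeasure lborel A * emeasure \<mu> ?B
        = (\<integral>\<^sup>+y. (\<integral>\<^sup>+x. indicator A (x + y) * indicator ?B y \<partial>lborel) \<partial>\<mu>)"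
      by (simp add: nn_integral_multc nl nn_integral_cmult_indicator sets)
    also have "\<dots> = (\<integral>\<^sup>+x. (\<integral>\<^sup>+y. indicator A (x + y) * indicator ?B y \<partial>\<mu>) \<partial>lborel)"
      by (rule Fubini') measurable
    also have "\<dots> = (\<integral>\<^sup>+x. (\<integral>\<^sup>+y. indicator A y * indicator ?B (y - x) \<partial>\<mu>) \<partial>lborel)"
    proof (rule nn_integral_cong)
      fix x :: 'a
      show "(\<integral>\<^sup>+y. indicator A (x + y) * indicator ?B y \<partial>\<mu>)
          = (\<integral>\<^sup>+y. indicator A y * indicator ?B (y - x) \<partial>\<mu>)"
        using nn[of "\<lambda>y. indicator A y * indicator ?B (y - x)" x] by simp
    qed
    also have "\<dots> = (\<integral>\<^sup>+y. (\<integral>\<^sup>+x. indicator A y * indicator ?B (y - x) \<partial>lborel) \<partial>\<mu>)"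
      by (rule Fubini'[symmetric]) measurable
    also have "\<dots> = (\<integral>\<^sup>+y. (\<integral>\<^sup>+x. indicator A y * indicator (ball y 1) x \<partial>lborel) \<partial>\<mu>)"
      by (intro nn_integral_cong) (auto simp: indicator_def dist_norm norm_minus_commute)
    also have "\<dots> = emeasure \<mu> A * emeasure lborel ?B"
      by (simp add: nn_integral_cmult_indicator nn_integral_multc emeasure_ball sets)
    finally have "emeasure lborel ?B * emeasure lborel A = emeasure lborel ?B * emeasure \<mu> A"
      by (simp add: ball mult.commute)
    moreover have "unit_ball_vol (real DIM('a)) \<noteq> 0"
      using unit_ball_vol_pos[of "real DIM('a)"] by (metis less_irrefl of_nat_0_le_iff)
    then have "emeasure lborel ?B \<noteq> top" "emeasure lborel ?B \<noteq> 0"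
      by (auto simp: emeasure_ball)
    ultimately show "emeasure \<mu> A = emeasure lborel A"
      by (simp add: ennreal_mult_cancel_left)
  qed (simp add: sets)
qed

text \<open>
The linear isometry that sends the standard basis to \<open>B\<close> maps \<open>lborel\<close> to a
translation invariant measure with the same values on balls about the origin, hence to itself.
\<close>

lemma lborel_orthonormal_basis:
  fixes B :: "'a::euclidean_space set"
  assumes orth: "pairwise orthogonal B" and unit: "\<And>b. b \<in> B \<Longrightarrow> norm b = 1"
    and span: "span B = UNIV"
  shows "lborel = distr (\<Pi>\<^sub>M b\<in>B. lborel) borel (\<lambda>f. \<Sum>b\<in>B. f b *\<^sub>R b)"
proof -
  have indep: "independent B"
    using pairwise_orthogonal_independent[OF orth] unit by force
  have finB: "finite B" using indep by (rule independent_imp_finite)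
  have "card B = card (Basis :: 'a set)"
    using dim_eq_card_independent[OF indep] span dim_UNIV by (metis dim_span)
  then obtain h where h: "bij_betw h (Basis :: 'a set) B"
    using finite_same_card_bij[OF finite_Basis finB] by metis
  define g where "g x = (\<Sum>b\<in>Basis. (x \<bullet> b) *\<^sub>R h b)" for x :: 'a
  have lin: "linear g"
    unfolding g_def by (intro linear_compose_sum ballI)
      (auto intro!: linearI simp: inner_add_left scaleR_add_left)
  have normg: "norm (g x) = norm x" for x
  proof -
    have "pairwise (\<lambda>i j. orthogonal ((x \<bullet> i) *\<^sub>R h i) ((x \<bullet> j) *\<^sub>R h j)) Basis"
      using orth h unfolding pairwise_def orthogonal_def bij_betw_def inj_on_def by auto
    then have "(norm (g x))\<^sup>2 = (\<Sum>b\<in>Basis. (norm ((x \<bullet> b) *\<^sub>R h b))\<^sup>2)"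
      unfolding g_def by (intro norm_sum_Pythagorean) auto
    also have "\<dots> = (\<Sum>b\<in>Basis. (x \<bullet> b)\<^sup>2)"
      using h unit by (intro sum.cong) (auto simp: bij_betw_def)
    also have "\<dots> = (norm x)\<^sup>2"
      by (subst power2_norm_eq_inner, subst euclidean_inner) (simp add: power2_eq_square)
    finally show ?thesis by simp
  qed
  have "inj g"
    unfolding linear_injective_0[OF lin] using normg by (metis norm_eq_zero)
  then have surj: "surj g" using lin linear_injective_imp_surjective by blast
  have [measurable]: "g \<in> borel_measurable borel"
    using lin by (intro borel_measurable_continuous_onI linear_continuous_on linear_conv_bounded_linear[THEN iffD1])
  \<comment> \<open>Translating the image by g d amounts to translating the argument by d.\<close>
  have g_lborel: "distr lborel borel g = lborel"
  proof (rule translation_invariant_eq_lborel)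
    fix c :: 'a
    obtain d where d: "c = g d" using surj by (metis surjD)
    have "distr (distr lborel borel g) borel ((+) c) = distr lborel borel (\<lambda>x. c + g x)"
      by (subst distr_distr) (auto simp: o_def)
    also have "\<dots> = distr lborel borel (\<lambda>x. g (d + x))"
      by (simp add: d linear_add[OF lin])
    also have "\<dots> = distr (distr lborel borel ((+) d)) borel g"
      by (subst distr_distr) (auto simp: o_def)
    also have "\<dots> = distr lborel borel g" by (simp add: lborel_distr_plus)
    finally show "distr (distr lborel borel g) borel ((+) c) = distr lborel borel g" .
  next
    fix r
    have "g -` ball 0 r = ball 0 r" using normg by auto
    then show "emeasure (distr lborel borel g) (ball 0 r) = emeasure lborel (ball (0::'a) r)"
      by (simp add: emeasure_distr)
  qed simp
  interpret product_sigma_finite "\<lambda>_::'a. lborel :: real measure" ..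
  define k where "k f = (\<lambda>b\<in>B. f (inv_into Basis h b))" for f :: "'a \<Rightarrow> real"
  have invh: "inv_into Basis h b \<in> Basis" "h (inv_into Basis h b) = b" if "b \<in> B" for b
    using h that by (auto simp: bij_betw_def inv_into_into f_inv_into_f)
  have [measurable]: "k \<in> measurable (\<Pi>\<^sub>M b\<in>Basis. lborel) (\<Pi>\<^sub>M b\<in>B. lborel)"
    unfolding k_def using invh by (intro measurable_restrict) measurable
  \<comment> \<open>Renaming the coordinates along the bijection h carries one product measure to the other.\<close>
  have "distr (\<Pi>\<^sub>M b\<in>Basis. lborel) (\<Pi>\<^sub>M b\<in>B. lborel) k = (\<Pi>\<^sub>M b\<in>B. lborel)"
  proof (rule PiM_eqI[OF finB])
    fix A assume A: "\<And>i. i \<in> B \<Longrightarrow> A i \<in> sets (lborel :: real measure)"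
    have "k -` Pi\<^sub>E B A \<inter> space (\<Pi>\<^sub>M b\<in>Basis. lborel) = Pi\<^sub>E Basis (\<lambda>b. A (h b))"
    proof (intro equalityI subsetI)
      fix f assume "f \<in> k -` Pi\<^sub>E B A \<inter> space (\<Pi>\<^sub>M b\<in>Basis. (lborel :: real measure))"
      then have f: "k f \<in> Pi\<^sub>E B A" "f \<in> extensional Basis" by (auto simp: space_PiM PiE_def)
      have "f b \<in> A (h b)" if b: "b \<in> Basis" for b
      proof -
        have "h b \<in> B" "inv_into Basis h (h b) = b"
          using h b by (auto simp: bij_betw_def)
        then show ?thesis using f(1) unfolding k_def by (metis PiE_mem restrict_apply')
      qed
      then show "f \<in> Pi\<^sub>E Basis (\<lambda>b. A (h b))" using f(2) by (simp add: PiE_def)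
    next
      fix f assume f: "f \<in> Pi\<^sub>E Basis (\<lambda>b. A (h b))"
      then have "f (inv_into Basis h b) \<in> A b" if "b \<in> B" for b
        using invh[OF that] by (metis PiE_mem)
      then show "f \<in> k -` Pi\<^sub>E B A \<inter> space (\<Pi>\<^sub>M b\<in>Basis. (lborel :: real measure))"
        using f by (auto simp: space_PiM k_def)
    qed
    moreover have "A (h b) \<in> sets lborel" if "b \<in> Basis" for b
      using A h that by (auto simp: bij_betw_def)
    ultimately have "emeasure (distr (\<Pi>\<^sub>M b\<in>Basis. lborel) (\<Pi>\<^sub>M b\<in>B. lborel) k) (Pi\<^sub>E B A)
        = (\<Prod>b\<in>Basis. emeasure lborel (A (h b)))"
      using A finB by (subst emeasure_distr) (auto intro!: sets_PiM_I_finite simp: emeasure_PiM)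
    also have "\<dots> = (\<Prod>b\<in>B. emeasure lborel (A b))"
      using prod.reindex_bij_betw[OF h] by fast
    finally show "emeasure (distr (\<Pi>\<^sub>M b\<in>Basis. lborel) (\<Pi>\<^sub>M b\<in>B. lborel) k) (Pi\<^sub>E B A)
        = (\<Prod>b\<in>B. emeasure lborel (A b))" .
  qed simp
  then have "distr (\<Pi>\<^sub>M b\<in>B. lborel) borel (\<lambda>f. \<Sum>b\<in>B. f b *\<^sub>R b)
      = distr (distr (\<Pi>\<^sub>M b\<in>Basis. lborel) (\<Pi>\<^sub>M b\<in>B. lborel) k) borel (\<lambda>f. \<Sum>b\<in>B. f b *\<^sub>R b)"
    by simp
  also have "\<dots> = distr (\<Pi>\<^sub>M b\<in>Basis. lborel) borel (\<lambda>f. \<Sum>b\<in>B. k f b *\<^sub>R b)"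
    by (subst distr_distr) (auto simp: o_def)
  also have "(\<lambda>f. \<Sum>b\<in>B. k f b *\<^sub>R b) = (\<lambda>f. \<Sum>b\<in>Basis. f b *\<^sub>R h b)"
  proof
    fix f :: "'a \<Rightarrow> real"
    have "(\<Sum>b\<in>B. k f b *\<^sub>R b) = (\<Sum>b\<in>Basis. k f (h b) *\<^sub>R h b)"
      using sum.reindex_bij_betw[OF h, of "\<lambda>b. k f b *\<^sub>R b"] by simp
    also have "\<dots> = (\<Sum>b\<in>Basis. f b *\<^sub>R h b)"
      using h by (intro sum.cong) (auto simp: k_def bij_betw_def)
    finally show "(\<Sum>b\<in>B. k f b *\<^sub>R b) = (\<Sum>b\<in>Basis. f b *\<^sub>R h b)" .
  qed
  also have "distr (\<Pi>\<^sub>M b\<in>Basis. lborel) borel (\<lambda>f. \<Sum>b\<in>Basis. f b *\<^sub>R h b)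
      = distr (\<Pi>\<^sub>M b\<in>Basis. lborel) borel (g \<circ> (\<lambda>f. \<Sum>b\<in>Basis. f b *\<^sub>R b))"
    by (simp add: g_def o_def inner_sum_left inner_Basis if_distrib sum.delta cong: if_cong)
  also have "\<dots> = distr (distr (\<Pi>\<^sub>M b\<in>Basis. lborel) borel (\<lambda>f. \<Sum>b\<in>Basis. f b *\<^sub>R b)) borel g"
    by (subst distr_distr) auto
  also have "\<dots> = lborel" by (simp add: lborel_eq[symmetric] g_lborel)
  finally show ?thesis by simp
qed

section \<open>Slicing by parallel hyperplanes\<close>

lemma sets_hyperplane_measure [measurable_cong]: "sets (hyperplane_measure H) = sets borel"
  by (simp add: hyperplane_measure_def Let_def)

lemma space_hyperplane_measure [simp]: "space (hyperplane_measure H) = UNIV"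
  by (simp add: hyperplane_measure_def Let_def)

text \<open>
The unit normal completes the orthonormal frame chosen in \<open>hyperplane_measure\<close> to an
orthonormal basis of the whole space. This makes hyperplane measure a factor of
\<open>lborel\<close>, whichever frame was chosen.
\<close>

lemma hyperplane_measure_frame:
  fixes n :: "'a::euclidean_space"
  assumes n: "norm n = 1"
  obtains z B where "finite B" "n \<notin> B" "n \<bullet> z = c"
    "\<And>b. b \<in> B \<Longrightarrow> n \<bullet> b = 0"
    "lborel = distr (\<Pi>\<^sub>M b\<in>insert n B. lborel) borel (\<lambda>f. \<Sum>b\<in>insert n B. f b *\<^sub>R b)"
    "hyperplane_measure {y. n \<bullet> y = c}
      = distr (\<Pi>\<^sub>M b\<in>B. lborel) borel (\<lambda>f. z + (\<Sum>b\<in>B. f b *\<^sub>R b))"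
proof -
  define H where "H = {y. n \<bullet> y = c}"
  have nn: "n \<bullet> n = 1" using n by (simp add: norm_eq_1)
  have "n \<noteq> 0" using n by auto
  then have "hyperplane H" by (auto simp: hyperplane_def H_def)
  define zB where "zB = (SOME zB. orthonormal_frame H zB)"
  define z where "z = fst zB"
  define B where "B = snd zB"
  have "orthonormal_frame H zB"
    unfolding zB_def by (rule someI_ex[OF orthonormal_frame_exists]) fact
  then have orth: "pairwise orthogonal B" and unit: "\<And>b. b \<in> B \<Longrightarrow> norm b = 1"
    and H: "H = (\<lambda>v. z + v) ` span B"
    by (auto simp: orthonormal_frame_def z_def B_def)
  have "z \<in> H" unfolding H using span_zero by force
  then have z: "n \<bullet> z = c" by (simp add: H_def)
  have perp: "n \<bullet> v = 0" if "v \<in> span B" for v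
  proof -
    have "z + v \<in> H" using that unfolding H by blast
    then show ?thesis using z by (simp add: H_def inner_add_right)
  qed
  have span_perp: "v \<in> span B" if "n \<bullet> v = 0" for v
  proof -
    have "z + v \<in> H" using that z by (simp add: H_def inner_add_right)
    then show ?thesis unfolding H by auto
  qed
  have nB: "n \<bullet> b = 0" if "b \<in> B" for b using perp that span_base by blast
  then have notin: "n \<notin> B" using nn by force
  have orth': "pairwise orthogonal (insert n B)"
    using orth nB by (auto simp: pairwise_insert orthogonal_def inner_commute)
  have fin: "finite B"
    using pairwise_orthogonal_independent[OF orth] unit independent_imp_finite by force
  have "y \<in> span (insert n B)" for y
  proof -
    have "y - (n \<bullet> y) *\<^sub>R n \<in> span B"
      by (rule span_perp) (simp add: inner_diff_right nn)
    then have "y - (n \<bullet> y) *\<^sub>R n \<in> span (insert n B)"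
      by (meson span_mono subsetD subset_insertI)
    moreover have "(n \<bullet> y) *\<^sub>R n \<in> span (insert n B)" by (simp add: span_base span_scale)
    ultimately show ?thesis using span_add by fastforce
  qed
  then have "lborel = distr (\<Pi>\<^sub>M b\<in>insert n B. lborel) borel (\<lambda>f. \<Sum>b\<in>insert n B. f b *\<^sub>R b)"
    using orth' unit n by (intro lborel_orthonormal_basis) auto
  moreover have "hyperplane_measure {y. n \<bullet> y = c}
      = distr (\<Pi>\<^sub>M b\<in>B. lborel) borel (\<lambda>f. z + (\<Sum>b\<in>B. f b *\<^sub>R b))"
    by (simp add: hyperplane_measure_def Let_def z_def B_def zB_def H_def)
  ultimately show ?thesis using that fin notin z nB by blast
qed

lemma AE_hyperplane_measure:
  fixes n :: "'a::euclidean_space"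
  assumes n: "norm n = 1"
  shows "AE y in hyperplane_measure {y. n \<bullet> y = c}. n \<bullet> y = c"
proof -
  obtain z B where z: "n \<bullet> z = c" and B: "\<And>b. b \<in> B \<Longrightarrow> n \<bullet> b = 0"
    and H: "hyperplane_measure {y. n \<bullet> y = c}
      = distr (\<Pi>\<^sub>M b\<in>B. lborel) borel (\<lambda>f. z + (\<Sum>b\<in>B. f b *\<^sub>R b))"
    by (rule hyperplane_measure_frame[OF n, of c]) blast
  have "n \<bullet> (z + (\<Sum>b\<in>B. f b *\<^sub>R b)) = c" for f
    using B by (simp add: inner_add_right inner_sum_right z)
  then show ?thesis unfolding H by (subst AE_distr_iff) auto
qed

lemma nn_integral_slices:
  fixes n :: "'a::euclidean_space"
  assumes n: "norm n = 1" and f [measurable]: "f \<in> borel_measurable borel"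
  shows "(\<integral>\<^sup>+y. f y \<partial>lborel)
    = (\<integral>\<^sup>+t. (\<integral>\<^sup>+y. f (y + t *\<^sub>R n) \<partial>hyperplane_measure {y. n \<bullet> y = c}) \<partial>lborel)"
proof -
  obtain z B where fin: "finite B" and nB: "n \<notin> B"
    and L: "lborel = distr (\<Pi>\<^sub>M b\<in>insert n B. lborel) borel (\<lambda>f. \<Sum>b\<in>insert n B. f b *\<^sub>R b)"
    and H: "hyperplane_measure {y. n \<bullet> y = c}
      = distr (\<Pi>\<^sub>M b\<in>B. lborel) borel (\<lambda>f. z + (\<Sum>b\<in>B. f b *\<^sub>R b))"
    by (rule hyperplane_measure_frame[OF n, of c]) blast
  interpret product_sigma_finite "\<lambda>_::'a. lborel :: real measure" ..
  have upd: "(\<Sum>b\<in>insert n B. (x(n := t)) b *\<^sub>R b) = t *\<^sub>R n + (\<Sum>b\<in>B. x b *\<^sub>R b)"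
    for x :: "'a \<Rightarrow> real" and t
    using fin nB by (simp add: sum.insert) (auto intro!: sum.cong)
  have "(\<integral>\<^sup>+y. f y \<partial>lborel) = (\<integral>\<^sup>+y. f (z + y) \<partial>lborel)"
    using nn_integral_distr[of "(+) z" lborel borel f] by (simp add: lborel_distr_plus)
  also have "\<dots> = (\<integral>\<^sup>+x. f (z + (\<Sum>b\<in>insert n B. x b *\<^sub>R b)) \<partial>(\<Pi>\<^sub>M b\<in>insert n B. lborel))"
    by (subst L, subst nn_integral_distr) auto
  also have "\<dots> = (\<integral>\<^sup>+t. (\<integral>\<^sup>+x. f (z + (\<Sum>b\<in>insert n B. (x(n := t)) b *\<^sub>R b))
      \<partial>(\<Pi>\<^sub>M b\<in>B. lborel)) \<partial>lborel)"
    using fin nB by (intro product_nn_integral_insert_rev) auto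
  also have "\<dots> = (\<integral>\<^sup>+t. (\<integral>\<^sup>+x. f ((z + (\<Sum>b\<in>B. x b *\<^sub>R b)) + t *\<^sub>R n)
      \<partial>(\<Pi>\<^sub>M b\<in>B. lborel)) \<partial>lborel)"
    by (simp only: upd add.assoc add.commute[of "t *\<^sub>R n" for t])
  also have "\<dots> = (\<integral>\<^sup>+t. (\<integral>\<^sup>+y. f (y + t *\<^sub>R n) \<partial>hyperplane_measure {y. n \<bullet> y = c}) \<partial>lborel)"
    unfolding H by (subst nn_integral_distr) auto
  finally show ?thesis .
qed

lemma emeasure_lborel_slices:
  fixes n :: "'a::euclidean_space"
  assumes n: "norm n = 1" and A: "A \<in> sets borel"
  shows "emeasure lborel A
    = (\<integral>\<^sup>+t. emeasure (hyperplane_measure {y. n \<bullet> y = c}) {y. n \<bullet> y = c \<and> y + t *\<^sub>R n \<in> A} \<partial>lborel)"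
proof -
  let ?m = "hyperplane_measure {y. n \<bullet> y = c}"
  note [measurable] = A
  have "(\<integral>\<^sup>+y. indicator A (y + t *\<^sub>R n) \<partial>?m) = emeasure ?m {y. n \<bullet> y = c \<and> y + t *\<^sub>R n \<in> A}" for t
  proof -
    have "(\<integral>\<^sup>+y. indicator A (y + t *\<^sub>R n) \<partial>?m)
        = (\<integral>\<^sup>+y. indicator {y. n \<bullet> y = c \<and> y + t *\<^sub>R n \<in> A} y \<partial>?m)"
      using AE_hyperplane_measure[OF n, of c]
      by (intro nn_integral_cong_AE) (auto elim!: eventually_mono simp: indicator_def)
    also have "\<dots> = emeasure ?m {y. n \<bullet> y = c \<and> y + t *\<^sub>R n \<in> A}"
      by (intro nn_integral_indicator) (simp add: sets_hyperplane_measure)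
    finally show ?thesis .
  qed
  then show ?thesis
    using nn_integral_slices[OF n, of "indicator A" c] by simp
qed

text \<open>
Over a subset of the hyperplane, the cylinder in direction \<open>n\<close> of height \<open>t\<close> has
\<open>t\<close> times its hyperplane measure as volume. A homothety maps the cylinder of height 1
over \<open>X\<close> to the one of height \<open>t\<close> over the image of \<open>X\<close>, and it scales volumes by
the full power of \<open>t\<close>; dividing by \<open>t\<close> leaves one power less. The
condition on \<open>a\<close> says that the hyperplane is mapped to itself.
\<close>

lemma emeasure_hyperplane_measure_homothety:
  fixes n :: "'a::euclidean_space"
  assumes n: "norm n = 1" and X: "X \<in> sets borel" "X \<subseteq> {y. n \<bullet> y = c}"
    and t: "t > 0" and a: "n \<bullet> a + t * c = c"
  shows "emeasure (hyperplane_measure {y. n \<bullet> y = c}) {y. (1 / t) *\<^sub>R (y - a) \<in> X}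
    = ennreal (t ^ (DIM('a) - 1)) * emeasure (hyperplane_measure {y. n \<bullet> y = c}) X"
proof -
  let ?m = "hyperplane_measure {y. n \<bullet> y = c}"
  have nn: "n \<bullet> n = 1" using n by (simp add: norm_eq_1)
  note [measurable] = X(1)
  define T where "T X h = {y. 0 \<le> n \<bullet> y - c \<and> n \<bullet> y - c \<le> h \<and> y - (n \<bullet> y - c) *\<^sub>R n \<in> X}"
    for X :: "'a set" and h
  have Tm: "T X h \<in> sets borel" if [measurable]: "X \<in> sets borel" for X h
    unfolding T_def by measurable
  have vol: "emeasure lborel (T X h) = ennreal h * emeasure ?m X"
    if "X \<in> sets borel" "X \<subseteq> {y. n \<bullet> y = c}" "h > 0" for X h
  proof -
    have "{y. n \<bullet> y = c \<and> y + s *\<^sub>R n \<in> T X h} = (if 0 \<le> s \<and> s \<le> h then X else {})" for s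
      using that(2) by (auto simp: T_def inner_add_right nn)
    then have "emeasure lborel (T X h) = (\<integral>\<^sup>+s. emeasure ?m X * indicator {0..h} s \<partial>lborel)"
      by (subst emeasure_lborel_slices[OF n Tm[OF that(1)], where c = c])
         (auto intro!: nn_integral_cong simp: indicator_def)
    also have "\<dots> = ennreal h * emeasure ?m X"
      using that(3) by (subst nn_integral_cmult_indicator) (simp_all add: mult.commute)
    finally show ?thesis .
  qed
  define X' where "X' = {y. (1 / t) *\<^sub>R (y - a) \<in> X}"
  have X': "X' \<in> sets borel" unfolding X'_def by measurable
  have X'H: "X' \<subseteq> {y. n \<bullet> y = c}"
  proof
    fix y assume "y \<in> X'"
    then have "n \<bullet> ((1 / t) *\<^sub>R (y - a)) = c" using X(2) by (auto simp: X'_def)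
    then have "n \<bullet> y - n \<bullet> a = t * c" using t by (simp add: inner_diff_right field_simps)
    then show "y \<in> {y. n \<bullet> y = c}" using a by simp
  qed
  have mem: "a + t *\<^sub>R y \<in> T X' t \<longleftrightarrow> y \<in> T X 1" for y
  proof -
    have 1: "n \<bullet> (a + t *\<^sub>R y) - c = t * (n \<bullet> y - c)"
      using a by (simp add: inner_add_right algebra_simps)
    have 2: "(1 / t) *\<^sub>R (a + t *\<^sub>R y - (t * (n \<bullet> y - c)) *\<^sub>R n - a) = y - (n \<bullet> y - c) *\<^sub>R n"
      using t by (simp add: scaleR_diff_right)
    show ?thesis
      using t unfolding T_def mem_Collect_eq 1 X'_def 2
      by (simp add: zero_le_mult_iff)
  qed
  have "ennreal t * emeasure ?m X' = emeasure lborel (T X' t)"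
    using vol[OF X' X'H t] by simp
  also have "\<dots> = emeasure (density (distr lborel borel (\<lambda>x. a + t *\<^sub>R x)) (\<lambda>_. ennreal (\<bar>t\<bar> ^ DIM('a)))) (T X' t)"
    using t by (subst lborel_affine[of t a]) auto
  also have "\<dots> = ennreal (t ^ DIM('a)) * emeasure lborel (T X 1)"
  proof -
    have "(\<lambda>x. a + t *\<^sub>R x) -` T X' t = T X 1" using mem by auto
    then show ?thesis using t Tm[OF X'] by (simp add: emeasure_density nn_integral_cmult_indicator emeasure_distr)
  qed
  also have "\<dots> = ennreal (t ^ DIM('a)) * emeasure ?m X" using vol[OF X, of 1] by simp
  also have "\<dots> = ennreal t * (ennreal (t ^ (DIM('a) - 1)) * emeasure ?m X)"
  proof -
    have "t ^ DIM('a) = t * t ^ (DIM('a) - 1)"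
      by (metis DIM_positive Suc_diff_1 power_Suc)
    then show ?thesis using t by (simp add: ennreal_mult mult.assoc)
  qed
  finally have "ennreal t * emeasure ?m X' = ennreal t * (ennreal (t ^ (DIM('a) - 1)) * emeasure ?m X)" .
  then show ?thesis using t unfolding X'_def by (simp add: ennreal_mult_cancel_left)
qed

text \<open>
The set of points that reach \<open>X\<close> when they move along \<open>w\<close> for a time in
\<open>[0, 1]\<close>; \<open>\<tau> y\<close> is the time at which \<open>y\<close> meets the hyperplane.
Its nonempty slices parallel to the hyperplane are translates of \<open>X\<close>, and their heights form an interval
of length \<open>\<bar>n \<bullet> w\<bar>\<close>.
\<close>

lemma emeasure_sweep:
  fixes n :: "'a::euclidean_space"
  assumes n: "norm n = 1" and X: "X \<in> sets borel" "X \<subseteq> {y. n \<bullet> y = c}" and w: "n \<bullet> w \<noteq> 0"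
  defines "\<tau> \<equiv> (\<lambda>y. (c - n \<bullet> y) / (n \<bullet> w))"
  shows "{y. 0 \<le> \<tau> y \<and> \<tau> y \<le> 1 \<and> y + \<tau> y *\<^sub>R w \<in> X} \<in> sets borel" (is "?S \<in> _")
    and "emeasure lborel {y. 0 \<le> \<tau> y \<and> \<tau> y \<le> 1 \<and> y + \<tau> y *\<^sub>R w \<in> X}
      = ennreal \<bar>n \<bullet> w\<bar> * emeasure (hyperplane_measure {y. n \<bullet> y = c}) X"
proof -
  let ?m = "hyperplane_measure {y. n \<bullet> y = c}"
  let ?k = "n \<bullet> w"
  have nn: "n \<bullet> n = 1" using n by (simp add: norm_eq_1)
  note [measurable] = X(1)
  show S: "?S \<in> sets borel" unfolding \<tau>_def by measurable
  define I where "I = {min 0 (- ?k) .. max 0 (- ?k)}"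
  have slice: "{y. n \<bullet> y = c \<and> y + s *\<^sub>R n \<in> ?S}
      = (if s \<in> I then {y. (1 / 1) *\<^sub>R (y - ((s / ?k) *\<^sub>R w - s *\<^sub>R n)) \<in> X} else {})" for s
  proof -
    have \<tau>: "\<tau> (y + s *\<^sub>R n) = - s / ?k" if "n \<bullet> y = c" for y
      using that by (simp add: \<tau>_def inner_add_right nn)
    have "0 \<le> - s / ?k \<and> - s / ?k \<le> 1 \<longleftrightarrow> s \<in> I"
      using w unfolding I_def by (auto simp: field_simps min_def max_def split: if_splits)
    moreover have "n \<bullet> y = c" if "y - ((s / ?k) *\<^sub>R w - s *\<^sub>R n) \<in> X" for y
      using that X(2) w by (auto simp: inner_diff_right nn dest!: subsetD)
    moreover have "n \<bullet> y = c \<and> y + s *\<^sub>R n \<in> ?S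
        \<longleftrightarrow> n \<bullet> y = c \<and> 0 \<le> - s / ?k \<and> - s / ?k \<le> 1 \<and> y - ((s / ?k) *\<^sub>R w - s *\<^sub>R n) \<in> X" for y
    proof (cases "n \<bullet> y = c")
      case True
      have "y + s *\<^sub>R n + (- s / ?k) *\<^sub>R w = y - ((s / ?k) *\<^sub>R w - s *\<^sub>R n)" by simp
      then show ?thesis unfolding mem_Collect_eq \<tau>[OF True] by (simp only: True simp_thms)
    qed simp
    ultimately show ?thesis by auto
  qed
  have "emeasure ?m {y. (1 / 1) *\<^sub>R (y - ((s / ?k) *\<^sub>R w - s *\<^sub>R n)) \<in> X} = emeasure ?m X" for s
    using w by (subst emeasure_hyperplane_measure_homothety[OF n X]) (auto simp: inner_diff_right nn)
  then have "emeasure lborel ?S = (\<integral>\<^sup>+s. emeasure ?m X * indicator I s \<partial>lborel)"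
    unfolding emeasure_lborel_slices[OF n S, where c = c] slice
    by (intro nn_integral_cong) (auto simp: indicator_def)
  also have "\<dots> = ennreal \<bar>?k\<bar> * emeasure ?m X"
    unfolding I_def by (subst nn_integral_cmult_indicator) (simp_all add: mult.commute abs_if min_def max_def)
  finally show "emeasure lborel ?S = ennreal \<bar>?k\<bar> * emeasure ?m X" .
qed

text \<open>
Only the half of the pyramid next to its base is counted. There each slice is a copy of
\<open>X\<close> scaled by at least 1/2. The exact volume has $1/N$ in place of $1/2^N$; the cruder
constant avoids integrating the powers of the scaling factor.
\<close>

lemma emeasure_pyramid_ge:
  fixes n :: "'a::euclidean_space"
  assumes n: "norm n = 1" and X: "X \<in> sets borel" "X \<subseteq> {y. n \<bullet> y = c}" and d: "n \<bullet> a = c + d" "d > 0"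
    and P: "P \<in> sets borel" "\<And>q t. q \<in> X \<Longrightarrow> 0 < t \<Longrightarrow> t < 1 \<Longrightarrow> (1 - t) *\<^sub>R a + t *\<^sub>R q \<in> P"
  shows "ennreal (d / 2 ^ DIM('a)) * emeasure (hyperplane_measure {y. n \<bullet> y = c}) X \<le> emeasure lborel P"
proof -
  let ?m = "hyperplane_measure {y. n \<bullet> y = c}"
  let ?N = "DIM('a) - 1"
  have nn: "n \<bullet> n = 1" using n by (simp add: norm_eq_1)
  note [measurable] = X(1) P(1)
  have slice: "ennreal ((1 / 2) ^ ?N) * emeasure ?m X \<le> emeasure ?m {y. n \<bullet> y = c \<and> y + s *\<^sub>R n \<in> P}"
    if s: "0 < s" "s < d / 2" for s
  proof -
    define t where "t = 1 - s / d"
    have sd: "s = (1 - t) * d" using d by (simp add: t_def)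
    have t: "1 / 2 < t" "t < 1" using s d by (auto simp: t_def field_simps)
    define e where "e = (1 - t) *\<^sub>R a - s *\<^sub>R n"
    have e: "n \<bullet> e + t * c = c"
      by (simp add: e_def inner_diff_right nn d(1) sd algebra_simps)
    have "{y. (1 / t) *\<^sub>R (y - e) \<in> X} \<subseteq> {y. n \<bullet> y = c \<and> y + s *\<^sub>R n \<in> P}"
    proof
      fix y assume "y \<in> {y. (1 / t) *\<^sub>R (y - e) \<in> X}"
      then have q: "(1 / t) *\<^sub>R (y - e) \<in> X" by simp
      then have "n \<bullet> ((1 / t) *\<^sub>R (y - e)) = c" using X(2) by auto
      then have "n \<bullet> y - n \<bullet> e = t * c" using t by (simp add: inner_diff_right field_simps)
      moreover have "(1 - t) *\<^sub>R a + t *\<^sub>R ((1 / t) *\<^sub>R (y - e)) = y + s *\<^sub>R n"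
        using t by (simp add: e_def)
      moreover have "(1 - t) *\<^sub>R a + t *\<^sub>R ((1 / t) *\<^sub>R (y - e)) \<in> P"
        using t by (intro P(2)[OF q]) auto
      ultimately show "y \<in> {y. n \<bullet> y = c \<and> y + s *\<^sub>R n \<in> P}" using e by simp
    qed
    then have "emeasure ?m {y. (1 / t) *\<^sub>R (y - e) \<in> X} \<le> emeasure ?m {y. n \<bullet> y = c \<and> y + s *\<^sub>R n \<in> P}"
      by (intro emeasure_mono) (simp_all add: sets_hyperplane_measure)
    moreover have "emeasure ?m {y. (1 / t) *\<^sub>R (y - e) \<in> X} = ennreal (t ^ ?N) * emeasure ?m X"
      using t e by (intro emeasure_hyperplane_measure_homothety[OF n X]) auto
    moreover have "ennreal ((1 / 2) ^ ?N) \<le> ennreal (t ^ ?N)"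
      using t by (intro ennreal_leI power_mono) auto
    moreover from this have "ennreal ((1 / 2) ^ ?N) * emeasure ?m X \<le> ennreal (t ^ ?N) * emeasure ?m X"
      by (rule mult_right_mono) simp
    ultimately show ?thesis by simp
  qed
  have "ennreal (d / 2 ^ DIM('a)) = ennreal ((1 / 2) ^ ?N) * ennreal (d / 2)"
  proof -
    have "(2::real) ^ DIM('a) = 2 * 2 ^ ?N" by (metis DIM_positive Suc_diff_1 power_Suc)
    then show ?thesis using d(2) by (simp add: ennreal_mult[symmetric] power_one_over)
  qed
  then have "ennreal (d / 2 ^ DIM('a)) * emeasure ?m X
      = (\<integral>\<^sup>+s. (ennreal ((1 / 2) ^ ?N) * emeasure ?m X) * indicator {0<..<d/2} s \<partial>lborel)"
    using d(2) by (subst nn_integral_cmult_indicator) (simp_all add: mult_ac)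
  also have "\<dots> \<le> (\<integral>\<^sup>+s. emeasure ?m {y. n \<bullet> y = c \<and> y + s *\<^sub>R n \<in> P} \<partial>lborel)"
    using slice by (intro nn_integral_mono) (auto simp: indicator_def)
  also have "\<dots> = emeasure lborel P" by (rule emeasure_lborel_slices[OF n P(1), symmetric])
  finally show ?thesis .
qed

section \<open>Pyramids and unions of polyhedra\<close>

text \<open>
Apex and base are left out, so that the pyramid over a relatively open base is open and the
pyramids over the faces of one cell are disjoint.
\<close>

definition pyramid :: "'a::euclidean_space \<Rightarrow> 'a set \<Rightarrow> 'a set" where
  "pyramid a X = {(1 - t) *\<^sub>R a + t *\<^sub>R q |t q. 0 < t \<and> t < 1 \<and> q \<in> X}"

text \<open>
Near its base the pyramid is everything on the side of the apex. This is what determines a cell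
near one of its faces. The set \<open>W\<close> consists of the points whose central
projection from \<open>a\<close> to the hyperplane lies in the open set that cuts out \<open>X\<close>.
\<close>

lemma pyramid_open_neighbourhood:
  fixes n a :: "'a::euclidean_space"
  assumes X: "openin (top_of_set {y. n \<bullet> y = c}) X" and a: "n \<bullet> a \<noteq> c"
  obtains W where "open W" "X \<subseteq> W" "pyramid a X = W \<inter> {y. (n \<bullet> y - c) * (n \<bullet> a - c) > 0}"
proof -
  obtain U where U: "open U" "X = {y. n \<bullet> y = c} \<inter> U" using X by (auto simp: openin_open)
  \<comment> \<open>\<tau> is 0 on the level of the apex and 1 on the hyperplane; f is the central projection.\<close>
  define \<tau> where "\<tau> y = (n \<bullet> a - n \<bullet> y) / (n \<bullet> a - c)" for y
  define f where "f y = a + (1 / \<tau> y) *\<^sub>R (y - a)" for y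
  define W where "W = {y. \<tau> y > 0} \<inter> f -` U"
  have cont: "continuous_on A \<tau>" for A unfolding \<tau>_def using a by (intro continuous_intros) auto
  have "open {y. \<tau> y > 0}"
    using cont[of UNIV] by (intro open_Collect_less) (auto intro: continuous_intros)
  moreover have "continuous_on {y. \<tau> y > 0} f"
    unfolding f_def using cont by (intro continuous_intros) auto
  ultimately have "open W" unfolding W_def using U(1) by (intro continuous_open_preimage)
  moreover have "X \<subseteq> W"
  proof
    fix y assume "y \<in> X"
    moreover from this have "\<tau> y = 1" using a U by (simp add: \<tau>_def)
    ultimately show "y \<in> W" using U by (simp add: W_def f_def)
  qed
  moreover have "pyramid a X = W \<inter> {y. (n \<bullet> y - c) * (n \<bullet> a - c) > 0}"
  proof -
    have lt: "(n \<bullet> y - c) * (n \<bullet> a - c) > 0 \<longleftrightarrow> \<tau> y < 1" for y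
    proof -
      have "\<tau> y = 1 - (n \<bullet> y - c) / (n \<bullet> a - c)" using a by (simp add: \<tau>_def field_simps)
      then show ?thesis by (simp add: zero_less_mult_iff zero_less_divide_iff)
    qed
    have "y \<in> pyramid a X \<longleftrightarrow> y \<in> W \<and> \<tau> y < 1" for y
    proof
      assume "y \<in> pyramid a X"
      then obtain t q where t: "0 < t" "t < 1" and q: "q \<in> X" and y: "y = (1 - t) *\<^sub>R a + t *\<^sub>R q"
        by (auto simp: pyramid_def)
      have nq: "n \<bullet> q = c" using q U by auto
      have "n \<bullet> a - n \<bullet> y = t * (n \<bullet> a - c)" by (simp add: y inner_add_right nq algebra_simps)
      then have \<tau>: "\<tau> y = t" using a by (simp add: \<tau>_def)
      have "y - a = t *\<^sub>R (q - a)" by (simp add: y algebra_simps)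
      then have "f y = q" using t by (simp add: f_def \<tau>)
      then show "y \<in> W \<and> \<tau> y < 1" using t \<tau> q U by (simp add: W_def)
    next
      assume y: "y \<in> W \<and> \<tau> y < 1"
      then have \<tau>: "0 < \<tau> y" "\<tau> y < 1" by (auto simp: W_def)
      have "\<tau> y * (n \<bullet> a - c) = n \<bullet> a - n \<bullet> y" using a by (simp add: \<tau>_def)
      then have "n \<bullet> (y - a) = \<tau> y * (c - n \<bullet> a)" by (simp add: inner_diff_right algebra_simps)
      then have "n \<bullet> f y = c" using \<tau> by (simp add: f_def inner_add_right)
      then have "f y \<in> X" using y U by (simp add: W_def)
      moreover have "y = (1 - \<tau> y) *\<^sub>R a + \<tau> y *\<^sub>R f y"
        using \<tau> by (simp add: f_def algebra_simps)
      ultimately show "y \<in> pyramid a X" using \<tau> unfolding pyramid_def by blast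
    qed
    then show ?thesis using lt by blast
  qed
  ultimately show ?thesis using that by blast
qed

lemma open_pyramid:
  fixes n a :: "'a::euclidean_space"
  assumes X: "openin (top_of_set {y. n \<bullet> y = c}) X" and a: "n \<bullet> a \<noteq> c"
  shows "open (pyramid a X)"
proof -
  obtain W where W: "open W" "pyramid a X = W \<inter> {y. (n \<bullet> y - c) * (n \<bullet> a - c) > 0}"
    using pyramid_open_neighbourhood[OF assms] by metis
  have "open {y. (n \<bullet> y - c) * (n \<bullet> a - c) > 0}"
    by (intro open_Collect_less continuous_intros)
  then show ?thesis using W by auto
qed

text \<open>
A common point would put one point of each base on the same ray from the apex. The nearer of the
two would lie inside the pyramid over the other base, unless they coincide.
\<close>

lemma pyramid_disjoint:
  assumes "X \<inter> Y = {}" "X \<inter> pyramid a Y = {}" "Y \<inter> pyramid a X = {}"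
  shows "pyramid a X \<inter> pyramid a Y = {}"
proof (rule ccontr)
  assume "pyramid a X \<inter> pyramid a Y \<noteq> {}"
  then obtain t q s r where t: "0 < t" "t < 1" "q \<in> X" and s: "0 < s" "s < 1" "r \<in> Y"
    and eq: "(1 - t) *\<^sub>R a + t *\<^sub>R q = (1 - s) *\<^sub>R a + s *\<^sub>R r"
    by (auto simp: pyramid_def)
  from eq have eq': "t *\<^sub>R (q - a) = s *\<^sub>R (r - a)" by (simp add: algebra_simps)
  have in_pyramid: "q \<in> pyramid a Y"
    if "0 < t" "0 < s" "s < t" "r \<in> Y" "t *\<^sub>R (q - a) = s *\<^sub>R (r - a)" for t s q r Y
  proof -
    have "q - a = (1 / t) *\<^sub>R (t *\<^sub>R (q - a))" using that(1) by simp
    also have "\<dots> = (s / t) *\<^sub>R (r - a)" by (simp only: that(5)) simp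
    finally have "q - a = (s / t) *\<^sub>R (r - a)" .
    then have "q = (1 - s / t) *\<^sub>R a + (s / t) *\<^sub>R r" by (simp add: algebra_simps)
    moreover have "0 < s / t" "s / t < 1" using that by auto
    ultimately show ?thesis using that unfolding pyramid_def by blast
  qed
  consider "s < t" | "t < s" | "s = t" by linarith
  then show False
  proof cases
    case 1
    then show ?thesis using in_pyramid[of t s r Y q] t s eq' assms(2) by auto
  next
    case 2
    then show ?thesis using in_pyramid[of s t q X r] t s eq' assms(3) by auto
  next
    case 3
    then show ?thesis using t s eq' assms(1) by auto
  qed
qed

text \<open>
Relative to \<open>H\<close>, a finite union of polyhedra is a neighbourhood of all its points outside
finitely many hyperplanes, none of which contains \<open>H\<close>. They are the bounding hyperplanes of the
polyhedra that do not contain \<open>H\<close>: a half-space whose bounding hyperplane contains \<open>H\<close> does not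
restrict the points of \<open>H\<close> at all. With the whole space as \<open>H\<close> this locates the
frontier of a cell, and with a hyperplane as \<open>H\<close> the relative boundary of a face.
\<close>

lemma finite_Union_polyhedra_interior_points:
  fixes P :: "'a::euclidean_space set set"
  assumes fin: "finite P" and poly: "\<forall>Q\<in>P. polyhedron Q"
  shows "\<exists>G :: ('a \<times> real) set. finite G \<and> (\<forall>(a, b)\<in>G. a \<noteq> 0 \<and> \<not> H \<subseteq> {y. a \<bullet> y = b}) \<and>
    (\<forall>q\<in>\<Union>P. (\<forall>(a, b)\<in>G. a \<bullet> q \<noteq> b) \<longrightarrow> (\<exists>T. open T \<and> q \<in> T \<and> T \<inter> H \<subseteq> \<Union>P))"
proof -
  have "\<forall>Q\<in>P. \<exists>F. finite F \<and> Q = \<Inter>F \<and> (\<forall>h\<in>F. \<exists>a b. a \<noteq> 0 \<and> h = {x. a \<bullet> x \<le> b})"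
    using poly unfolding polyhedron_def by blast
  then obtain F where F: "\<And>Q. Q \<in> P \<Longrightarrow> finite (F Q)" "\<And>Q. Q \<in> P \<Longrightarrow> Q = \<Inter>(F Q)"
    "\<And>Q h. Q \<in> P \<Longrightarrow> h \<in> F Q \<Longrightarrow> \<exists>a b. a \<noteq> 0 \<and> h = {x. a \<bullet> x \<le> b}"
    by metis
  have "\<forall>h\<in>\<Union>(F ` P). \<exists>ab. fst ab \<noteq> 0 \<and> h = {x. fst ab \<bullet> x \<le> snd ab}"
    using F(3) by fastforce
  then obtain ab where ab1: "\<forall>h\<in>\<Union>(F ` P). fst (ab h) \<noteq> 0 \<and> h = {x. fst (ab h) \<bullet> x \<le> snd (ab h)}"
    by (rule bchoice[THEN exE])
  then have ab: "fst (ab h) \<noteq> 0" "\<And>x. x \<in> h \<longleftrightarrow> fst (ab h) \<bullet> x \<le> snd (ab h)"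
    if "Q \<in> P" "h \<in> F Q" for Q h
    using that by blast+
  define G where "G = {(a, b). (a, b) \<in> ab ` \<Union>(F ` P) \<and> \<not> H \<subseteq> {y. a \<bullet> y = b}}"
  have finG: "finite G" unfolding G_def
    using fin F(1) by (intro finite_subset[OF _ finite_imageI[of "\<Union>(F ` P)" ab]]) auto
  have properG: "a \<noteq> 0 \<and> \<not> H \<subseteq> {y. a \<bullet> y = b}" if "(a, b) \<in> G" for a b
    using that ab(1) unfolding G_def by (auto, metis fst_conv)
  have nbhd: "\<exists>T. open T \<and> q \<in> T \<and> T \<inter> H \<subseteq> \<Union>P"
    if q: "q \<in> \<Union>P" and off: "\<And>a b. (a, b) \<in> G \<Longrightarrow> a \<bullet> q \<noteq> b" for q
  proof -
    obtain Q where Q: "Q \<in> P" "q \<in> Q" using q by blast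
    \<comment> \<open>The half-spaces of Q that hold strictly at q define the neighbourhood T.\<close>
    define F' where "F' = {h \<in> F Q. fst (ab h) \<bullet> q < snd (ab h)}"
    define T where "T = (\<Inter>h\<in>F'. {x. fst (ab h) \<bullet> x < snd (ab h)})"
    have "open T" unfolding T_def F'_def using F(1)[OF Q(1)]
      by (intro open_INT ballI open_Collect_less continuous_intros) auto
    moreover have "q \<in> T" by (auto simp: T_def F'_def)
    moreover have "y \<in> Q" if y: "y \<in> T" "y \<in> H" for y
    proof -
      have "y \<in> h" if h: "h \<in> F Q" for h
      proof (cases "h \<in> F'")
        case True
        then have "fst (ab h) \<bullet> y < snd (ab h)" using y by (auto simp: T_def)
        then show ?thesis using ab(2)[OF Q(1) h] by auto
      next
        case False
        have "q \<in> h" using Q h F(2) by blast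
        then have "fst (ab h) \<bullet> q = snd (ab h)" using False h ab(2)[OF Q(1) h] unfolding F'_def by auto
        then have "ab h \<notin> G" using off by (metis prod.collapse)
        then have "H \<subseteq> {y. fst (ab h) \<bullet> y = snd (ab h)}"
          using h Q unfolding G_def by (auto simp: case_prod_beta)
        then show ?thesis using y ab(2)[OF Q(1) h] by auto
      qed
      then show ?thesis using F(2)[OF Q(1)] by blast
    qed
    ultimately show ?thesis using Q(1) by blast
  qed
  show ?thesis
  proof (intro exI[of _ G] conjI ballI impI)
    fix q assume "q \<in> \<Union>P" "\<forall>(a, b)\<in>G. a \<bullet> q \<noteq> b"
    then show "\<exists>T. open T \<and> q \<in> T \<and> T \<inter> H \<subseteq> \<Union>P" by (intro nbhd) auto
  qed (use finG properG in auto)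
qed

lemma null_sets_hyperplane:
  fixes a :: "'a::euclidean_space"
  assumes "a \<noteq> 0"
  shows "{y. a \<bullet> y = b} \<in> null_sets lborel"
proof -
  have "{y. a \<bullet> y = b} \<in> null_sets lebesgue"
    using negligible_hyperplane[of a b] assms by (simp add: negligible_iff_null_sets)
  moreover have "{y. a \<bullet> y = b} \<in> sets borel" by measurable
  ultimately show ?thesis by (simp add: null_sets_completion_iff)
qed

lemma hyperplane_face_normal:
  fixes \<sigma> :: "'a::euclidean_space set"
  assumes "hyperplane_face \<sigma>"
  obtains n c where "norm n = 1" "affine hull \<sigma> = {y. n \<bullet> y = c}"
    "openin (top_of_set {y. n \<bullet> y = c}) \<sigma>"
proof -
  obtain a b where a: "a \<noteq> 0" and op: "openin (top_of_set {y. a \<bullet> y = b}) \<sigma>" and ne: "\<sigma> \<noteq> {}"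
    using assms by (auto simp: hyperplane_face_def hyperplane_def)
  have eq: "{y. a \<bullet> y = b} = {y. (a /\<^sub>R norm a) \<bullet> y = b / norm a}"
    using a by (auto simp: field_simps)
  have H: "affine hull {y. a \<bullet> y = b} = {y. a \<bullet> y = b}"
    by (simp only: affine_hull_eq affine_hyperplane)
  then have "affine hull \<sigma> = {y. a \<bullet> y = b}"
    using op ne by (metis H affine_hull_openin)
  then show ?thesis using that[of "a /\<^sub>R norm a" "b / norm a"] op a unfolding eq by simp
qed

lemma open_subset_hyperplane_empty:
  fixes n :: "'a::euclidean_space"
  assumes "open A" "A \<subseteq> {y. n \<bullet> y = c}" "n \<noteq> 0"
  shows "A = {}"
  using interior_maximal[OF assms(2,1)] interior_hyperplane[OF assms(3), of c] by simp

text \<open>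
Every slice of a small ball in \<open>A\<close> by a parallel of a hyperplane through its centre projects
into the ball, hence into a null set of that hyperplane. By slicing, the ball would be a null set.
\<close>

lemma hyperplane_null_open_empty:
  fixes A :: "'a::euclidean_space set"
  assumes "open A" "A \<subseteq> S" "S \<in> sets borel" "hyperplane_null S"
  shows "A = {}"
proof (rule ccontr)
  assume "A \<noteq> {}"
  then obtain y0 r where r: "r > 0" "ball y0 r \<subseteq> S"
    using assms(1,2) by (meson ex_in_conv open_contains_ball order_trans)
  obtain n :: 'a where n: "norm n = 1" using vector_choose_size[of 1] by auto
  have nn: "n \<bullet> n = 1" using n by (simp add: norm_eq_1)
  let ?H = "{y. n \<bullet> y = n \<bullet> y0}"
  have "hyperplane ?H" using n by (auto simp: hyperplane_def intro!: exI[of _ n])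
  then have null: "emeasure (hyperplane_measure ?H) S = 0" using assms(4) by (simp add: hyperplane_null_def)
  have "emeasure (hyperplane_measure ?H) {y. n \<bullet> y = n \<bullet> y0 \<and> y + t *\<^sub>R n \<in> ball y0 r} = 0" for t
  proof -
    have "{y. n \<bullet> y = n \<bullet> y0 \<and> y + t *\<^sub>R n \<in> ball y0 r} \<subseteq> ball y0 r"
    proof
      fix y assume y: "y \<in> {y. n \<bullet> y = n \<bullet> y0 \<and> y + t *\<^sub>R n \<in> ball y0 r}"
      have "(norm (y + t *\<^sub>R n - y0))\<^sup>2 = (norm (y - y0))\<^sup>2 + t\<^sup>2"
        using y unfolding power2_norm_eq_inner
        by (simp add: inner_add inner_diff inner_commute nn power2_eq_square)
      then have "(norm (y - y0))\<^sup>2 \<le> (norm (y + t *\<^sub>R n - y0))\<^sup>2" by simp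
      then have "norm (y - y0) \<le> norm (y + t *\<^sub>R n - y0)"
        by (rule power2_le_imp_le) simp
      then show "y \<in> ball y0 r" using y by (simp add: dist_norm norm_minus_commute)
    qed
    then have "{y. n \<bullet> y = n \<bullet> y0 \<and> y + t *\<^sub>R n \<in> ball y0 r} \<subseteq> S" using r by blast
    then have "emeasure (hyperplane_measure ?H) {y. n \<bullet> y = n \<bullet> y0 \<and> y + t *\<^sub>R n \<in> ball y0 r}
        \<le> emeasure (hyperplane_measure ?H) S"
      using assms(3) by (intro emeasure_mono) (auto simp: sets_hyperplane_measure)
    then show ?thesis using null by simp
  qed
  then have "emeasure lborel (ball y0 r) = 0"
    by (subst emeasure_lborel_slices[OF n, where c = "n \<bullet> y0"]) auto
  then have "unit_ball_vol (real DIM('a)) * r ^ DIM('a) \<le> 0"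
    using r by (simp add: emeasure_ball ennreal_eq_0_iff)
  moreover have "unit_ball_vol (real DIM('a)) * r ^ DIM('a) > 0" using r by simp
  ultimately show False by linarith
qed

section \<open>Geometry of a regular mesh\<close>

locale regular_mesh = mesh \<Omega> M E EK x
  for \<Omega> :: "'a::euclidean_space set" and M E EK x +
  fixes \<xi> :: real
  assumes bounded_domain: "bounded \<Omega>"
    and open_domain: "open \<Omega>"
    and \<xi>_pos: "\<xi> > 0"
    and regular: "mesh_regular \<Omega> M E EK x \<xi>"
begin

lemma interface_sym: "interface M E K L \<sigma> \<longleftrightarrow> interface M E L K \<sigma>"
  by (auto simp: interface_def)

lemma open_cell: "K \<in> M \<Longrightarrow> open K"
  using cells by (auto simp: open_polyhedral_def)

lemma interior_closure_cell: "K \<in> M \<Longrightarrow> interior (closure K) = K"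
  using cells by (auto simp: open_polyhedral_def)

lemma interface_subset_closure:
  assumes "interface M E K L \<sigma>"
  shows "\<sigma> \<subseteq> closure K" "\<sigma> \<subseteq> closure L" "closure \<sigma> = closure K \<inter> closure L"
  using assms closure_subset[of \<sigma>] by (auto simp: interface_def)

text \<open>
The common part of two cells is open. If they share a face it lies in a hyperplane, and otherwise it is
null in every hyperplane; in both cases it is empty.
\<close>

lemma cells_disjoint:
  assumes "K \<in> M" "L \<in> M" "K \<noteq> L"
  shows "K \<inter> L = {}"
  using conforming[OF assms]
proof
  assume "hyperplane_null (closure K \<inter> closure L)"
  then show ?thesis
    using hyperplane_null_open_empty[of "K \<inter> L" "closure K \<inter> closure L"] open_cell assms
      closure_subset[of K] closure_subset[of L] by auto
next
  assume "\<exists>\<sigma>. interface M E K L \<sigma>"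
  then obtain \<sigma> where \<sigma>: "interface M E K L \<sigma>" ..
  then obtain n c where n: "norm n = 1" "affine hull \<sigma> = {y. n \<bullet> y = c}"
    using hyperplane_face_normal faces unfolding interface_def by metis
  have "K \<inter> L \<subseteq> closure \<sigma>"
    using interface_subset_closure(3)[OF \<sigma>] closure_subset[of K] closure_subset[of L] by blast
  also have "\<dots> \<subseteq> {y. n \<bullet> y = c}"
    using closure_minimal[of \<sigma> "{y. n \<bullet> y = c}"] hull_subset[of \<sigma> affine] n(2) closed_hyperplane by auto
  finally show ?thesis
    using open_cell assms n by (intro open_subset_hyperplane_empty[of _ n c]) auto
qed

text \<open>
This is where the regularity constraint shapes the cells: it makes the pyramids over interior
faces nondegenerate.
\<close>

lemma point_off_interface:
  assumes "interface M E K L \<sigma>"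
  shows "x K \<notin> affine hull \<sigma>"
proof
  assume "x K \<in> affine hull \<sigma>"
  then have "face_dist (x K) \<sigma> = 0" by (simp add: face_dist_def)
  moreover have "face_dist (x K) \<sigma> \<ge> \<xi> * dist (x K) (x L)"
    using regular assms interface_faces[OF assms] by (auto simp: mesh_regular_def interface_def)
  moreover have "\<xi> * dist (x K) (x L) > 0" using \<xi>_pos points_distinct[OF assms] by simp
  ultimately show False by simp
qed

lemma star_shaped_closure:
  assumes K: "K \<in> M" and q: "q \<in> closure K" and t: "0 \<le> t" "t \<le> 1"
  shows "(1 - t) *\<^sub>R x K + t *\<^sub>R q \<in> closure K"
proof -
  have "(\<lambda>y. (1 - t) *\<^sub>R x K + t *\<^sub>R y) ` closure K \<subseteq> closure K"
  proof (rule image_closure_subset)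
    show "(\<lambda>y. (1 - t) *\<^sub>R x K + t *\<^sub>R y) ` K \<subseteq> closure K"
      using star_shaped[OF K] t closure_subset[of K] unfolding closed_segment_def by blast
  qed (auto intro!: continuous_intros)
  then show ?thesis using q by blast
qed

text \<open>
The open pyramid over \<open>\<sigma>\<close> lies in the closure of the star-shaped cell, hence in
the interior of that closure, which is the cell. So near \<open>\<sigma>\<close> each of \<open>K\<close> and
\<open>L\<close> contains a full side of the hyperplane. These must be different sides because the
cells are disjoint, and no room is left for a third cell.
\<close>

lemma interface_geometry:
  assumes I: "interface M E K L \<sigma>"
  obtains n c where "norm n = 1" "affine hull \<sigma> = {y. n \<bullet> y = c}" "\<sigma> \<subseteq> {y. n \<bullet> y = c}"
    "closure \<sigma> \<subseteq> {y. n \<bullet> y = c}"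
    "openin (top_of_set {y. n \<bullet> y = c}) \<sigma>" "n \<bullet> x K > c" "n \<bullet> x L < c"
    "pyramid (x K) \<sigma> \<subseteq> K" "open (pyramid (x K) \<sigma>)"
    "\<And>q. q \<in> \<sigma> \<Longrightarrow> \<exists>r>0. \<forall>y\<in>ball q r. n \<bullet> y \<noteq> c \<longrightarrow> y \<in> K \<union> L"
proof -
  have KL: "K \<in> M" "L \<in> M" "K \<noteq> L" "hyperplane_face \<sigma>"
    using I faces by (auto simp: interface_def)
  obtain n0 c0 where n0: "norm n0 = 1" "affine hull \<sigma> = {y. n0 \<bullet> y = c0}"
    "openin (top_of_set {y. n0 \<bullet> y = c0}) \<sigma>"
    using hyperplane_face_normal[OF KL(4)] by metis
  \<comment> \<open>The normal is oriented towards K.\<close>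
  define s :: real where "s = (if n0 \<bullet> x K > c0 then 1 else -1)"
  define n where "n = s *\<^sub>R n0"
  define c where "c = s * c0"
  have Heq: "{y. n0 \<bullet> y = c0} = {y. n \<bullet> y = c}" by (auto simp: n_def c_def s_def)
  note n1 = n0(2,3)[unfolded Heq]
  have offK: "n0 \<bullet> x K \<noteq> c0" using point_off_interface[OF I] n0(2) by auto
  have offL: "n \<bullet> x L \<noteq> c" using point_off_interface[OF interface_sym[THEN iffD1, OF I]] n1(1) by auto
  have n: "norm n = 1" using n0(1) by (simp add: n_def s_def)
  have nn: "n \<bullet> n = 1" using n by (simp add: norm_eq_1)
  have xK: "n \<bullet> x K > c" using offK by (auto simp: n_def c_def s_def)
  have sub: "\<sigma> \<subseteq> {y. n \<bullet> y = c}" using hull_subset[of \<sigma> affine] n1(1) by simp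
  have sub': "closure \<sigma> \<subseteq> {y. n \<bullet> y = c}"
    using closure_minimal[OF sub closed_hyperplane] .
  have pyr: "pyramid (x K') \<sigma> \<subseteq> K' \<and> open (pyramid (x K') \<sigma>)"
    if K': "K' \<in> M" "\<sigma> \<subseteq> closure K'" "n \<bullet> x K' \<noteq> c" for K'
  proof -
    have op: "open (pyramid (x K') \<sigma>)" using open_pyramid[OF n1(2) K'(3)] .
    have "pyramid (x K') \<sigma> \<subseteq> closure K'"
      using star_shaped_closure[OF K'(1)] K'(2) by (auto simp: pyramid_def)
    then have "pyramid (x K') \<sigma> \<subseteq> interior (closure K')" using op by (simp add: interior_maximal)
    then show ?thesis using interior_closure_cell[OF K'(1)] op by simp
  qed
  have pK: "pyramid (x K) \<sigma> \<subseteq> K" "open (pyramid (x K) \<sigma>)"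
    using pyr[of K] KL interface_subset_closure[OF I] xK by auto
  have pL: "pyramid (x L) \<sigma> \<subseteq> L"
    using pyr[of L] KL interface_subset_closure[OF I] offL by auto
  obtain W where W: "open W" "\<sigma> \<subseteq> W"
    "pyramid (x K) \<sigma> = W \<inter> {y. (n \<bullet> y - c) * (n \<bullet> x K - c) > 0}"
    using pyramid_open_neighbourhood[OF n1(2), of "x K"] xK by (metis less_irrefl)
  obtain W' where W': "open W'" "\<sigma> \<subseteq> W'"
    "pyramid (x L) \<sigma> = W' \<inter> {y. (n \<bullet> y - c) * (n \<bullet> x L - c) > 0}"
    using pyramid_open_neighbourhood[OF n1(2) offL] by metis
  have ball: "\<exists>r>0. ball q r \<subseteq> W \<inter> W'" if "q \<in> \<sigma>" for q
  proof -
    have "open (W \<inter> W')" "q \<in> W \<inter> W'" using that W(1,2) W'(1,2) by auto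
    then show ?thesis by (simp add: open_contains_ball)
  qed
  have xL: "n \<bullet> x L < c"
  proof (rule ccontr)
    assume "\<not> n \<bullet> x L < c"
    then have L: "n \<bullet> x L > c" using offL by simp
    obtain q where q: "q \<in> \<sigma>" using KL(4) by (auto simp: hyperplane_face_def)
    obtain r where r: "r > 0" "ball q r \<subseteq> W \<inter> W'" using ball[OF q] by blast
    define y where "y = q + (r / 2) *\<^sub>R n"
    have "y \<in> ball q r" using r n by (simp add: y_def dist_norm)
    moreover have "n \<bullet> y > c" using q sub r by (auto simp: y_def inner_add_right nn)
    ultimately have "y \<in> pyramid (x K) \<sigma> \<inter> pyramid (x L) \<sigma>"
      using r W(3) W'(3) xK L by auto
    then show False using pK(1) pL cells_disjoint[OF KL(1-3)] by blast
  qed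
  have "\<exists>r>0. \<forall>y\<in>ball q r. n \<bullet> y \<noteq> c \<longrightarrow> y \<in> K \<union> L" if q: "q \<in> \<sigma>" for q
  proof -
    obtain r where r: "r > 0" "ball q r \<subseteq> W \<inter> W'" using ball[OF q] by blast
    have "y \<in> K \<union> L" if y: "y \<in> ball q r" "n \<bullet> y \<noteq> c" for y
    proof (cases "n \<bullet> y > c")
      case True
      then have "y \<in> pyramid (x K) \<sigma>" using y r W(3) xK by auto
      then show ?thesis using pK by blast
    next
      case False
      then have "y \<in> pyramid (x L) \<sigma>" using y r W'(3) xL by (auto simp: mult_neg_neg)
      then show ?thesis using pL by blast
    qed
    then show ?thesis using r(1) by blast
  qed
  then show ?thesis using that[OF n n1(1) sub sub' n1(2) xK xL pK] by blast
qed

lemma interface_disjoint_cell: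
  assumes "interface M E K L \<sigma>"
  shows "\<sigma> \<inter> K = {}"
proof -
  have KL: "K \<in> M" "L \<in> M" "K \<noteq> L" using assms by (auto simp: interface_def)
  have "K \<inter> closure L = {}"
    using open_Int_closure_eq_empty[OF open_cell[OF KL(1)], of L] cells_disjoint[OF KL] by simp
  then show ?thesis using interface_subset_closure[OF assms] by blast
qed

text \<open>
Around a common point a small ball is filled by \<open>K\<close> and \<open>L\<close> up to a
piece of a hyperplane, which does not contain any open part of the third cell.
\<close>

lemma interfaces_disjoint:
  assumes I: "interface M E K L \<sigma>" and I': "interface M E K L' \<sigma>'" and ne: "L \<noteq> L'"
  shows "\<sigma> \<inter> \<sigma>' = {}"
proof (rule ccontr)
  assume "\<sigma> \<inter> \<sigma>' \<noteq> {}"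
  then obtain q where q: "q \<in> \<sigma>" "q \<in> \<sigma>'" by blast
  have cells: "K \<in> M" "L \<in> M" "L' \<in> M" "K \<noteq> L" "K \<noteq> L'"
    using I I' by (auto simp: interface_def)
  obtain n c r where n: "norm n = 1" and r: "r > 0" "\<And>y. y \<in> ball q r \<Longrightarrow> n \<bullet> y \<noteq> c \<Longrightarrow> y \<in> K \<union> L"
    using interface_geometry[OF I] q(1) by metis
  have "L' \<inter> K = {}" "L' \<inter> L = {}" using cells_disjoint cells ne by blast+
  then have "L' \<inter> ball q r \<subseteq> {y. n \<bullet> y = c}" using r(2) by blast
  then have "L' \<inter> ball q r = {}"
    using open_cell[OF cells(3)] n by (intro open_subset_hyperplane_empty[of _ n c]) auto
  moreover have "q \<in> closure L'" using interface_subset_closure[OF I'] q by blast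
  ultimately show False
    using r(1) by (metis Int_commute centre_in_ball disjoint_iff open_Int_closure_eq_empty open_ball)
qed

text \<open>
A face is the relative interior of its closure and is therefore determined by the two cells.
\<close>

lemma finite_interfaces: "finite {(K, L, \<sigma>). interface M E K L \<sigma>}"
proof -
  have "{(K, L, \<sigma>). interface M E K L \<sigma>}
      \<subseteq> (\<lambda>(K, L). (K, L, rel_interior (closure K \<inter> closure L))) ` (M \<times> M)"
  proof clarify
    fix K L \<sigma> assume I: "interface M E K L \<sigma>"
    then have "rel_interior (closure \<sigma>) = \<sigma>"
      using faces by (auto simp: interface_def hyperplane_face_def)
    then show "(K, L, \<sigma>) \<in> (\<lambda>(K, L). (K, L, rel_interior (closure K \<inter> closure L))) ` (M \<times> M)"
      using I by (auto simp: interface_def intro!: image_eqI[of _ _ "(K, L)"])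
  qed
  then show ?thesis using finite_cells by (meson finite_SigmaI finite_imageI finite_subset)
qed

lemma interface_unique:
  assumes "interface M E K L \<sigma>" "interface M E K L \<sigma>'"
  shows "\<sigma> = \<sigma>'"
  using assms faces unfolding interface_def hyperplane_face_def by metis

lemma bounded_cell: "K \<in> M \<Longrightarrow> bounded K"
  using cells bounded_domain bounded_subset by blast

lemma cell_fmeasurable: "K \<in> M \<Longrightarrow> K \<in> fmeasurable lborel"
  using open_cell bounded_cell emeasure_bounded_finite by (intro fmeasurableI) auto

lemma measure_cell_pos: "K \<in> M \<Longrightarrow> measure lborel K > 0"
proof -
  assume K: "K \<in> M"
  obtain r where r: "r > 0" "ball (x K) r \<subseteq> K"
    using open_cell[OF K] points[OF K] by (meson open_contains_ball)
  have "emeasure lborel (ball (x K) r) \<le> emeasure lborel K"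
    using r open_cell[OF K] by (intro emeasure_mono) auto
  also have "\<dots> = ennreal (measure lborel K)"
    using cell_fmeasurable[OF K] by (intro emeasure_eq_measure2)
  finally have "unit_ball_vol (real DIM('a)) * r ^ DIM('a) \<le> measure lborel K"
    using r by (simp add: emeasure_ball)
  moreover have "unit_ball_vol (real DIM('a)) * r ^ DIM('a) > 0" using r by simp
  ultimately show "measure lborel K > 0" by linarith
qed

end

text \<open>
The measure of the part of the boundary of the union of \<open>S\<close> that lies inside the domain:
faces on the boundary of the domain do not count. Every face occurs once, oriented outwards.
\<close>

definition perimeter :: "'a::euclidean_space set set \<Rightarrow> 'a set set \<Rightarrow> 'a set set \<Rightarrow> real" where
  "perimeter M E S
    = (\<Sum>(K, L, \<sigma>)\<in>{(K, L, \<sigma>). interface M E K L \<sigma> \<and> K \<in> S \<and> L \<notin> S}. face_measure \<sigma>)"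

lemma perimeter_nonneg: "perimeter M E S \<ge> 0"
  unfolding perimeter_def by (intro sum_nonneg) (auto simp: face_measure_def)

context regular_mesh
begin

lemma interface_sets:
  assumes I: "interface M E K L \<sigma>"
  shows "\<sigma> \<in> sets borel"
proof -
  obtain n c where "openin (top_of_set {y. n \<bullet> y = c}) \<sigma>"
    using interface_geometry[OF I] by metis
  then obtain U where "open U" "\<sigma> = {y. n \<bullet> y = c} \<inter> U" by (auto simp: openin_open)
  then show ?thesis using closed_hyperplane[of n c] by auto
qed

lemma face_measure_le_pyramid:
  assumes I: "interface M E K L \<sigma>"
  shows "emeasure (hyperplane_measure (affine hull \<sigma>)) \<sigma> = ennreal (face_measure \<sigma>)"
    and "\<xi> * (face_measure \<sigma> * dist (x K) (x L)) \<le> 2 ^ DIM('a) * measure lborel (pyramid (x K) \<sigma>)"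
    and "pyramid (x K) \<sigma> \<in> fmeasurable lborel"
proof -
  obtain n c where n: "norm n = 1" and H: "affine hull \<sigma> = {y. n \<bullet> y = c}" "\<sigma> \<subseteq> {y. n \<bullet> y = c}"
    and xK: "n \<bullet> x K > c" and P: "pyramid (x K) \<sigma> \<subseteq> K" "open (pyramid (x K) \<sigma>)"
    using interface_geometry[OF I] by metis
  have nn: "n \<bullet> n = 1" using n by (simp add: norm_eq_1)
  have K: "K \<in> M" using I by (simp add: interface_def)
  define d where "d = n \<bullet> x K - c"
  have d: "n \<bullet> x K = c + d" "d > 0" using xK by (auto simp: d_def)
  have fm: "pyramid (x K) \<sigma> \<in> fmeasurable lborel"
    using P bounded_cell[OF K] emeasure_bounded_finite bounded_subset by (intro fmeasurableI) auto
  then show "pyramid (x K) \<sigma> \<in> fmeasurable lborel" .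
  let ?m = "hyperplane_measure (affine hull \<sigma>)"
  have "ennreal (d / 2 ^ DIM('a)) * emeasure (hyperplane_measure {y. n \<bullet> y = c}) \<sigma>
      \<le> emeasure lborel (pyramid (x K) \<sigma>)"
    using P(2) by (intro emeasure_pyramid_ge[OF n interface_sets[OF I] H(2) d])
      (auto simp: pyramid_def)
  then have le: "ennreal (d / 2 ^ DIM('a)) * emeasure ?m \<sigma> \<le> ennreal (measure lborel (pyramid (x K) \<sigma>))"
    unfolding H(1) using fm by (simp add: emeasure_eq_measure2)
  have "emeasure ?m \<sigma> \<noteq> top"
  proof
    assume "emeasure ?m \<sigma> = top"
    then show False using le d(2) by (simp add: ennreal_mult_top top_unique)
  qed
  then show em: "emeasure ?m \<sigma> = ennreal (face_measure \<sigma>)"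
    unfolding face_measure_def by (rule emeasure_eq_ennreal_measure)
  have nonneg: "face_measure \<sigma> \<ge> 0" by (simp add: face_measure_def)
  have 1: "d * face_measure \<sigma> \<le> 2 ^ DIM('a) * measure lborel (pyramid (x K) \<sigma>)"
    using le d(2) nonneg unfolding em by (simp add: ennreal_mult[symmetric] field_simps)
  have "\<xi> * dist (x K) (x L) \<le> face_dist (x K) \<sigma>"
    using regular I interface_faces[OF I] K by (auto simp: mesh_regular_def)
  also have "\<dots> \<le> dist (x K) (x K - d *\<^sub>R n)"
    unfolding face_dist_def H(1) by (rule infdist_le) (simp add: inner_diff_right nn d(1))
  also have "\<dots> = d" using d n by (simp add: dist_norm)
  finally have "\<xi> * dist (x K) (x L) * face_measure \<sigma> \<le> d * face_measure \<sigma>"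
    using nonneg by (rule mult_right_mono)
  then show "\<xi> * (face_measure \<sigma> * dist (x K) (x L)) \<le> 2 ^ DIM('a) * measure lborel (pyramid (x K) \<sigma>)"
    using 1 by (simp add: mult_ac)
qed

text \<open>
The pyramids over the faces of \<open>K\<close> do not overlap, since no face of \<open>K\<close> meets
\<open>K\<close> and distinct faces are disjoint. The factor $1/\xi$ pays for the passage from the
height of the pyramid to the distance of the two cell points.
\<close>

lemma sum_pyramids_le_cell:
  assumes K: "K \<in> M"
  shows "(\<Sum>(L, \<sigma>)\<in>{(L, \<sigma>). interface M E K L \<sigma>}. face_measure \<sigma> * dist (x K) (x L))
    \<le> 2 ^ DIM('a) / \<xi> * measure lborel K"
proof -
  define J where "J = {(L, \<sigma>). interface M E K L \<sigma>}"
  have "J \<subseteq> snd ` {(K, L, \<sigma>). interface M E K L \<sigma>}" by (force simp: J_def)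
  then have fin: "finite J" using finite_interfaces by (meson finite_imageI finite_subset)
  have J: "interface M E K (fst i) (snd i)" if "i \<in> J" for i using that by (auto simp: J_def)
  have sub: "pyramid (x K) (snd i) \<subseteq> K" if "i \<in> J" for i
    using interface_geometry[OF J[OF that]] by metis
  have disj: "disjoint_family_on (\<lambda>i. pyramid (x K) (snd i)) J"
    unfolding disjoint_family_on_def
  proof (intro ballI impI)
    fix i j assume ij: "i \<in> J" "j \<in> J" "i \<noteq> j"
    have "fst i \<noteq> fst j"
      using ij J interface_unique by (metis prod.collapse)
    then have "snd i \<inter> snd j = {}" using interfaces_disjoint J ij by blast
    moreover have "snd i \<inter> K = {}" "snd j \<inter> K = {}" using interface_disjoint_cell J ij by blast+
    ultimately show "pyramid (x K) (snd i) \<inter> pyramid (x K) (snd j) = {}"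
      using sub ij by (intro pyramid_disjoint) blast+
  qed
  have "\<xi> * (\<Sum>i\<in>J. face_measure (snd i) * dist (x K) (x (fst i)))
      \<le> (\<Sum>i\<in>J. 2 ^ DIM('a) * measure lborel (pyramid (x K) (snd i)))"
    unfolding sum_distrib_left using face_measure_le_pyramid(2)[OF J] by (intro sum_mono)
  also have "\<dots> = 2 ^ DIM('a) * measure lborel (\<Union>i\<in>J. pyramid (x K) (snd i))"
    using fmeasurableD[OF face_measure_le_pyramid(3)[OF J]] fmeasurableD2[OF face_measure_le_pyramid(3)[OF J]]
      fin disj
    by (subst measure_finite_Union) (auto simp: sum_distrib_left)
  also have "\<dots> \<le> 2 ^ DIM('a) * measure lborel K"
    using sub face_measure_le_pyramid(3)[OF J] cell_fmeasurable[OF K] fin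
    by (intro mult_left_mono measure_mono_fmeasurable sets.finite_UN) (auto simp: fmeasurable_def)
  finally have "\<xi> * (\<Sum>i\<in>J. face_measure (snd i) * dist (x K) (x (fst i))) \<le> 2 ^ DIM('a) * measure lborel K" .
  then show ?thesis using \<xi>_pos by (simp add: J_def[symmetric] case_prod_beta field_simps)
qed

lemma sum_interfaces_le_cells:
  assumes g: "\<And>K. K \<in> M \<Longrightarrow> g K \<ge> 0"
  shows "(\<Sum>(K, L, \<sigma>)\<in>{(K, L, \<sigma>). interface M E K L \<sigma>}. face_measure \<sigma> * dist (x K) (x L) * g K)
    \<le> 2 ^ DIM('a) / \<xi> * (\<Sum>K\<in>M. measure lborel K * g K)"
proof -
  have eq: "{(K, L, \<sigma>). interface M E K L \<sigma>} = Sigma M (\<lambda>K. {(L, \<sigma>). interface M E K L \<sigma>})"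
    by (auto simp: interface_def)
  have fin: "finite {(L, \<sigma>). interface M E K L \<sigma>}" for K
    by (rule finite_subset[OF _ finite_imageI[OF finite_interfaces, of snd]]) force
  have "(\<Sum>(K, L, \<sigma>)\<in>{(K, L, \<sigma>). interface M E K L \<sigma>}. face_measure \<sigma> * dist (x K) (x L) * g K)
     = (\<Sum>K\<in>M. (\<Sum>(L, \<sigma>)\<in>{(L, \<sigma>). interface M E K L \<sigma>}. face_measure \<sigma> * dist (x K) (x L)) * g K)"
    unfolding eq using finite_cells fin
    by (subst sum.Sigma[symmetric]) (auto simp: sum_distrib_right case_prod_beta)
  also have "\<dots> \<le> (\<Sum>K\<in>M. 2 ^ DIM('a) / \<xi> * measure lborel K * g K)"
    using sum_pyramids_le_cell g by (intro sum_mono mult_right_mono) auto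
  finally show ?thesis by (simp add: sum_distrib_left mult.assoc)
qed

lemma frontier_cell_hyperplanes:
  assumes K: "K \<in> M"
  obtains G :: "('a \<times> real) set" where "finite G" "\<And>a b. (a, b) \<in> G \<Longrightarrow> a \<noteq> 0"
    "\<And>q. q \<in> frontier K \<Longrightarrow> \<exists>(a, b)\<in>G. a \<bullet> q = b"
proof -
  obtain P where P: "finite P" "\<forall>Q\<in>P. polyhedron Q" "closure K = \<Union>P"
    using cells[OF K] by (auto simp: open_polyhedral_def)
  obtain G :: "('a \<times> real) set" where G: "finite G" "\<forall>(a, b)\<in>G. a \<noteq> 0 \<and> \<not> UNIV \<subseteq> {y. a \<bullet> y = b}"
    "\<forall>q\<in>\<Union>P. (\<forall>(a, b)\<in>G. a \<bullet> q \<noteq> b) \<longrightarrow> (\<exists>T. open T \<and> q \<in> T \<and> T \<inter> UNIV \<subseteq> \<Union>P)"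
    using finite_Union_polyhedra_interior_points[OF P(1,2), where H = UNIV] by (elim exE conjE) (rule that)
  have "\<exists>(a, b)\<in>G. a \<bullet> q = b" if q: "q \<in> frontier K" for q
  proof (rule ccontr)
    assume "\<not> (\<exists>(a, b)\<in>G. a \<bullet> q = b)"
    moreover have "q \<in> \<Union>P" using q P(3) by (auto simp: frontier_def)
    ultimately obtain T where "open T" "q \<in> T" "T \<subseteq> \<Union>P" using G(3) by fastforce
    then have "q \<in> interior (closure K)" using P(3) by (auto intro: interiorI)
    then have "q \<in> interior K"
      using interior_closure_cell[OF K] open_cell[OF K] by (simp add: interior_open)
    then show False using q by (simp add: frontier_def)
  qed
  then show ?thesis using that G by blast
qed

text \<open>
The frontier of a bounded polyhedral cell cannot be made of radial pieces only. A ray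
from \<open>x K\<close> in a generic direction leaves the cell at a point that avoids those bounding
hyperplanes that pass through \<open>x K\<close>. A radial face near this point would contain a piece of
a line through \<open>x K\<close> that is covered by finitely many hyperplanes missing \<open>x K\<close>;
but each of them meets the line in at most one point.
\<close>

lemma exists_point_off_face:
  assumes K: "K \<in> M"
  shows "\<exists>\<sigma>\<in>EK K. x K \<notin> affine hull \<sigma>"
proof (rule ccontr)
  assume "\<not> (\<exists>\<sigma>\<in>EK K. x K \<notin> affine hull \<sigma>)"
  then have radial: "\<And>\<sigma>. \<sigma> \<in> EK K \<Longrightarrow> x K \<in> affine hull \<sigma>" by blast
  define a where "a = x K"
  obtain G :: "('a \<times> real) set" where G: "finite G" "\<And>p b. (p, b) \<in> G \<Longrightarrow> p \<noteq> 0"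
    "\<And>q. q \<in> frontier K \<Longrightarrow> \<exists>(p, b)\<in>G. p \<bullet> q = b"
    using frontier_cell_hyperplanes[OF K] by metis
  \<comment> \<open>The radial bounding hyperplanes; Z has to be avoided by the direction of the ray.\<close>
  define G0 where "G0 = {(p, b)\<in>G. p \<bullet> a = b}"
  define Z where "Z = {a} \<union> (\<Union>(p, b)\<in>G0. {y. p \<bullet> y = b})"
  have finG0: "finite G0" using G(1) by (rule finite_subset[rotated]) (auto simp: G0_def)
  have "closed Z"
    unfolding Z_def using finG0 by (intro closed_Un closed_UN) (auto simp: closed_hyperplane)
  have "Z \<in> null_sets lborel"
    unfolding Z_def using finG0 G(2)
    by (intro null_sets.Un null_sets.finite_UN) (auto simp: G0_def intro!: null_sets_hyperplane)
  moreover have "K \<notin> null_sets lborel"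
    using measure_cell_pos[OF K] by (auto simp: null_sets_def measure_def)
  ultimately have "\<not> K \<subseteq> Z"
    using open_cell[OF K] null_sets_subset[of Z lborel K] by auto
  then obtain y where y: "y \<in> K" "y \<notin> Z" by blast
  have "y \<noteq> a" using y by (auto simp: Z_def)
  obtain B where B: "B > 0" "\<And>z. z \<in> K \<Longrightarrow> norm z \<le> B" using bounded_cell[OF K] bounded_pos by metis
  \<comment> \<open>A point on the ray through y that is too far from a to belong to K.\<close>
  define far where "far = a + ((B + norm a + 1) / norm (y - a) + 1) *\<^sub>R (y - a)"
  have "norm (far - a) > B + norm a"
  proof -
    have "norm (far - a) = ((B + norm a + 1) / norm (y - a) + 1) * norm (y - a)"
      using B(1) by (simp add: far_def)
    also have "\<dots> = B + norm a + 1 + norm (y - a)" using \<open>y \<noteq> a\<close> by (subst distrib_right) simp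
    finally show ?thesis using norm_ge_zero[of "y - a"] by linarith
  qed
  then have "far \<notin> K" using B(2)[of far] norm_triangle_ineq4[of far a] by linarith
  then have "closed_segment y far \<inter> frontier K \<noteq> {}"
    using y(1) by (intro connected_Int_frontier) auto
  then obtain q where q: "q \<in> closed_segment y far" "q \<in> frontier K" by blast
  obtain s where s: "s \<ge> 1" "q = a + s *\<^sub>R (y - a)"
  proof -
    obtain u where u: "0 \<le> u" "u \<le> 1" "q = (1 - u) *\<^sub>R y + u *\<^sub>R far"
      using q(1) by (auto simp: closed_segment_def)
    define k where "k = (B + norm a + 1) / norm (y - a) + 1"
    have "k \<ge> 1" using B(1) by (simp add: k_def)
    have "q = a + (1 + u * (k - 1)) *\<^sub>R (y - a)"
      unfolding u(3) far_def k_def[symmetric] by (simp add: algebra_simps)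
    moreover have "1 + u * (k - 1) \<ge> 1" using u \<open>k \<ge> 1\<close> by simp
    ultimately show ?thesis using that by blast
  qed
  have qZ: "q \<notin> Z"
  proof -
    have "q \<noteq> a" using s \<open>y \<noteq> a\<close> by simp
    moreover have "p \<bullet> q \<noteq> b" if "(p, b) \<in> G0" for p b
    proof -
      have "p \<bullet> a = b" "p \<bullet> y \<noteq> b" using that y(2) by (auto simp: G0_def Z_def)
      moreover have "p \<bullet> q = p \<bullet> a + s * (p \<bullet> y - p \<bullet> a)"
        by (simp add: s(2) inner_add_right inner_diff_right)
      ultimately show ?thesis using s(1) by simp
    qed
    ultimately show ?thesis by (auto simp: Z_def)
  qed
  obtain \<sigma> where \<sigma>: "\<sigma> \<in> EK K" "q \<in> closure \<sigma>" using cell_faces[OF K] q(2) by auto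
  then have face: "hyperplane_face \<sigma>" using cell_faces[OF K] faces by blast
  obtain n c where n: "affine hull \<sigma> = {y. n \<bullet> y = c}" "openin (top_of_set {y. n \<bullet> y = c}) \<sigma>"
    using hyperplane_face_normal[OF face] by metis
  obtain U where U: "open U" "\<sigma> = {y. n \<bullet> y = c} \<inter> U" using n(2) by (auto simp: openin_open)
  have "open (- Z)" using \<open>closed Z\<close> by auto
  then obtain q' where q': "q' \<in> \<sigma>" "q' \<notin> Z"
    using \<sigma>(2) qZ by (metis ComplI IntE disjoint_iff open_Int_closure_eq_empty ComplD)
  have na: "n \<bullet> a = c" using radial[OF \<sigma>(1)] n(1) by (simp add: a_def)
  \<comment> \<open>The line through a and q'; it lies in the hyperplane of \<sigma>, which is radial.\<close>
  define l where "l t = a + t *\<^sub>R (q' - a)" for t :: real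
  have "open (l -` (U \<inter> - Z))"
    unfolding l_def using U(1) \<open>open (- Z)\<close>
    by (intro open_vimage open_Int) (auto intro!: continuous_intros)
  moreover have "1 \<in> l -` (U \<inter> - Z)" using q' U(2) by (simp add: l_def)
  ultimately obtain \<eta> where \<eta>: "\<eta> > 0" "ball 1 \<eta> \<subseteq> l -` (U \<inter> - Z)"
    by (meson open_contains_ball)
  have "n \<bullet> q' = c" using q'(1) U(2) by simp
  then have "n \<bullet> l t = c" for t by (simp add: l_def inner_add_right inner_diff_right na)
  then have "l t \<in> frontier K" if "t \<in> ball 1 \<eta>" for t
    using \<eta>(2) that U(2) closure_subset[of \<sigma>] cell_faces[OF K] \<sigma>(1) by blast
  then have "ball 1 \<eta> \<subseteq> (\<Union>(p, b)\<in>G - G0. {t. p \<bullet> l t = b})"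
    using G(3) \<eta>(2) by (fastforce simp: Z_def)
  moreover have "finite {t. p \<bullet> l t = b}" if "(p, b) \<in> G - G0" for p b
  proof -
    have ne: "p \<bullet> a \<noteq> b" using that by (auto simp: G0_def)
    have "p \<bullet> l t = b \<longleftrightarrow> t * (p \<bullet> (q' - a)) = b - p \<bullet> a" for t
      by (auto simp: l_def inner_add_right)
    then have "{t. p \<bullet> l t = b} \<subseteq> {(b - p \<bullet> a) / (p \<bullet> (q' - a))}"
      using ne by (auto simp: field_simps)
    then show ?thesis using finite_subset by blast
  qed
  then have "finite (\<Union>(p, b)\<in>G - G0. {t. p \<bullet> l t = b})" using G(1) by (intro finite_UN_I) auto
  ultimately have "finite (ball (1::real) \<eta>)" using finite_subset by blast
  then show False using \<eta>(1) by (simp add: ball_eq_greaterThanLessThan infinite_Ioo)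
qed

text \<open>
The bound is needed to absorb the term without differences into the one that carries the factor
$\xi^{-(p-1)/p}$. A mesh of one cell has no interior face to compare with, so the bound
has to come from a boundary face, for which it is immediate as soon as \<open>x K\<close> is not in its
hyperplane.
\<close>

lemma regularity_parameter_le_1:
  assumes "M \<noteq> {}"
  shows "\<xi> \<le> 1"
proof -
  obtain K \<sigma> where K: "K \<in> M" "\<sigma> \<in> EK K" and off: "x K \<notin> affine hull \<sigma>"
    using assms exists_point_off_face by blast
  then have face: "hyperplane_face \<sigma>" using cell_faces faces by blast
  show ?thesis
    using interior_or_boundary[OF K]
  proof
    assume bd: "\<sigma> \<subseteq> frontier \<Omega>"
    obtain n c where n: "affine hull \<sigma> = {y. n \<bullet> y = c}" "norm n = 1"
      using hyperplane_face_normal[OF face] by metis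
    have "affine hull \<sigma> \<noteq> {}" using face by (simp add: hyperplane_face_def)
    then have "face_dist (x K) \<sigma> \<noteq> 0"
      unfolding face_dist_def using off n closed_hyperplane[of n c]
      by (metis in_closed_iff_infdist_zero)
    then have "face_dist (x K) \<sigma> > 0" using infdist_nonneg[of "x K" "affine hull \<sigma>"] by (simp add: face_dist_def)
    moreover have "face_dist (x K) \<sigma> \<ge> \<xi> * face_dist (x K) \<sigma>"
      using regular K bd by (auto simp: mesh_regular_def)
    ultimately show ?thesis by simp
  next
    assume "\<exists>L. interface M E K L \<sigma>"
    then obtain L where I: "interface M E K L \<sigma>" ..
    obtain n c where n: "norm n = 1" and H: "affine hull \<sigma> = {y. n \<bullet> y = c}"
      and xK: "n \<bullet> x K > c" and xL: "n \<bullet> x L < c"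
      using interface_geometry[OF I] by metis
    have nn: "n \<bullet> n = 1" using n by (simp add: norm_eq_1)
    have "\<xi> * dist (x K) (x L) \<le> face_dist (x K) \<sigma>"
      using regular I interface_faces[OF I] K by (auto simp: mesh_regular_def)
    also have "\<dots> \<le> dist (x K) (x K - (n \<bullet> x K - c) *\<^sub>R n)"
      unfolding face_dist_def H by (rule infdist_le) (simp add: inner_diff_right nn)
    also have "\<dots> = n \<bullet> x K - c" using xK n by (simp add: dist_norm)
    also have "\<dots> \<le> n \<bullet> (x K - x L)" using xL by (simp add: inner_diff_right)
    also have "\<dots> \<le> dist (x K) (x L)"
      using norm_cauchy_schwarz[of n "x K - x L"] n by (simp add: dist_norm)
    finally have "\<xi> * dist (x K) (x L) \<le> 1 * dist (x K) (x L)" by simp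
    then show ?thesis using points_distinct[OF I] by (subst (asm) mult_le_cancel_right) auto
  qed
qed

section \<open>Crossing faces along a translation\<close>

text \<open>
The relative boundary of a face lies in finitely many sets of codimension 2, each the
intersection of the hyperplane $n \cdot y = c$ of the face with a hyperplane $a \cdot y = b$ transversal
to it. The combination of the two equations whose normal \<open>v a\<close> is orthogonal to
\<open>w\<close> holds on all lines in direction \<open>w\<close> through that intersection.
\<close>

lemma interface_boundary_sweep_null:
  assumes I: "interface M E K L \<sigma>" and H: "affine hull \<sigma> = {y. n \<bullet> y = c}" and w: "n \<bullet> w \<noteq> 0"
  obtains Z where "Z \<in> null_sets lborel" "\<And>y t. y + t *\<^sub>R w \<in> closure \<sigma> - \<sigma> \<Longrightarrow> y \<in> Z"
proof -
  have KL: "K \<in> M" "L \<in> M" "hyperplane_face \<sigma>" using I faces by (auto simp: interface_def)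
  obtain P where P: "finite P" "\<forall>Q\<in>P. polyhedron Q" "closure K = \<Union>P"
    using cells[OF KL(1)] by (auto simp: open_polyhedral_def)
  obtain P' where P': "finite P'" "\<forall>Q\<in>P'. polyhedron Q" "closure L = \<Union>P'"
    using cells[OF KL(2)] by (auto simp: open_polyhedral_def)
  define PP where "PP = (\<lambda>(Q, Q'). Q \<inter> Q') ` (P \<times> P')"
  have PP: "finite PP" "\<forall>Q\<in>PP. polyhedron Q" "closure \<sigma> = \<Union>PP"
    using P P' interface_subset_closure(3)[OF I] by (auto simp: PP_def)
  have sub: "closure \<sigma> \<subseteq> {y. n \<bullet> y = c}"
    using closure_minimal[OF _ closed_hyperplane, of \<sigma> n c] hull_subset[of \<sigma> affine] H by simp
  obtain G :: "('a \<times> real) set" where G: "finite G"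
    "\<forall>(a, b)\<in>G. a \<noteq> 0 \<and> \<not> {y. n \<bullet> y = c} \<subseteq> {y. a \<bullet> y = b}"
    "\<forall>q\<in>\<Union>PP. (\<forall>(a, b)\<in>G. a \<bullet> q \<noteq> b) \<longrightarrow>
       (\<exists>T. open T \<and> q \<in> T \<and> T \<inter> {y. n \<bullet> y = c} \<subseteq> \<Union>PP)"
    using finite_Union_polyhedra_interior_points[OF PP(1,2), where H = "{y. n \<bullet> y = c}"]
    by (elim exE conjE) (rule that)
  define v where "v a = (n \<bullet> w) *\<^sub>R a - (a \<bullet> w) *\<^sub>R n" for a
  define Z where "Z = (\<Union>(a, b)\<in>{i \<in> G. v (fst i) \<noteq> 0}. {y. v a \<bullet> y = b * (n \<bullet> w) - c * (a \<bullet> w)})"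
  have "Z \<in> null_sets lborel"
    unfolding Z_def using G(1) by (intro null_sets.finite_UN) (auto intro!: null_sets_hyperplane)
  moreover have "y \<in> Z" if q: "y + t *\<^sub>R w \<in> closure \<sigma> - \<sigma>" for y t
  proof -
    define q where "q = y + t *\<^sub>R w"
    have q: "q \<in> closure \<sigma>" "q \<notin> \<sigma>" "n \<bullet> q = c" using that sub by (auto simp: q_def)
    have "\<exists>a b. (a, b) \<in> G \<and> a \<bullet> q = b"
    proof (rule ccontr)
      assume "\<nexists>a b. (a, b) \<in> G \<and> a \<bullet> q = b"
      then obtain T where T: "open T" "q \<in> T" "T \<inter> {y. n \<bullet> y = c} \<subseteq> closure \<sigma>"
        using G(3)[rule_format, of q] q(1) unfolding PP(3) by blast
      have "affine hull closure \<sigma> \<subseteq> {y. n \<bullet> y = c}"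
        using sub affine_hyperplane by (rule hull_minimal)
      then have "q \<in> rel_interior (closure \<sigma>)"
        using T q(1) by (auto simp: mem_rel_interior)
      then show False using KL(3) q(2) by (simp add: hyperplane_face_def)
    qed
    then obtain a b where ab: "(a, b) \<in> G" "a \<bullet> q = b" by blast
    have "v a \<noteq> 0"
    proof
      assume "v a = 0"
      then have a: "(n \<bullet> w) *\<^sub>R a = (a \<bullet> w) *\<^sub>R n" by (simp add: v_def)
      have eq: "(n \<bullet> w) * (a \<bullet> z) = (a \<bullet> w) * (n \<bullet> z)" for z
        using arg_cong[OF a, of "\<lambda>u. u \<bullet> z"] by simp
      have "a \<bullet> z = b" if "n \<bullet> z = c" for z
      proof -
        have "(n \<bullet> w) * (a \<bullet> z) = (n \<bullet> w) * (a \<bullet> q)" using eq[of z] eq[of q] q(3) that by simp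
        then show ?thesis using w ab(2) by simp
      qed
      then show False using G(2) ab(1) by blast
    qed
    moreover have "v a \<bullet> y = b * (n \<bullet> w) - c * (a \<bullet> w)"
    proof -
      have "v a \<bullet> w = 0" by (simp add: v_def inner_diff_left)
      then have "v a \<bullet> y = v a \<bullet> q" by (simp add: q_def inner_add_right)
      then show ?thesis using q(3) ab(2) by (simp add: v_def inner_diff_left)
    qed
    ultimately show ?thesis using ab(1) by (force simp: Z_def)
  qed
  ultimately show ?thesis using that by blast
qed

text \<open>
If \<open>w\<close> is parallel to the face, the exceptional starting points are those in its hyperplane.
Otherwise they lie on lines in direction \<open>w\<close> through the relative boundary of the face, or
\<open>y + w\<close> lies in its hyperplane.
\<close>

lemma exit_through_interface:
  assumes I: "interface M E K L \<sigma>" and H: "norm n = 1" "affine hull \<sigma> = {y. n \<bullet> y = c}"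
  obtains Z where "Z \<in> null_sets lborel"
    "\<And>y t. y \<notin> Z \<Longrightarrow> y + t *\<^sub>R w \<in> closure \<sigma> \<Longrightarrow> n \<bullet> w \<noteq> 0 \<and> y + t *\<^sub>R w \<in> \<sigma> \<and> t \<noteq> 1"
proof (cases "n \<bullet> w = 0")
  case True
  have "closure \<sigma> \<subseteq> {y. n \<bullet> y = c}"
    using closure_minimal[OF _ closed_hyperplane, of \<sigma> n c] hull_subset[of \<sigma> affine] H(2) by simp
  moreover have "{y. n \<bullet> y = c} \<in> null_sets lborel" using H by (intro null_sets_hyperplane) auto
  ultimately show ?thesis using that[of "{y. n \<bullet> y = c}"] True by (force simp: inner_add_right)
next
  case False
  obtain Z where Z: "Z \<in> null_sets lborel" "\<And>y t. y + t *\<^sub>R w \<in> closure \<sigma> - \<sigma> \<Longrightarrow> y \<in> Z"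
    using interface_boundary_sweep_null[OF I H(2) False] by metis
  have sub: "\<sigma> \<subseteq> {y. n \<bullet> y = c}" using hull_subset[of \<sigma> affine] H(2) by simp
  have "Z \<union> {y. n \<bullet> y = c - n \<bullet> w} \<in> null_sets lborel"
    using Z(1) H by (intro null_sets.Un null_sets_hyperplane) auto
  moreover have "n \<bullet> w \<noteq> 0 \<and> y + t *\<^sub>R w \<in> \<sigma> \<and> t \<noteq> 1"
    if "y \<notin> Z \<union> {y. n \<bullet> y = c - n \<bullet> w}" "y + t *\<^sub>R w \<in> closure \<sigma>" for y t
  proof -
    have s: "y + t *\<^sub>R w \<in> \<sigma>" using Z(2)[of y t] that by blast
    then have "n \<bullet> y + t * (n \<bullet> w) = c" using sub by (auto simp: inner_add_right)
    then have "t \<noteq> 1" using that(1) by auto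
    then show ?thesis using s False by simp
  qed
  ultimately show ?thesis by (rule that)
qed

text \<open>
A point \<open>y\<close> of \<open>U = \<Union>S\<close> with \<open>y + w\<close> outside \<open>U\<close> is followed up to the last
time \<open>t\<close> at which its path is in the closure of \<open>U\<close>. The path stays in the
domain, so at that time it is on an interior face of a cell of \<open>S\<close>. For almost all \<open>y\<close>
it crosses the open face transversally. If the cell on the other side were in \<open>S\<close> as
well, the path would be in \<open>U\<close> again immediately afterwards. So the face separates
\<open>S\<close> from its complement and \<open>y\<close> belongs to the sweep of that face.
\<close>

lemma emeasure_exit_le_perimeter:
  assumes S: "S \<subseteq> M" and D: "\<And>y t. y \<in> D \<Longrightarrow> 0 \<le> t \<Longrightarrow> t \<le> 1 \<Longrightarrow> y + t *\<^sub>R w \<in> \<Omega>"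
  shows "emeasure lborel {y \<in> D \<inter> \<Union>S. y + w \<notin> \<Union>S} \<le> ennreal (norm w * perimeter M E S)"
proof -
  define U where "U = \<Union>S"
  define J where "J = {(K, L, \<sigma>). interface M E K L \<sigma>}"
  define JS where "JS = {(K, L, \<sigma>). interface M E K L \<sigma> \<and> K \<in> S \<and> L \<notin> S}"
  have finJ: "finite J" unfolding J_def by (rule finite_interfaces)
  have JS: "JS \<subseteq> J" by (auto simp: JS_def J_def)
  then have finJS: "finite JS" using finJ finite_subset by blast
  have openU: "open U" using S open_cell by (auto simp: U_def)
  have "\<forall>i\<in>J. \<exists>nc Z. norm (fst nc) = 1 \<and> affine hull (snd (snd i)) = {y. fst nc \<bullet> y = snd nc} \<and>
      Z \<in> null_sets lborel \<and> (\<forall>y t. y \<notin> Z \<longrightarrow> y + t *\<^sub>R w \<in> closure (snd (snd i)) \<longrightarrow>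
        fst nc \<bullet> w \<noteq> 0 \<and> y + t *\<^sub>R w \<in> snd (snd i) \<and> t \<noteq> 1)"
  proof
    fix i assume "i \<in> J"
    then obtain K L \<sigma> where i: "i = (K, L, \<sigma>)" and I: "interface M E K L \<sigma>" by (auto simp: J_def)
    obtain n c where n: "norm n = 1" "affine hull \<sigma> = {y. n \<bullet> y = c}"
      using interface_geometry[OF I] by metis
    obtain Z where "Z \<in> null_sets lborel"
      "\<And>y t. y \<notin> Z \<Longrightarrow> y + t *\<^sub>R w \<in> closure \<sigma> \<Longrightarrow> n \<bullet> w \<noteq> 0 \<and> y + t *\<^sub>R w \<in> \<sigma> \<and> t \<noteq> 1"
      using exit_through_interface[OF I n] by metis
    then show "\<exists>nc Z. norm (fst nc) = 1 \<and> affine hull (snd (snd i)) = {y. fst nc \<bullet> y = snd nc} \<and>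
      Z \<in> null_sets lborel \<and> (\<forall>y t. y \<notin> Z \<longrightarrow> y + t *\<^sub>R w \<in> closure (snd (snd i)) \<longrightarrow>
        fst nc \<bullet> w \<noteq> 0 \<and> y + t *\<^sub>R w \<in> snd (snd i) \<and> t \<noteq> 1)"
      using n by (intro exI[of _ "(n, c)"] exI[of _ Z]) (simp add: i)
  qed
  then obtain nc where "\<forall>i\<in>J. \<exists>Z. norm (fst (nc i)) = 1 \<and> affine hull (snd (snd i)) = {y. fst (nc i) \<bullet> y = snd (nc i)} \<and>
      Z \<in> null_sets lborel \<and> (\<forall>y t. y \<notin> Z \<longrightarrow> y + t *\<^sub>R w \<in> closure (snd (snd i)) \<longrightarrow>
        fst (nc i) \<bullet> w \<noteq> 0 \<and> y + t *\<^sub>R w \<in> snd (snd i) \<and> t \<noteq> 1)"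
    by (rule bchoice[THEN exE])
  then obtain Z where ncZ: "\<forall>i\<in>J. norm (fst (nc i)) = 1 \<and> affine hull (snd (snd i)) = {y. fst (nc i) \<bullet> y = snd (nc i)} \<and>
      Z i \<in> null_sets lborel \<and> (\<forall>y t. y \<notin> Z i \<longrightarrow> y + t *\<^sub>R w \<in> closure (snd (snd i)) \<longrightarrow>
        fst (nc i) \<bullet> w \<noteq> 0 \<and> y + t *\<^sub>R w \<in> snd (snd i) \<and> t \<noteq> 1)"
    by (rule bchoice[THEN exE])
  define n where "n i = fst (nc i)" for i
  define c where "c i = snd (nc i)" for i
  define \<tau> where "\<tau> i y = (c i - n i \<bullet> y) / (n i \<bullet> w)" for i y
  \<comment> \<open>W i is the sweep of the face; the guard makes it empty for faces parallel to w.\<close>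
  define W where "W i = {y. n i \<bullet> w \<noteq> 0 \<and> 0 \<le> \<tau> i y \<and> \<tau> i y \<le> 1 \<and> y + \<tau> i y *\<^sub>R w \<in> snd (snd i)}" for i
  have nor: "norm (n i) = 1" and hull: "affine hull (snd (snd i)) = {y. n i \<bullet> y = c i}"
    and nullZ: "Z i \<in> null_sets lborel"
    and Z: "\<And>y t. y \<notin> Z i \<Longrightarrow> y + t *\<^sub>R w \<in> closure (snd (snd i)) \<Longrightarrow>
        n i \<bullet> w \<noteq> 0 \<and> y + t *\<^sub>R w \<in> snd (snd i) \<and> t \<noteq> 1" if "i \<in> J" for i
    using ncZ that by (auto simp: n_def c_def)
  have W: "W i \<in> sets borel \<and> emeasure lborel (W i) \<le> ennreal (norm w * face_measure (snd (snd i)))"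
    if i: "i \<in> J" for i
  proof (cases "n i \<bullet> w = 0")
    case False
    obtain K L \<sigma> where i': "i = (K, L, \<sigma>)" and I: "interface M E K L \<sigma>" using i by (auto simp: J_def)
    have sub: "\<sigma> \<subseteq> {y. n i \<bullet> y = c i}" using hull_subset[of \<sigma> affine] hull[OF i] by (simp add: i')
    have W_eq: "W i = {y. 0 \<le> (c i - n i \<bullet> y) / (n i \<bullet> w) \<and> (c i - n i \<bullet> y) / (n i \<bullet> w) \<le> 1 \<and>
        y + ((c i - n i \<bullet> y) / (n i \<bullet> w)) *\<^sub>R w \<in> \<sigma>}"
      unfolding W_def \<tau>_def i' using False[unfolded i'] by simp
    have hull': "affine hull \<sigma> = {y. n i \<bullet> y = c i}" using hull[OF i] by (simp only: i' snd_conv)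
    have "W i \<in> sets borel"
      unfolding W_eq by (rule emeasure_sweep(1)[OF nor[OF i] interface_sets[OF I] sub False])
    moreover have "emeasure lborel (W i) = ennreal \<bar>n i \<bullet> w\<bar> * ennreal (face_measure \<sigma>)"
      unfolding W_eq face_measure_le_pyramid(1)[OF I, symmetric] hull'
      by (rule emeasure_sweep(2)[OF nor[OF i] interface_sets[OF I] sub False])
    moreover have "\<bar>n i \<bullet> w\<bar> \<le> norm w" using Cauchy_Schwarz_ineq2[of "n i" w] nor[OF i] by simp
    then have "\<bar>n i \<bullet> w\<bar> * face_measure \<sigma> \<le> norm w * face_measure \<sigma>"
      by (intro mult_right_mono) (simp_all add: face_measure_def)
    ultimately show ?thesis by (simp add: i' ennreal_mult[symmetric] face_measure_def)
  qed (simp add: W_def)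
  have "{y \<in> D \<inter> U. y + w \<notin> U} \<subseteq> (\<Union>i\<in>JS. W i) \<union> (\<Union>i\<in>J. Z i)"
  proof
    fix y assume "y \<in> {y \<in> D \<inter> U. y + w \<notin> U}"
    then have y: "y \<in> D" "y \<in> U" "y + w \<notin> U" by auto
    show "y \<in> (\<Union>i\<in>JS. W i) \<union> (\<Union>i\<in>J. Z i)"
    proof (rule ccontr)
      assume not: "y \<notin> (\<Union>i\<in>JS. W i) \<union> (\<Union>i\<in>J. Z i)"
      define A where "A = {t. 0 \<le> t \<and> t \<le> 1 \<and> y + t *\<^sub>R w \<in> U}"
      have A0: "0 \<in> A" using y by (simp add: A_def)
      have bdd: "bdd_above A" by (rule bdd_aboveI[of _ 1]) (auto simp: A_def)
      define t where "t = Sup A"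
      have t: "0 \<le> t" "t \<le> 1"
        using A0 bdd unfolding t_def by (auto intro!: cSup_upper cSup_least simp: A_def)
      define q where "q = y + t *\<^sub>R w"
      have "t \<in> closure A" unfolding t_def using A0 bdd by (intro closure_contains_Sup) auto
      moreover have "(\<lambda>t. y + t *\<^sub>R w) ` closure A \<subseteq> closure U"
        by (rule image_closure_subset) (auto intro!: continuous_intros closure_subset[THEN subsetD] simp: A_def)
      ultimately have qcl: "q \<in> closure U" by (auto simp: q_def)
      \<comment> \<open>The path is in an open set around q for a while after t.\<close>
      have later: "\<exists>u>t. u \<le> 1 \<and> y + u *\<^sub>R w \<in> V \<and> u < e" if V: "open V" "q \<in> V" "t < 1" "t < e" for V e
      proof -
        have "open ((\<lambda>u. y + u *\<^sub>R w) -` V)"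
          using V(1) by (intro open_vimage) (auto intro!: continuous_intros)
        then obtain r where r: "r > 0" "ball t r \<subseteq> (\<lambda>u. y + u *\<^sub>R w) -` V"
          using V(2) unfolding q_def open_contains_ball by blast
        define u where "u = min (t + r / 2) (min 1 ((t + e) / 2))"
        have "u > t" "u \<le> 1" "u \<in> ball t r" "u < e"
          using r(1) V(3,4) by (auto simp: u_def dist_real_def min_def)
        then show ?thesis using r(2) by auto
      qed
      have notA: "u \<notin> A" if "u > t" for u using bdd that cSup_upper[of u A] unfolding t_def by auto
      have qU: "q \<notin> U"
      proof
        assume "q \<in> U"
        moreover from this have "t < 1" using y(3) t by (cases "t = 1") (auto simp: q_def)
        ultimately obtain u where "u > t" "u \<le> 1" "y + u *\<^sub>R w \<in> U"
          using later[OF openU, of 2] by auto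
        then show False using notA[of u] t by (simp add: A_def)
      qed
      have "closure U \<subseteq> (\<Union>K\<in>S. closure K)"
        using finite_subset[OF S finite_cells] closure_subset unfolding U_def
        by (intro closure_minimal closed_UN) auto
      then obtain K where K: "K \<in> S" "q \<in> closure K" using qcl by auto
      have KM: "K \<in> M" using K S by blast
      have "q \<in> frontier K"
        using K qU open_cell[OF KM] by (auto simp: frontier_def U_def interior_open)
      then obtain \<sigma> where \<sigma>: "\<sigma> \<in> EK K" "q \<in> closure \<sigma>" using cell_faces[OF KM] by auto
      have "q \<in> \<Omega>" unfolding q_def using D[OF y(1) t] .
      then have "q \<notin> frontier \<Omega>" using open_domain by (simp add: frontier_def interior_open)
      then have "\<not> \<sigma> \<subseteq> frontier \<Omega>"
        using \<sigma>(2) closure_minimal[of \<sigma> "frontier \<Omega>"] frontier_closed by blast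
      then obtain L where I: "interface M E K L \<sigma>" using interior_or_boundary[OF KM \<sigma>(1)] by blast
      define i where "i = (K, L, \<sigma>)"
      have i: "i \<in> J" using I by (simp add: J_def i_def)
      then have "y \<notin> Z i" using not by blast
      then have cross: "n i \<bullet> w \<noteq> 0" "q \<in> \<sigma>" "t \<noteq> 1"
        using Z[OF i, of y t] \<sigma>(2) by (auto simp: q_def i_def)
      have sub: "\<sigma> \<subseteq> {y. n i \<bullet> y = c i}" using hull_subset[of \<sigma> affine] hull[OF i] by (simp add: i_def)
      have nq: "n i \<bullet> y + t * (n i \<bullet> w) = c i" using cross(2) sub by (auto simp: q_def inner_add_right)
      then have \<tau>: "\<tau> i y = t" using cross(1) by (simp add: \<tau>_def field_simps)
      have "y \<in> W i" using cross t \<tau> by (simp add: W_def q_def i_def)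
      then have "i \<notin> JS" using not by blast
      then have "L \<in> S" using I K(1) by (simp add: JS_def i_def)
      obtain n' c' r where n': "affine hull \<sigma> = {y. n' \<bullet> y = c'}" and r: "r > 0"
        "\<And>z. z \<in> ball q r \<Longrightarrow> n' \<bullet> z \<noteq> c' \<Longrightarrow> z \<in> K \<union> L"
        using interface_geometry[OF I] cross(2) by metis
      have r': "z \<in> K \<union> L" if "z \<in> ball q r" "n i \<bullet> z \<noteq> c i" for z
        using r(2)[OF that(1)] that(2) n' hull[OF i] by (auto simp: i_def)
      obtain u where u: "u > t" "u \<le> 1" "y + u *\<^sub>R w \<in> ball q r"
        using later[of "ball q r" 2] r(1) cross(3) t by auto
      have "n i \<bullet> (y + u *\<^sub>R w) \<noteq> c i"
      proof
        assume "n i \<bullet> (y + u *\<^sub>R w) = c i"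
        then have "n i \<bullet> y + u * (n i \<bullet> w) = c i" by (simp add: inner_add_right)
        then have "(u - t) * (n i \<bullet> w) = 0" using nq unfolding left_diff_distrib by linarith
        then show False using u(1) cross(1) by simp
      qed
      then have "y + u *\<^sub>R w \<in> U" using r'[OF u(3)] K(1) \<open>L \<in> S\<close> by (auto simp: U_def)
      then show False using notA[OF u(1)] u t by (simp add: A_def)
    qed
  qed
  then have "emeasure lborel {y \<in> D \<inter> U. y + w \<notin> U} \<le> emeasure lborel ((\<Union>i\<in>JS. W i) \<union> (\<Union>i\<in>J. Z i))"
    using W JS nullZ finJ finJS by (intro emeasure_mono) (auto intro!: sets.Un sets.finite_UN simp: null_sets_def)
  also have "\<dots> = emeasure lborel (\<Union>i\<in>JS. W i)"
    using W JS nullZ finJ finJS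
    by (intro emeasure_Un_null_set null_sets.finite_UN) (auto intro!: sets.finite_UN)
  also have "\<dots> \<le> (\<Sum>i\<in>JS. emeasure lborel (W i))"
    using W JS finJS by (intro emeasure_subadditive_finite) auto
  also have "\<dots> \<le> (\<Sum>i\<in>JS. ennreal (norm w * face_measure (snd (snd i))))"
    using W JS by (intro sum_mono) auto
  also have "\<dots> = ennreal (norm w * perimeter M E S)"
    by (subst sum_ennreal) (auto simp: perimeter_def JS_def[symmetric] sum_distrib_left case_prod_beta face_measure_def)
  finally show ?thesis by (simp add: U_def)
qed

end

section \<open>The isoperimetric inequality\<close>

text \<open>
Above the graph of a function with Lipschitz constant \<open>C\<close>, one may move by any vector whose
component along \<open>e\<close> is at least \<open>C\<close> times its orthogonal component. The vectors close to
a multiple of \<open>e\<close> have this property.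
\<close>

lemma lipschitz_domain_local_cone:
  fixes \<Omega> :: "'a::euclidean_space set"
  assumes L: "lipschitz_domain \<Omega>" and z: "z \<in> closure \<Omega>"
  shows "\<exists>V a \<delta>. open V \<and> z \<in> V \<and> \<delta> > 0 \<and>
    (\<forall>y\<in>V \<inter> \<Omega>. \<forall>w\<in>ball a \<delta>. \<forall>t\<in>{0..1}. y + t *\<^sub>R w \<in> \<Omega>)"
proof (cases "z \<in> \<Omega>")
  case True
  moreover have "open \<Omega>" using L by (simp add: lipschitz_domain_def)
  ultimately obtain r where r: "r > 0" "ball z r \<subseteq> \<Omega>" by (auto simp: open_contains_ball)
  have "y + t *\<^sub>R w \<in> \<Omega>" if "y \<in> ball z (r / 2)" "w \<in> ball 0 (r / 2)" "t \<in> {0..1}" for y w t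
  proof -
    have "norm (t *\<^sub>R w) \<le> norm w" using that(3) by (simp add: mult_left_le_one_le)
    moreover have "dist z (y + t *\<^sub>R w) \<le> dist z y + norm (t *\<^sub>R w)"
      using dist_triangle[of z "y + t *\<^sub>R w" y] by (simp add: dist_norm)
    ultimately have "y + t *\<^sub>R w \<in> ball z r" using that by simp
    then show ?thesis using r by blast
  qed
  then show ?thesis using r
    by (intro exI[of _ "ball z (r / 2)"] exI[of _ 0] exI[of _ "r / 2"]) auto
next
  case False
  have "open \<Omega>" using L by (simp add: lipschitz_domain_def)
  then have "z \<in> frontier \<Omega>" using z False by (simp add: frontier_def interior_open)
  then obtain U e C and g :: "'a \<Rightarrow> real" where U: "open U" "z \<in> U" and e: "norm e = 1"
    and g: "C-lipschitz_on UNIV g" and graph: "\<Omega> \<inter> U = {y \<in> U. g (y - (y \<bullet> e) *\<^sub>R e) < y \<bullet> e}"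
    using L unfolding lipschitz_domain_def by blast
  have C: "C \<ge> 0" using g by (rule lipschitz_on_nonneg)
  have ee: "e \<bullet> e = 1" using e by (simp add: norm_eq_1)
  obtain r where r: "r > 0" "ball z r \<subseteq> U" using U by (auto simp: open_contains_ball)
  \<comment> \<open>\<kappa> keeps the path in the ball of radius r; \<delta> makes the ascent \<kappa> - \<delta> equal to C \<delta>.\<close>
  define \<kappa> where "\<kappa> = r / 4"
  define \<delta> where "\<delta> = \<kappa> / (C + 1)"
  have \<kappa>: "\<kappa> > 0" using r by (simp add: \<kappa>_def)
  have \<delta>: "\<delta> > 0" "C * \<delta> = \<kappa> - \<delta>" "\<delta> \<le> \<kappa>"
    using \<kappa> C by (auto simp: \<delta>_def field_simps)
  have "y + t *\<^sub>R w \<in> \<Omega>"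
    if y: "y \<in> ball z (r / 2)" "y \<in> \<Omega>" and w: "w \<in> ball (\<kappa> *\<^sub>R e) \<delta>" and t: "t \<in> {0..1}" for y w t
  proof -
    define h where "h = w - \<kappa> *\<^sub>R e"
    have h: "norm h < \<delta>" using w by (simp add: h_def dist_norm norm_minus_commute)
    have w_eq: "w = \<kappa> *\<^sub>R e + h" by (simp add: h_def)
    have "norm w < 2 * \<kappa>"
      using norm_triangle_ineq[of "\<kappa> *\<^sub>R e" h] h \<delta>(3) \<kappa> e by (simp add: w_eq)
    then have "norm (t *\<^sub>R w) < r / 2"
      using t mult_left_le_one_le[of "norm w" t] by (simp add: \<kappa>_def)
    moreover have "dist z (y + t *\<^sub>R w) \<le> dist z y + norm (t *\<^sub>R w)"
      using dist_triangle[of z "y + t *\<^sub>R w" y] by (simp add: dist_norm)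
    ultimately have inU: "y + t *\<^sub>R w \<in> U" "y \<in> U" using y(1) r by auto
    define pr where "pr v = v - (v \<bullet> e) *\<^sub>R e" for v
    have pr: "pr (y + t *\<^sub>R w) = pr y + t *\<^sub>R pr h"
      by (simp add: pr_def w_eq inner_add_left ee algebra_simps)
    have "(norm (pr h))\<^sup>2 = (norm h)\<^sup>2 - (h \<bullet> e)\<^sup>2"
      unfolding power2_norm_eq_inner pr_def
      by (simp add: inner_diff_left inner_diff_right ee inner_commute power2_eq_square)
    then have "(norm (pr h))\<^sup>2 \<le> (norm h)\<^sup>2" by simp
    then have prh: "norm (pr h) \<le> norm h" by (rule power2_le_imp_le) simp
    have he: "\<bar>h \<bullet> e\<bar> \<le> norm h" using Cauchy_Schwarz_ineq2[of h e] e by simp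
    have "\<bar>g (pr (y + t *\<^sub>R w)) - g (pr y)\<bar> \<le> C * (t * norm (pr h))"
      using lipschitz_onD[OF g, of "pr (y + t *\<^sub>R w)" "pr y"] t by (simp add: pr dist_norm)
    also have "\<dots> \<le> t * (C * \<delta>)"
      using mult_left_mono[of "norm (pr h)" \<delta> "t * C"] C t prh h by (simp add: mult_ac)
    finally have "g (pr (y + t *\<^sub>R w)) \<le> g (pr y) + t * (\<kappa> - \<delta>)" using \<delta>(2) by simp
    also have "\<dots> < y \<bullet> e + t * (\<kappa> - \<delta>)" using graph y(2) inU(2) by (auto simp: pr_def)
    also have "\<dots> \<le> y \<bullet> e + t * (\<kappa> + h \<bullet> e)"
      using he h t by (intro add_left_mono mult_left_mono) auto
    also have "\<dots> = (y + t *\<^sub>R w) \<bullet> e" by (simp add: w_eq inner_add_left ee)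
    finally show ?thesis using graph inU(1) unfolding pr_def by blast
  qed
  then show ?thesis using r \<delta>(1)
    by (intro exI[of _ "ball z (r / 2)"] exI[of _ "\<kappa> *\<^sub>R e"] exI[of _ \<delta>]) auto
qed

lemma lipschitz_domain_finite_cones:
  fixes \<Omega> :: "'a::euclidean_space set"
  assumes L: "lipschitz_domain \<Omega>" and bd: "bounded \<Omega>"
  obtains F :: "('a set \<times> 'a) set" and \<delta> R :: real where "finite F" "\<delta> > 0" "R > 0"
    "\<Omega> \<subseteq> (\<Union>(V, a)\<in>F. V)"
    "\<And>V a. (V, a) \<in> F \<Longrightarrow> open V \<and> norm a + \<delta> \<le> R"
    "\<And>V a y w t. (V, a) \<in> F \<Longrightarrow> y \<in> V \<inter> \<Omega> \<Longrightarrow> w \<in> ball a \<delta> \<Longrightarrow> 0 \<le> t \<Longrightarrow> t \<le> 1 \<Longrightarrow> y + t *\<^sub>R w \<in> \<Omega>"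
proof -
  define good where "good V a \<delta> \<longleftrightarrow> open V \<and> \<delta> > 0 \<and>
    (\<forall>y\<in>V \<inter> \<Omega>. \<forall>w\<in>ball a \<delta>. \<forall>t\<in>{0..1}. y + t *\<^sub>R w \<in> \<Omega>)" for V a and \<delta> :: real
  have "\<forall>z\<in>closure \<Omega>. \<exists>i. z \<in> fst i \<and> good (fst i) (fst (snd i)) (snd (snd i))"
    using lipschitz_domain_local_cone[OF L] unfolding good_def by (metis fst_conv snd_conv)
  then obtain i where i: "\<forall>z\<in>closure \<Omega>. z \<in> fst (i z) \<and> good (fst (i z)) (fst (snd (i z))) (snd (snd (i z)))"
    by (rule bchoice[THEN exE])
  have "compact (closure \<Omega>)" using bd by (simp add: compact_closure)
  then obtain Z where Z: "Z \<subseteq> closure \<Omega>" "finite Z" "closure \<Omega> \<subseteq> (\<Union>z\<in>Z. fst (i z))"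
    by (rule compactE_image[of "closure \<Omega>" "closure \<Omega>" "\<lambda>z. fst (i z)"])
       (use i in \<open>auto simp: good_def\<close>)
  have "\<Omega> \<noteq> {}" using L by (simp add: lipschitz_domain_def)
  then have "Z \<noteq> {}" using Z(3) closure_subset[of \<Omega>] by auto
  define \<delta> where "\<delta> = Min ((\<lambda>z. snd (snd (i z))) ` Z)"
  have \<delta>: "\<delta> > 0" "\<And>z. z \<in> Z \<Longrightarrow> \<delta> \<le> snd (snd (i z))"
    using Z i \<open>Z \<noteq> {}\<close> by (auto simp: \<delta>_def good_def)
  define R where "R = (\<Sum>z\<in>Z. norm (fst (snd (i z)))) + \<delta>"
  define F where "F = (\<lambda>z. (fst (i z), fst (snd (i z)))) ` Z"
  have nR: "norm (fst (snd (i z))) + \<delta> \<le> R" if "z \<in> Z" for z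
    using member_le_sum[OF that, of "\<lambda>z. norm (fst (snd (i z)))"] Z(2) by (simp add: R_def)
  show ?thesis
  proof (rule that[of F \<delta> R])
    show "finite F" "\<delta> > 0" "\<Omega> \<subseteq> (\<Union>(V, a)\<in>F. V)"
      using Z \<delta> closure_subset[of \<Omega>] by (auto simp: F_def)
    show "R > 0" using \<delta>(1) by (simp add: R_def add_nonneg_pos sum_nonneg)
    show "open V \<and> norm a + \<delta> \<le> R" if "(V, a) \<in> F" for V a
      using that i Z(1) nR by (auto simp: F_def good_def)
    show "y + t *\<^sub>R w \<in> \<Omega>"
      if prem: "(V, a) \<in> F" "y \<in> V \<inter> \<Omega>" "w \<in> ball a \<delta>" "0 \<le> t" "t \<le> 1" for V a y w t
    proof -
      obtain z where z: "z \<in> Z" "V = fst (i z)" "a = fst (snd (i z))" using prem(1) by (auto simp: F_def)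
      have "w \<in> ball a (snd (snd (i z)))" using prem(3) \<delta>(2)[OF z(1)] by auto
      then show ?thesis using i z Z(1) prem unfolding good_def by auto
    qed
  qed
qed

text \<open>
With $D = U \cap V$ and the scaled ball $B$ of translations, every $w$ in $B$ satisfies
$|D| \le |D \cap (U - w)| + \rho R P$, where $P$ is the perimeter. Integrating over $B$ and
estimating the integral of the first term by $|D| |U|$ gives
$|D| |B| \le |D| |U| + \rho R P |B|$. The assumption $|B| = 2 |U|$ lets the left-hand side absorb
the first term on the right.
\<close>

lemma (in regular_mesh) measure_le_perimeter_in_cone_chart:
  assumes S: "S \<subseteq> M" and V: "open V" and \<delta>: "\<delta> > 0" "norm a + \<delta> \<le> R" and \<rho>: "0 < \<rho>" "\<rho> \<le> 1"
    and cone: "\<And>y w t. y \<in> V \<inter> \<Omega> \<Longrightarrow> w \<in> ball a \<delta> \<Longrightarrow> 0 \<le> t \<Longrightarrow> t \<le> 1 \<Longrightarrow> y + t *\<^sub>R w \<in> \<Omega>"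
    and vol: "unit_ball_vol (real DIM('a)) * (\<rho> * \<delta>) ^ DIM('a) = 2 * measure lborel (\<Union>S)"
  shows "measure lborel (\<Union>S \<inter> V) \<le> 2 * \<rho> * R * perimeter M E S"
proof -
  define U where "U = \<Union>S"
  define D where "D = U \<inter> V"
  define B where "B = ball (\<rho> *\<^sub>R a) (\<rho> * \<delta>)"
  define p where "p = \<rho> * R * perimeter M E S"
  have "R > 0" using \<delta> norm_ge_zero[of a] by linarith
  then have p: "p \<ge> 0" using \<rho>(1) perimeter_nonneg[of M E S] by (simp add: p_def)
  have openU: "open U" using S open_cell by (auto simp: U_def)
  have openD: "open D" using openU V by (auto simp: D_def)
  have [measurable]: "U \<in> sets borel" "D \<in> sets borel" "B \<in> sets borel"
    using openU openD by (auto simp: B_def)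
  have sub: "U \<subseteq> \<Omega>" using S cells by (auto simp: U_def)
  have fin: "emeasure lborel A < \<infinity>" if "A \<subseteq> \<Omega>" for A
    using emeasure_bounded_finite bounded_subset[OF bounded_domain that] .
  have U: "emeasure lborel U = ennreal (measure lborel U)"
    using fin[OF sub] by (intro emeasure_eq_ennreal_measure) auto
  have subD: "D \<subseteq> \<Omega>" using sub by (auto simp: D_def)
  have D: "emeasure lborel D = ennreal (measure lborel D)"
    using fin[of D] subD by (intro emeasure_eq_ennreal_measure) auto
  have B: "emeasure lborel B = ennreal (2 * measure lborel U)"
    using vol \<rho>(1) \<delta>(1) by (simp add: B_def emeasure_ball U_def)
  have split: "emeasure lborel D * indicator B w
      \<le> (\<integral>\<^sup>+y. indicator D y * indicator U (y + w) \<partial>lborel) + ennreal p * indicator B w" for w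
  proof (cases "w \<in> B")
    case True
    \<comment> \<open>The unscaled vector, to which the cone property applies.\<close>
    define v where "v = (1 / \<rho>) *\<^sub>R w"
    have "dist a v = dist (\<rho> *\<^sub>R a) w / \<rho>"
    proof -
      have "a - v = (1 / \<rho>) *\<^sub>R (\<rho> *\<^sub>R a - w)" using \<rho>(1) by (simp add: v_def scaleR_diff_right)
      then show ?thesis using \<rho>(1) by (simp add: dist_norm)
    qed
    moreover have "dist (\<rho> *\<^sub>R a) w / \<rho> < \<delta>" using True \<rho>(1) by (simp add: B_def field_simps)
    ultimately have v: "v \<in> ball a \<delta>" "w = \<rho> *\<^sub>R v"
      using \<rho>(1) by (simp_all add: v_def)
    have stay: "y + t *\<^sub>R w \<in> \<Omega>" if "y \<in> D" "0 \<le> t" "t \<le> 1" for y t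
      using cone[of y v "t * \<rho>"] that v sub \<rho> mult_le_one[of t \<rho>] by (auto simp: D_def)
    have "norm w \<le> \<rho> * R"
    proof -
      have "norm v \<le> norm a + dist a v" by (metis dist_norm norm_minus_commute norm_triangle_sub)
      then have "norm v \<le> R" using v(1) \<delta>(2) by simp
      then show ?thesis using \<rho>(1) by (simp add: v(2))
    qed
    then have wp: "norm w * perimeter M E S \<le> p"
      unfolding p_def using perimeter_nonneg by (rule mult_right_mono)
    have "emeasure lborel D = emeasure lborel ({y \<in> D. y + w \<in> U} \<union> {y \<in> D \<inter> U. y + w \<notin> U})"
      by (rule arg_cong[of _ _ "emeasure lborel"]) (auto simp: D_def)
    also have "\<dots> \<le> emeasure lborel {y \<in> D. y + w \<in> U} + emeasure lborel {y \<in> D \<inter> U. y + w \<notin> U}"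
      by (rule emeasure_subadditive) measurable
    also have "emeasure lborel {y \<in> D. y + w \<in> U} = (\<integral>\<^sup>+y. indicator {y \<in> D. y + w \<in> U} y \<partial>lborel)"
      by (rule nn_integral_indicator[symmetric]) measurable
    also have "\<dots> = (\<integral>\<^sup>+y. indicator D y * indicator U (y + w) \<partial>lborel)"
      by (intro nn_integral_cong) (auto simp: indicator_def)
    also have "emeasure lborel {y \<in> D \<inter> U. y + w \<notin> U} \<le> ennreal p"
      using emeasure_exit_le_perimeter[OF S stay] wp ennreal_leI order_trans unfolding U_def by blast
    finally show ?thesis using True by (simp add: add_left_mono)
  qed simp
  have "ennreal (measure lborel D * (2 * measure lborel U)) = (\<integral>\<^sup>+w. emeasure lborel D * indicator B w \<partial>lborel)"
    by (simp add: nn_integral_cmult_indicator D B ennreal_mult)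
  also have "\<dots> \<le> (\<integral>\<^sup>+w. (\<integral>\<^sup>+y. indicator D y * indicator U (y + w) \<partial>lborel) + ennreal p * indicator B w \<partial>lborel)"
    by (rule nn_integral_mono) (rule split)
  also have "\<dots> = (\<integral>\<^sup>+w. (\<integral>\<^sup>+y. indicator D y * indicator U (y + w) \<partial>lborel) \<partial>lborel)
      + (\<integral>\<^sup>+w. ennreal p * indicator B w \<partial>lborel)"
    by (rule nn_integral_add) measurable
  also have "(\<integral>\<^sup>+w. (\<integral>\<^sup>+y. indicator D y * indicator U (y + w) \<partial>lborel) \<partial>lborel)
      = (\<integral>\<^sup>+y. (\<integral>\<^sup>+w. indicator D y * indicator U (y + w) \<partial>lborel) \<partial>(lborel :: 'a measure))"
    by (rule lborel_pair.Fubini') measurable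
  also have "\<dots> = (\<integral>\<^sup>+y. indicator D y * emeasure lborel U \<partial>lborel)"
  proof (intro nn_integral_cong)
    fix y
    have "(\<integral>\<^sup>+w. indicator U (y + w) \<partial>lborel) = emeasure lborel U"
      using nn_integral_distr[of "(+) y" lborel borel "indicator U"] by (simp add: lborel_distr_plus)
    then show "(\<integral>\<^sup>+w. indicator D y * indicator U (y + w) \<partial>lborel) = indicator D y * emeasure lborel U"
      by (subst nn_integral_cmult) auto
  qed
  also have "\<dots> = ennreal (measure lborel D * measure lborel U)"
    by (subst nn_integral_multc) (auto simp: D U ennreal_mult)
  also have "(\<integral>\<^sup>+w. ennreal p * indicator B w \<partial>lborel) = ennreal (p * (2 * measure lborel U))"
    using p by (simp add: nn_integral_cmult_indicator B ennreal_mult)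
  finally have "measure lborel D * (2 * measure lborel U) \<le> measure lborel D * measure lborel U + p * (2 * measure lborel U)"
    using p by (simp add: ennreal_plus[symmetric] del: ennreal_plus)
  then have "measure lborel D * measure lborel U \<le> (2 * p) * measure lborel U" by simp
  moreover have "measure lborel U > 0"
  proof -
    have "unit_ball_vol (real DIM('a)) * (\<rho> * \<delta>) ^ DIM('a) > 0" using \<rho>(1) \<delta>(1) by simp
    then show ?thesis using vol by (simp add: U_def)
  qed
  ultimately have "measure lborel D \<le> 2 * p" by simp
  then show ?thesis by (simp add: D_def U_def p_def mult_ac)
qed

text \<open>
The scale \<open>\<rho>\<close> is proportional to the \<open>N\<close>-th root of the volume of the union. If it is
at most 1, the estimates in the finitely many charts add up. Otherwise the volume is bounded
below, and the volume term alone dominates the left-hand side.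
\<close>

lemma isoperimetric_inequality:
  fixes \<Omega> :: "'a::euclidean_space set"
  assumes L: "lipschitz_domain \<Omega>" and bd: "bounded \<Omega>"
  shows "\<exists>C>0. \<forall>M E EK x \<xi> S. regular_mesh \<Omega> M E EK x \<xi> \<longrightarrow> S \<subseteq> M \<longrightarrow>
    measure lborel (\<Union>S) powr (1 - 1 / real DIM('a)) \<le> C * (measure lborel (\<Union>S) + perimeter M E S)"
proof -
  obtain F :: "('a set \<times> 'a) set" and \<delta> R :: real where F: "finite F" "\<delta> > 0" "R > 0"
    "\<Omega> \<subseteq> (\<Union>(V, a)\<in>F. V)"
    "\<And>V a. (V, a) \<in> F \<Longrightarrow> open V \<and> norm a + \<delta> \<le> R"
    "\<And>V a y w t. (V, a) \<in> F \<Longrightarrow> y \<in> V \<inter> \<Omega> \<Longrightarrow> w \<in> ball a \<delta> \<Longrightarrow> 0 \<le> t \<Longrightarrow> t \<le> 1 \<Longrightarrow> y + t *\<^sub>R w \<in> \<Omega>"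
    using lipschitz_domain_finite_cones[OF L bd] by blast
  let ?N = "real DIM('a)"
  define \<omega> where "\<omega> = unit_ball_vol ?N"
  have \<omega>: "\<omega> > 0" by (simp add: \<omega>_def)
  define k where "k = (2 / \<omega>) powr (1 / ?N) / \<delta>"
  have k: "k > 0" using \<omega> F(2) by (simp add: k_def)
  define C where "C = real (card F) * (2 * R) * k + k"
  have C: "C > 0" using k F(3) by (simp add: C_def add_nonneg_pos)
  have "measure lborel (\<Union>S) powr (1 - 1 / ?N) \<le> C * (measure lborel (\<Union>S) + perimeter M E S)"
    if M: "regular_mesh \<Omega> M E EK x \<xi>" and S: "S \<subseteq> M" for M E EK x \<xi> S
  proof (cases "measure lborel (\<Union>S) = 0")
    case True
    then show ?thesis using C perimeter_nonneg[of M E S] by simp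
  next
    case False
    interpret regular_mesh \<Omega> M E EK x \<xi> by (rule M)
    define \<mu> where "\<mu> = measure lborel (\<Union>S)"
    have \<mu>: "\<mu> > 0" using False by (simp add: \<mu>_def less_le)
    \<comment> \<open>This scale gives the translation ball of radius \<rho> \<delta> the volume 2 \<mu>.\<close>
    define \<rho> where "\<rho> = k * \<mu> powr (1 / ?N)"
    have \<rho>: "\<rho> > 0" using k \<mu> by (simp add: \<rho>_def)
    have per: "perimeter M E S \<ge> 0" by (rule perimeter_nonneg)
    have split: "\<mu> = \<mu> powr (1 - 1 / ?N) * \<mu> powr (1 / ?N)" using \<mu> by (simp add: powr_add[symmetric])
    show ?thesis
    proof (cases "\<rho> \<le> 1")
      case True
      have "\<rho> * \<delta> = (2 * \<mu> / \<omega>) powr (1 / ?N)"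
        using F(2) \<omega> \<mu> by (simp add: \<rho>_def k_def powr_mult[symmetric])
      then have "(\<rho> * \<delta>) ^ DIM('a) = ((2 * \<mu> / \<omega>) powr (1 / ?N)) powr ?N"
        using \<rho> F(2) \<mu> \<omega> by (simp add: powr_realpow)
      also have "\<dots> = 2 * \<mu> / \<omega>" using \<mu> \<omega> by (simp add: powr_powr)
      finally have vol: "unit_ball_vol ?N * (\<rho> * \<delta>) ^ DIM('a) = 2 * measure lborel (\<Union>S)"
        using \<omega> by (simp add: \<omega>_def[symmetric] \<mu>_def)
      have openS: "open (\<Union>S)" using S open_cell by auto
      have subS: "\<Union>S \<subseteq> \<Omega>" using S cells by auto
      have fm: "\<Union>S \<inter> V \<in> fmeasurable lborel" if "open V" for V
        using openS that subS bounded_subset[OF bd, of "\<Union>S \<inter> V"]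
        by (intro fmeasurableI emeasure_bounded_finite) auto
      have cover: "\<Union>S \<subseteq> (\<Union>i\<in>F. \<Union>S \<inter> fst i)" using subS F(4) by (fastforce simp: case_prod_beta)
      have "\<mu> \<le> measure lborel (\<Union>i\<in>F. \<Union>S \<inter> fst i)"
        unfolding \<mu>_def using cover F(1,5) fm openS
        by (intro measure_mono_fmeasurable fmeasurable.finite_UN) auto
      also have "\<dots> \<le> (\<Sum>i\<in>F. measure lborel (\<Union>S \<inter> fst i))"
        using F(1,5) fmeasurableD[OF fm] by (intro measure_UNION_le) auto
      also have "\<dots> \<le> (\<Sum>i\<in>F. 2 * \<rho> * R * perimeter M E S)"
      proof (intro sum_mono)
        fix i assume i: "i \<in> F"
        obtain V a where Va: "i = (V, a)" by (cases i)
        show "measure lborel (\<Union>S \<inter> fst i) \<le> 2 * \<rho> * R * perimeter M E S"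
          unfolding Va fst_conv using i F(2,5,6) Va \<rho> True
          by (intro measure_le_perimeter_in_cone_chart[OF S _ _ _ _ _ _ vol, where a = a]) auto
      qed
      also have "\<dots> = (real (card F) * (2 * R) * k) * perimeter M E S * \<mu> powr (1 / ?N)"
        by (simp add: \<rho>_def)
      finally have "\<mu> powr (1 - 1 / ?N) * \<mu> powr (1 / ?N)
          \<le> (real (card F) * (2 * R) * k) * perimeter M E S * \<mu> powr (1 / ?N)"
        using split by simp
      then have "\<mu> powr (1 - 1 / ?N) \<le> (real (card F) * (2 * R) * k) * perimeter M E S"
        using \<mu> by simp
      also have "\<dots> \<le> C * (\<mu> + perimeter M E S)"
        unfolding C_def using k F(3) \<mu> per by (intro mult_mono) auto
      finally show ?thesis by (simp add: \<mu>_def)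
    next
      case False
      have "\<mu> powr (1 - 1 / ?N) \<le> \<mu> powr (1 - 1 / ?N) * \<rho>"
        using False mult_left_mono[of 1 \<rho> "\<mu> powr (1 - 1 / ?N)"] by simp
      also have "\<dots> = k * (\<mu> powr (1 - 1 / ?N) * \<mu> powr (1 / ?N))" by (simp add: \<rho>_def)
      also have "\<dots> = k * \<mu>" using split by simp
      also have "\<dots> \<le> C * (\<mu> + perimeter M E S)"
        unfolding C_def using k F(3) \<mu> per by (intro mult_mono) auto
      finally show ?thesis by (simp add: \<mu>_def)
    qed
  qed
  then show ?thesis using C by blast
qed

section \<open>Inequalities for weighted sums\<close>

lemma holder_sum_powr:
  fixes a b :: "'b \<Rightarrow> real"
  assumes fin: "finite A" and nonneg: "\<And>i. i \<in> A \<Longrightarrow> 0 \<le> a i" "\<And>i. i \<in> A \<Longrightarrow> 0 \<le> b i"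
    and xy: "x > 0" "y > 0" "x + y = 1"
  shows "(\<Sum>i\<in>A. a i powr x * b i powr y) \<le> sum a A powr x * sum b A powr y"
proof (cases "sum a A = 0 \<or> sum b A = 0")
  case True
  then have "(\<forall>i\<in>A. a i = 0) \<or> (\<forall>i\<in>A. b i = 0)"
    using nonneg by (simp add: sum_nonneg_eq_0_iff[OF fin])
  then have "(\<Sum>i\<in>A. a i powr x * b i powr y) = 0" by (intro sum.neutral) auto
  then show ?thesis by simp
next
  case False
  then have pos: "sum a A > 0" "sum b A > 0" using sum_nonneg nonneg by (metis less_le)+
  have "a i powr x * b i powr y
      \<le> (x * (a i / sum a A) + y * (b i / sum b A)) * (sum a A powr x * sum b A powr y)" if i: "i \<in> A" for i
  proof (cases "a i = 0 \<or> b i = 0")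
    case True
    moreover have "0 \<le> (x * (a i / sum a A) + y * (b i / sum b A)) * (sum a A powr x * sum b A powr y)"
      using nonneg[OF i] xy pos by (intro mult_nonneg_nonneg add_nonneg_nonneg) auto
    ultimately show ?thesis by auto
  next
    case False
    then have ab: "a i > 0" "b i > 0" using nonneg[OF i] by auto
    have "(a i / sum a A) powr x * (b i / sum b A) powr y \<le> x * (a i / sum a A) + y * (b i / sum b A)"
      using ab pos xy by (intro Youngs_inequality_0) auto
    then have "((a i / sum a A) powr x * (b i / sum b A) powr y) * (sum a A powr x * sum b A powr y)
        \<le> (x * (a i / sum a A) + y * (b i / sum b A)) * (sum a A powr x * sum b A powr y)"
      by (rule mult_right_mono) simp
    also have "((a i / sum a A) powr x * (b i / sum b A) powr y) * (sum a A powr x * sum b A powr y)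
        = a i powr x * b i powr y"
      using ab pos by (simp add: powr_divide)
    finally show ?thesis .
  qed
  then have "(\<Sum>i\<in>A. a i powr x * b i powr y)
      \<le> (\<Sum>i\<in>A. (x * (a i / sum a A) + y * (b i / sum b A)) * (sum a A powr x * sum b A powr y))"
    by (rule sum_mono)
  also have "\<dots> = (\<Sum>i\<in>A. x * (a i / sum a A) + y * (b i / sum b A)) * (sum a A powr x * sum b A powr y)"
    by (simp add: sum_distrib_right)
  also have "(\<Sum>i\<in>A. x * (a i / sum a A) + y * (b i / sum b A)) = x * (sum a A / sum a A) + y * (sum b A / sum b A)"
    by (simp only: sum.distrib sum_distrib_left sum_divide_distrib)
  also have "\<dots> = 1" using pos xy by simp
  finally show ?thesis by simp
qed

text \<open>
The usual derivation from Hoelder's inequality: the sum of $m h^{1/\alpha}$ for $h = f + g$ is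
split as $m f h^{1/\alpha-1} + m g h^{1/\alpha-1}$.
\<close>

lemma minkowski_sum_powr:
  fixes m f g :: "'b \<Rightarrow> real"
  assumes fin: "finite A" and m: "\<And>i. i \<in> A \<Longrightarrow> 0 \<le> m i"
    and f: "\<And>i. i \<in> A \<Longrightarrow> 0 \<le> f i" and g: "\<And>i. i \<in> A \<Longrightarrow> 0 \<le> g i" and \<alpha>: "0 < \<alpha>" "\<alpha> < 1"
  shows "(\<Sum>i\<in>A. m i * (f i + g i) powr (1 / \<alpha>)) powr \<alpha>
    \<le> (\<Sum>i\<in>A. m i * f i powr (1 / \<alpha>)) powr \<alpha> + (\<Sum>i\<in>A. m i * g i powr (1 / \<alpha>)) powr \<alpha>"
proof -
  define T where "T h = (\<Sum>i\<in>A. m i * h i powr (1 / \<alpha>))" for h :: "'b \<Rightarrow> real"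
  define h where "h i = f i + g i" for i
  have h: "\<And>i. i \<in> A \<Longrightarrow> 0 \<le> h i" using f g by (simp add: h_def)
  have part: "(\<Sum>i\<in>A. m i * k i * h i powr (1 / \<alpha> - 1)) \<le> T k powr \<alpha> * T h powr (1 - \<alpha>)"
    if k: "\<And>i. i \<in> A \<Longrightarrow> 0 \<le> k i" for k
  proof -
    have "m i * k i * h i powr (1 / \<alpha> - 1)
        = (m i * k i powr (1 / \<alpha>)) powr \<alpha> * (m i * h i powr (1 / \<alpha>)) powr (1 - \<alpha>)" if i: "i \<in> A" for i
    proof -
      have "(1 / \<alpha>) * (1 - \<alpha>) = 1 / \<alpha> - 1" using \<alpha> by (simp add: field_simps)
      then have "(m i * k i powr (1 / \<alpha>)) powr \<alpha> * (m i * h i powr (1 / \<alpha>)) powr (1 - \<alpha>)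
          = (m i powr \<alpha> * m i powr (1 - \<alpha>)) * k i powr 1 * h i powr (1 / \<alpha> - 1)"
        using \<alpha> by (simp add: powr_mult powr_powr)
      also have "m i powr \<alpha> * m i powr (1 - \<alpha>) = m i" using m[OF i] by (simp add: powr_add[symmetric])
      finally show ?thesis using k[OF i] by simp
    qed
    then have "(\<Sum>i\<in>A. m i * k i * h i powr (1 / \<alpha> - 1))
        = (\<Sum>i\<in>A. (m i * k i powr (1 / \<alpha>)) powr \<alpha> * (m i * h i powr (1 / \<alpha>)) powr (1 - \<alpha>))"
      by (rule sum.cong[OF refl])
    also have "\<dots> \<le> T k powr \<alpha> * T h powr (1 - \<alpha>)"
      unfolding T_def using m \<alpha> by (intro holder_sum_powr fin) auto
    finally show ?thesis .
  qed
  have "T h = (\<Sum>i\<in>A. m i * f i * h i powr (1 / \<alpha> - 1)) + (\<Sum>i\<in>A. m i * g i * h i powr (1 / \<alpha> - 1))"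
  proof -
    have "h i powr (1 / \<alpha>) = h i * h i powr (1 / \<alpha> - 1)" if "i \<in> A" for i
      using powr_mult_base[OF h[OF that], of "1 / \<alpha> - 1"] by simp
    then have "T h = (\<Sum>i\<in>A. m i * (f i + g i) * h i powr (1 / \<alpha> - 1))"
      unfolding T_def by (intro sum.cong) (auto simp: h_def)
    then show ?thesis by (simp add: sum.distrib algebra_simps)
  qed
  then have le: "T h \<le> (T f powr \<alpha> + T g powr \<alpha>) * T h powr (1 - \<alpha>)"
    using part[of f] part[of g] f g by (simp add: algebra_simps)
  have Th: "T h \<ge> 0" unfolding T_def using m by (intro sum_nonneg mult_nonneg_nonneg) auto
  have "T h powr \<alpha> \<le> T f powr \<alpha> + T g powr \<alpha>"
  proof (cases "T h = 0")
    case False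
    then have pos: "T h powr (1 - \<alpha>) > 0" by simp
    have "T h powr \<alpha> * T h powr (1 - \<alpha>) = T h" using Th by (simp add: powr_add[symmetric])
    then show ?thesis using le pos by (metis mult_le_cancel_right less_le_not_le)
  qed simp
  then show ?thesis by (simp add: T_def h_def)
qed

text \<open>
The passage from sets to functions. If \<open>\<tau>\<close> is the smallest nonzero value of
\<open>v\<close> and \<open>S\<close> its support, then subtracting the layer \<open>\<tau> * indicator S\<close> leaves a
function with smaller support. Mass and total variation are additive under this
decomposition, and the norm on the left is subadditive by Minkowski's inequality. The total
variation counts each pair of cells in the direction of decreasing values only.
\<close>

lemma layer_cake_inequality:
  fixes m v :: "'b \<Rightarrow> real" and J :: "('b \<times> 'b \<times> 'c) set" and a :: "'c \<Rightarrow> real"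
  assumes finM: "finite M" and finJ: "finite J" and \<alpha>: "0 < \<alpha>" "\<alpha> < 1"
    and m: "\<And>K. K \<in> M \<Longrightarrow> 0 \<le> m K"
    and iso: "\<And>S. S \<subseteq> M \<Longrightarrow> sum m S powr \<alpha>
        \<le> C * (sum m S + (\<Sum>(K, L, \<sigma>)\<in>{(K, L, \<sigma>). (K, L, \<sigma>) \<in> J \<and> K \<in> S \<and> L \<notin> S}. a \<sigma>))"
    and J: "\<And>K L \<sigma>. (K, L, \<sigma>) \<in> J \<Longrightarrow> K \<in> M \<and> L \<in> M"
    and v: "\<And>K. K \<in> M \<Longrightarrow> 0 \<le> v K"
  shows "(\<Sum>K\<in>M. m K * v K powr (1 / \<alpha>)) powr \<alpha>
    \<le> C * ((\<Sum>K\<in>M. m K * v K) + (\<Sum>(K, L, \<sigma>)\<in>J. a \<sigma> * max (v K - v L) 0))"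
  using v
proof (induction "card {K \<in> M. v K \<noteq> 0}" arbitrary: v rule: less_induct)
  case less
  define S where "S = {K \<in> M. v K \<noteq> 0}"
  have finS: "finite S" using finM by (simp add: S_def)
  show ?case
  proof (cases "S = {}")
    case True
    then have v0: "\<And>K. K \<in> M \<Longrightarrow> v K = 0" by (auto simp: S_def)
    have 1: "(\<Sum>K\<in>M. m K * v K powr (1 / \<alpha>)) = 0" "(\<Sum>K\<in>M. m K * v K) = 0"
      using v0 by (auto intro!: sum.neutral)
    have "(\<Sum>(K, L, \<sigma>)\<in>J. a \<sigma> * max (v K - v L) 0) = 0"
      using v0 J by (intro sum.neutral) auto
    then show ?thesis using 1 by simp
  next
    case False
    define \<tau> where "\<tau> = Min (v ` S)"
    have \<tau>_le: "\<tau> \<le> v K" if "K \<in> S" for K using finS that by (simp add: \<tau>_def)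
    have "\<tau> \<in> v ` S" unfolding \<tau>_def using finS False by (intro Min_in) auto
    then obtain K0 where K0: "K0 \<in> S" "v K0 = \<tau>" by auto
    have \<tau>: "\<tau> > 0" using K0 less.prems by (auto simp: S_def less_le)
    define w where "w K = (if K \<in> S then v K - \<tau> else 0)" for K
    have w: "0 \<le> w K" for K using \<tau>_le by (simp add: w_def)
    have v_eq: "v K = \<tau> * indicator S K + w K" if "K \<in> M" for K
      using that by (auto simp: w_def S_def)
    have "{K \<in> M. w K \<noteq> 0} \<subset> S" using K0 by (auto simp: w_def S_def)
    then have IH: "(\<Sum>K\<in>M. m K * w K powr (1 / \<alpha>)) powr \<alpha>
        \<le> C * ((\<Sum>K\<in>M. m K * w K) + (\<Sum>(K, L, \<sigma>)\<in>J. a \<sigma> * max (w K - w L) 0))"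
      using w finS unfolding S_def by (intro less.hyps psubset_card_mono) auto
    have SM: "S \<subseteq> M" by (auto simp: S_def)
    have "(\<Sum>K\<in>M. m K * (\<tau> * indicator S K) powr (1 / \<alpha>)) = \<tau> powr (1 / \<alpha>) * sum m S"
    proof -
      have "(\<Sum>K\<in>M. m K * (\<tau> * indicator S K) powr (1 / \<alpha>)) = (\<Sum>K\<in>S. m K * \<tau> powr (1 / \<alpha>))"
        using SM finM by (intro sum.mono_neutral_cong_right) (auto simp: indicator_def)
      then show ?thesis by (simp add: sum_distrib_right mult.commute)
    qed
    then have layer: "(\<Sum>K\<in>M. m K * (\<tau> * indicator S K) powr (1 / \<alpha>)) powr \<alpha> = \<tau> * sum m S powr \<alpha>"
      using \<tau> \<alpha> sum_nonneg[of S m] m SM by (simp add: powr_mult powr_powr)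
    have mass: "(\<Sum>K\<in>M. m K * v K) = \<tau> * sum m S + (\<Sum>K\<in>M. m K * w K)"
    proof -
      have "(\<Sum>K\<in>M. m K * v K) = (\<Sum>K\<in>M. m K * (\<tau> * indicator S K)) + (\<Sum>K\<in>M. m K * w K)"
        using v_eq by (simp add: sum.distrib[symmetric] distrib_left[symmetric])
      also have "(\<Sum>K\<in>M. m K * (\<tau> * indicator S K)) = (\<Sum>K\<in>S. m K * \<tau>)"
        using SM finM by (intro sum.mono_neutral_cong_right) (auto simp: indicator_def)
      finally show ?thesis by (simp add: sum_distrib_left mult.commute)
    qed
    have tv: "(\<Sum>(K, L, \<sigma>)\<in>J. a \<sigma> * max (v K - v L) 0)
        = \<tau> * (\<Sum>(K, L, \<sigma>)\<in>{(K, L, \<sigma>). (K, L, \<sigma>) \<in> J \<and> K \<in> S \<and> L \<notin> S}. a \<sigma>)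
          + (\<Sum>(K, L, \<sigma>)\<in>J. a \<sigma> * max (w K - w L) 0)"
    proof -
      have jump: "max (v K - v L) 0 = \<tau> * (if K \<in> S \<and> L \<notin> S then 1 else 0) + max (w K - w L) 0"
        if "K \<in> M" "L \<in> M" for K L
        using that less.prems[of K] less.prems[of L] \<tau>_le[of K] \<tau>_le[of L] \<tau>
        by (auto simp: w_def S_def max_def)
      have "(\<Sum>(K, L, \<sigma>)\<in>J. a \<sigma> * max (v K - v L) 0)
          = (\<Sum>(K, L, \<sigma>)\<in>J. \<tau> * (if K \<in> S \<and> L \<notin> S then a \<sigma> else 0) + a \<sigma> * max (w K - w L) 0)"
      proof (rule sum.cong[OF refl])
        fix i assume "i \<in> J"
        moreover obtain K L \<sigma> where i: "i = (K, L, \<sigma>)" by (cases i)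
        ultimately have "K \<in> M" "L \<in> M" using J by blast+
        then show "(case i of (K, L, \<sigma>) \<Rightarrow> a \<sigma> * max (v K - v L) 0)
            = (case i of (K, L, \<sigma>) \<Rightarrow> \<tau> * (if K \<in> S \<and> L \<notin> S then a \<sigma> else 0) + a \<sigma> * max (w K - w L) 0)"
          by (simp add: i jump distrib_left)
      qed
      also have "\<dots> = \<tau> * (\<Sum>(K, L, \<sigma>)\<in>J. if K \<in> S \<and> L \<notin> S then a \<sigma> else 0)
          + (\<Sum>(K, L, \<sigma>)\<in>J. a \<sigma> * max (w K - w L) 0)"
        by (simp add: sum.distrib sum_distrib_left case_prod_beta)
      also have "(\<Sum>(K, L, \<sigma>)\<in>J. if K \<in> S \<and> L \<notin> S then a \<sigma> else 0)
          = (\<Sum>(K, L, \<sigma>)\<in>{(K, L, \<sigma>). (K, L, \<sigma>) \<in> J \<and> K \<in> S \<and> L \<notin> S}. a \<sigma>)"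
        using finJ by (intro sum.mono_neutral_cong_right) (auto split: if_splits)
      finally show ?thesis .
    qed
    have "(\<Sum>K\<in>M. m K * v K powr (1 / \<alpha>)) powr \<alpha>
        = (\<Sum>K\<in>M. m K * (\<tau> * indicator S K + w K) powr (1 / \<alpha>)) powr \<alpha>"
      using v_eq by simp
    also have "\<dots> \<le> \<tau> * sum m S powr \<alpha> + (\<Sum>K\<in>M. m K * w K powr (1 / \<alpha>)) powr \<alpha>"
      unfolding layer[symmetric] using m w \<tau> \<alpha> by (intro minkowski_sum_powr finM) auto
    also have "\<dots> \<le> \<tau> * (C * (sum m S + (\<Sum>(K, L, \<sigma>)\<in>{(K, L, \<sigma>). (K, L, \<sigma>) \<in> J \<and> K \<in> S \<and> L \<notin> S}. a \<sigma>)))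
        + C * ((\<Sum>K\<in>M. m K * w K) + (\<Sum>(K, L, \<sigma>)\<in>J. a \<sigma> * max (w K - w L) 0))"
      using iso[OF SM] IH \<tau> by (intro add_mono mult_left_mono) auto
    also have "\<dots> = C * ((\<Sum>K\<in>M. m K * v K) + (\<Sum>(K, L, \<sigma>)\<in>J. a \<sigma> * max (v K - v L) 0))"
      unfolding mass tv by (simp add: algebra_simps)
    finally show ?thesis .
  qed
qed

lemma powr_diff_le:
  fixes a b :: real
  assumes a: "0 \<le> a" and b: "0 \<le> b" and g: "g > 1"
  shows "max (a powr g - b powr g) 0 \<le> g * \<bar>a - b\<bar> * a powr (g - 1)"
proof (cases "b < a")
  case False
  then have "a powr g \<le> b powr g" using assms by (intro powr_mono2) auto
  then show ?thesis using g by (auto simp: max_def)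
next
  case True
  show ?thesis
  proof (cases "b = 0")
    case True
    have "a powr g = a * a powr (g - 1)" using powr_mult_base[OF a, of "g - 1"] by simp
    moreover have "a * a powr (g - 1) \<le> g * (a * a powr (g - 1))"
      using mult_right_mono[of 1 g "a * a powr (g - 1)"] g a by simp
    ultimately show ?thesis using True a by (simp add: mult.assoc)
  next
    case False
    then have b0: "0 < b" using b by simp
    have "\<exists>z>b. z < a \<and> a powr g - b powr g = (a - b) * (g * z powr (g - 1))"
      using b0 by (intro MVT2 \<open>b < a\<close> has_real_derivative_powr) auto
    then obtain z where z: "b < z" "z < a" "a powr g - b powr g = (a - b) * (g * z powr (g - 1))" by blast
    have "z powr (g - 1) \<le> a powr (g - 1)" using z b0 g by (intro powr_mono2) auto
    then have "(a - b) * (g * z powr (g - 1)) \<le> (a - b) * (g * a powr (g - 1))"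
      using \<open>b < a\<close> g by (intro mult_left_mono) auto
    then show ?thesis using z(3) \<open>b < a\<close> g by (simp add: mult_ac)
  qed
qed

text \<open>
Hoelder's inequality in the form that the logarithm of the sum of $m |u|^t$ is a convex function of $t$.
\<close>

lemma interpolation_sum_powr:
  fixes m u :: "'b \<Rightarrow> real"
  assumes fin: "finite A" and m: "\<And>i. i \<in> A \<Longrightarrow> 0 \<le> m i" and pos: "\<And>t. (\<Sum>i\<in>A. m i * \<bar>u i\<bar> powr t) > 0"
    and srq: "s \<le> r" "r \<le> q" "s < q"
  defines "P \<equiv> (\<lambda>t. ln (\<Sum>i\<in>A. m i * \<bar>u i\<bar> powr t))"
  shows "(q - s) * P r \<le> (q - r) * P s + (r - s) * P q"
proof -
  consider "r = s" | "r = q" | "s < r" "r < q" using srq by linarith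
  then show ?thesis
  proof cases
    case 3
    define x where "x = (q - r) / (q - s)"
    define y where "y = (r - s) / (q - s)"
    have xy: "x > 0" "y > 0" "x + y = 1"
      using 3 by (auto simp: x_def y_def add_divide_distrib[symmetric])
    have "s * x + q * y = r"
    proof -
      have "(q - s) * (s * x + q * y) = s * (q - r) + q * (r - s)"
        using 3 by (simp add: x_def y_def distrib_left)
      also have "\<dots> = (q - s) * r" by (simp add: algebra_simps)
      finally show ?thesis using 3 by simp
    qed
    then have "m i * \<bar>u i\<bar> powr r = (m i * \<bar>u i\<bar> powr s) powr x * (m i * \<bar>u i\<bar> powr q) powr y" if "i \<in> A" for i
    proof -
      have "(m i * \<bar>u i\<bar> powr s) powr x * (m i * \<bar>u i\<bar> powr q) powr y
          = (m i powr x * m i powr y) * (\<bar>u i\<bar> powr (s * x) * \<bar>u i\<bar> powr (q * y))"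
        by (simp add: powr_mult powr_powr)
      also have "\<dots> = m i * \<bar>u i\<bar> powr r"
        using m[OF that] xy \<open>s * x + q * y = r\<close> by (simp add: powr_add[symmetric])
      finally show ?thesis by simp
    qed
    then have "(\<Sum>i\<in>A. m i * \<bar>u i\<bar> powr r)
        = (\<Sum>i\<in>A. (m i * \<bar>u i\<bar> powr s) powr x * (m i * \<bar>u i\<bar> powr q) powr y)"
      by (rule sum.cong[OF refl])
    also have "\<dots> \<le> (\<Sum>i\<in>A. m i * \<bar>u i\<bar> powr s) powr x * (\<Sum>i\<in>A. m i * \<bar>u i\<bar> powr q) powr y"
      using m xy by (intro holder_sum_powr fin) auto
    finally have "P r \<le> ln ((\<Sum>i\<in>A. m i * \<bar>u i\<bar> powr s) powr x * (\<Sum>i\<in>A. m i * \<bar>u i\<bar> powr q) powr y)"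
      unfolding P_def using pos by (intro ln_mono) auto
    also have "\<dots> = x * P s + y * P q"
      unfolding P_def using pos by (subst ln_mult) (auto simp: ln_powr less_imp_neq[symmetric])
    finally have "(q - s) * P r \<le> (q - s) * (x * P s + y * P q)"
      using 3 by (intro mult_left_mono) auto
    also have "\<dots> = (q - r) * P s + (r - s) * P q"
      using 3 by (simp add: x_def y_def distrib_left)
    finally show ?thesis .
  qed auto
qed

text \<open>
\<open>Pt\<close> stands for the logarithm of the sum of $m |u|^t$ and \<open>a\<close> for the
logarithm of the Sobolev constant times the discrete norm. Inserting the bound on
\<open>Pr\<close> into \<open>sob\<close> gives a bound on \<open>Pq\<close> with the coefficient
\<open>E\<close>, which is \<open>s\<close> times the denominator of \<open>\<theta>\<close>; inserting this into
\<open>int_m\<close> gives the claim. The relation between \<open>r\<close> and \<open>q\<close> removes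
\<open>r\<close>, and \<open>q\<close> cancels in the end.
\<close>

lemma interpolation_exponents:
  fixes p s m N q r \<theta> a Ps Pm Pq Pr :: real
  assumes s: "1 \<le> s" "s < m" "m \<le> q" and p: "1 \<le> p"
    and D: "1 / s + 1 / N - 1 / p > 0" and \<theta>: "\<theta> = (1 / s - 1 / m) / (1 / s + 1 / N - 1 / p)"
    and r: "r * (1 - 1 / p) = q * (1 - 1 / N) - 1"
    and sob: "(1 - 1 / N) * Pq \<le> a + (1 - 1 / p) * Pr"
    and int_r: "(q - s) * Pr \<le> (q - r) * Ps + (r - s) * Pq"
    and int_m: "(q - s) * Pm \<le> (q - m) * Ps + (m - s) * Pq"
  shows "Pm / m \<le> \<theta> * a + (1 - \<theta>) * (Ps / s)"
proof -
  define \<delta> where "\<delta> = 1 / N - 1 / p"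
  define E where "E = 1 + s * \<delta>"
  have E: "E = s * (1 / s + 1 / N - 1 / p)" using s by (simp add: E_def \<delta>_def algebra_simps)
  then have Epos: "E > 0" using D s by simp
  have qs: "q > s" "m > 0" "s > 0" using s by auto
  have 1: "(q - s) * ((1 - 1 / N) * Pq) \<le> (q - s) * (a + (1 - 1 / p) * Pr)"
    using sob qs by (intro mult_left_mono) auto
  have 2: "(1 - 1 / p) * ((q - s) * Pr) \<le> (1 - 1 / p) * ((q - r) * Ps + (r - s) * Pq)"
    using int_r p by (intro mult_left_mono) auto
  have 3: "(q - s) * ((1 - 1 / N) * Pq)
      \<le> (q - s) * a + (q * (1 - 1 / p) - r * (1 - 1 / p)) * Ps + (r * (1 - 1 / p) - s * (1 - 1 / p)) * Pq"
  proof -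
    have "(q - s) * (c1 * Pq) \<le> (q - s) * a + (q * c2 - r * c2) * Ps + (r * c2 - s * c2) * Pq"
      if "(q - s) * (c1 * Pq) \<le> (q - s) * (a + c2 * Pr)"
        "c2 * ((q - s) * Pr) \<le> c2 * ((q - r) * Ps + (r - s) * Pq)" for c1 c2
      using that by (simp add: algebra_simps)
    from this[OF 1 2] show ?thesis .
  qed
  have 4: "q * (1 - 1 / p) - r * (1 - 1 / p) = 1 + q * \<delta>" unfolding r by (simp add: \<delta>_def algebra_simps)
  have 5: "(q - s) * (1 - 1 / N) - (r * (1 - 1 / p) - s * (1 - 1 / p)) = E"
    unfolding r by (simp add: E_def \<delta>_def algebra_simps diff_divide_distrib)
  have "((q - s) * (1 - 1 / N) - (r * (1 - 1 / p) - s * (1 - 1 / p))) * Pq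
      \<le> (q - s) * a + (1 + q * \<delta>) * Ps"
    using 3 unfolding 4 by (simp only: left_diff_distrib mult.assoc)
  then have 6: "E * Pq \<le> (q - s) * a + (1 + q * \<delta>) * Ps" unfolding 5 .
  have "E * ((q - s) * Pm) \<le> E * ((q - m) * Ps + (m - s) * Pq)"
    using int_m Epos by (intro mult_left_mono) auto
  also have "\<dots> = E * (q - m) * Ps + (m - s) * (E * Pq)" by (simp add: algebra_simps)
  also have "\<dots> \<le> E * (q - m) * Ps + (m - s) * ((q - s) * a + (1 + q * \<delta>) * Ps)"
    using 6 s by (intro add_left_mono mult_left_mono) auto
  also have "\<dots> = (q - s) * ((m - s) * a + (1 + m * \<delta>) * Ps)"
    by (simp add: E_def algebra_simps)
  finally have "(q - s) * (E * Pm) \<le> (q - s) * ((m - s) * a + (1 + m * \<delta>) * Ps)" by (simp add: mult_ac)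
  then have 7: "E * Pm \<le> (m - s) * a + (1 + m * \<delta>) * Ps" using qs by simp
  have \<theta>E: "\<theta> * (m * E) = m - s"
  proof -
    have "\<theta> * (1 / s + 1 / N - 1 / p) = 1 / s - 1 / m" using D by (simp add: \<theta>)
    then have "\<theta> * (m * E) = m * s * (1 / s - 1 / m)" unfolding E by (metis mult.assoc mult.commute)
    also have "\<dots> = m - s" using qs by (simp add: right_diff_distrib)
    finally show ?thesis .
  qed
  have "(m * E) * (\<theta> * a + (1 - \<theta>) * (Ps / s)) = (\<theta> * (m * E)) * a + (m * E - \<theta> * (m * E)) * (Ps / s)"
    by (simp add: algebra_simps diff_divide_distrib)
  also have "\<dots> = (m - s) * a + (m * E - (m - s)) * (Ps / s)" unfolding \<theta>E ..
  also have "m * E - (m - s) = s * (1 + m * \<delta>)" by (simp add: E_def algebra_simps)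
  also have "s * (1 + m * \<delta>) * (Ps / s) = (1 + m * \<delta>) * Ps" using qs by simp
  finally have "E * Pm \<le> (m * E) * (\<theta> * a + (1 - \<theta>) * (Ps / s))" using 7 by simp
  then have "E * (m * (Pm / m)) \<le> E * (m * (\<theta> * a + (1 - \<theta>) * (Ps / s)))"
    using qs by (simp add: mult_ac)
  then show ?thesis using Epos qs by (simp only: mult_le_cancel_left_pos)
qed

section \<open>The discrete Gagliardo-Nirenberg-Sobolev inequality\<close>

context regular_mesh
begin

lemma Lp_norm_step_fun:
  assumes p: "p > 0"
  shows "Lp_norm \<Omega> p (step_fun M u) = (\<Sum>K\<in>M. measure lborel K * \<bar>u K\<bar> powr p) powr (1 / p)"
proof -
  have pt: "indicator \<Omega> y *\<^sub>R \<bar>step_fun M u y\<bar> powr p = (\<Sum>K\<in>M. \<bar>u K\<bar> powr p * indicator K y)" for y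
  proof (cases "\<exists>K\<in>M. y \<in> K")
    case True
    then obtain K where K: "K \<in> M" "y \<in> K" by blast
    have one: "(\<Sum>L\<in>M. f L * indicator L y) = f K" for f :: "'a set \<Rightarrow> real"
    proof -
      have "(\<Sum>L\<in>M. f L * indicator L y) = (\<Sum>L\<in>{K}. f L * indicator L y)"
        using K cells_disjoint finite_cells by (intro sum.mono_neutral_right) (auto simp: indicator_def)
      then show ?thesis using K by simp
    qed
    have "y \<in> \<Omega>" using K cells by blast
    then show ?thesis by (simp add: step_fun_def one)
  next
    case False
    then have "(\<Sum>L\<in>M. f L * indicator L y) = 0" for f :: "'a set \<Rightarrow> real"
      by (intro sum.neutral) auto
    then show ?thesis by (simp add: step_fun_def)
  qed
  have "(LINT y:\<Omega>|lborel. \<bar>step_fun M u y\<bar> powr p) = (\<Sum>K\<in>M. LINT y|lborel. \<bar>u K\<bar> powr p * indicator K y)"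
    unfolding set_lebesgue_integral_def pt
    using cell_fmeasurable by (intro Bochner_Integration.integral_sum integrable_mult_right)
      (auto simp: fmeasurable_def integrable_real_indicator)
  also have "\<dots> = (\<Sum>K\<in>M. measure lborel K * \<bar>u K\<bar> powr p)"
    by (intro sum.cong) (auto simp: mult.commute)
  finally show ?thesis by (simp add: Lp_norm_def)
qed

lemma mesh_seminorm_sum_nonneg:
  "0 \<le> (\<Sum>(K, L, \<sigma>)\<in>{(K, L, \<sigma>). interface M E K L \<sigma>}.
    face_measure \<sigma> / dist (x K) (x L) powr (p - 1) * \<bar>u L - u K\<bar> powr p)"
  by (intro sum_nonneg) (auto simp: face_measure_def)

lemma sum_le_mesh_seminorm:
  assumes p: "1 \<le> p"
  shows "(\<Sum>(K, L, \<sigma>)\<in>{(K, L, \<sigma>). interface M E K L \<sigma>}.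
      face_measure \<sigma> / dist (x K) (x L) powr (p - 1) * \<bar>u L - u K\<bar> powr p) powr (1 / p)
    \<le> 2 * mesh_seminorm M E x p u"
proof -
  define T where "T = (\<Sum>(K, L, \<sigma>)\<in>{(K, L, \<sigma>). interface M E K L \<sigma>}.
      face_measure \<sigma> / dist (x K) (x L) powr (p - 1) * \<bar>u L - u K\<bar> powr p)"
  have T: "T \<ge> 0" unfolding T_def by (rule mesh_seminorm_sum_nonneg)
  have "T powr (1 / p) = 2 powr (1 / p) * (1 / 2 * T) powr (1 / p)"
    using T by (simp add: powr_mult[symmetric])
  also have "\<dots> \<le> 2 * (1 / 2 * T) powr (1 / p)"
    using powr_mono[of "1 / p" 1 "2::real"] p by (intro mult_right_mono) auto
  finally show ?thesis by (simp add: mesh_seminorm_def T_def)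
qed

text \<open>
The hypothesis \<open>bv\<close> is applied to $|u|^\gamma$. The relations between the exponents
are those for which Hoelder's inequality with exponents $p$ and $p/(p-1)$ produces the sum of
$m |u|^r$ both from the mass term and from the jumps. The last factor of the bound is the
$(\gamma-1)$-th power of the $L^r$ norm of $u$.
\<close>

lemma sobolev_power_sum:
  fixes u :: "'a set \<Rightarrow> real"
  assumes p: "1 < p" and \<gamma>: "1 < \<gamma>" and r: "r * (1 - 1 / p) = \<gamma> - 1"
    and q: "\<gamma> = q * (1 - 1 / real DIM('a))" and N: "2 \<le> DIM('a)" and C: "C > 0"
    and bv: "\<And>v. (\<And>K. K \<in> M \<Longrightarrow> 0 \<le> v K) \<Longrightarrow>
      (\<Sum>K\<in>M. measure lborel K * v K powr (1 / (1 - 1 / real DIM('a)))) powr (1 - 1 / real DIM('a))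
      \<le> C * ((\<Sum>K\<in>M. measure lborel K * v K)
        + (\<Sum>(K, L, \<sigma>)\<in>{(K, L, \<sigma>). interface M E K L \<sigma>}. face_measure \<sigma> * max (v K - v L) 0))"
  shows "(\<Sum>K\<in>M. measure lborel K * \<bar>u K\<bar> powr q) powr (1 - 1 / real DIM('a))
    \<le> C * (1 + \<gamma> * (2 * 2 ^ DIM('a))) * (1 / \<xi> powr ((p - 1) / p) * mesh_norm \<Omega> M E x p u)
      * (\<Sum>K\<in>M. measure lborel K * \<bar>u K\<bar> powr r) powr (1 - 1 / p)"
proof (cases "M = {}")
  case False
  define \<alpha> where "\<alpha> = 1 - 1 / real DIM('a)"
  define y where "y = 1 - 1 / p"
  define J where "J = {(K, L, \<sigma>). interface M E K L \<sigma>}"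
  define P where "P t = (\<Sum>K\<in>M. measure lborel K * \<bar>u K\<bar> powr t)" for t
  \<comment> \<open>B is at least 1, so that it may be put in front of the mass term as well.\<close>
  define B where "B = 1 / \<xi> powr ((p - 1) / p)"
  have \<alpha>: "\<alpha> > 0" using N by (simp add: \<alpha>_def)
  have y: "y > 0" "1 / p > 0" "1 / p + y = 1" "y \<le> 1" "y = (p - 1) / p"
    using p by (auto simp: y_def field_simps)
  have \<xi>: "\<xi> > 0" "\<xi> \<le> 1" using \<xi>_pos regularity_parameter_le_1[OF False] by auto
  have B: "B \<ge> 1"
    using powr_le1[of "(p - 1) / p" \<xi>] \<xi> p by (simp add: B_def)
  have finJ: "finite J" unfolding J_def by (rule finite_interfaces)
  have P0: "P t \<ge> 0" for t unfolding P_def by (intro sum_nonneg) auto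
  define semi where "semi = mesh_seminorm M E x p u"
  have semi: "semi \<ge> 0" by (simp add: semi_def mesh_seminorm_def)
  have exps: "\<bar>z\<bar> powr \<gamma> = \<bar>z\<bar> * \<bar>z\<bar> powr (\<gamma> - 1)" "(\<bar>z\<bar> powr r) powr y = \<bar>z\<bar> powr (\<gamma> - 1)" for z :: real
    using powr_mult_base[of "\<bar>z\<bar>" "\<gamma> - 1"] r by (simp_all add: powr_powr y_def)
  have mass: "(\<Sum>K\<in>M. measure lborel K * \<bar>u K\<bar> powr \<gamma>) \<le> P p powr (1 / p) * P r powr y"
  proof -
    have "measure lborel K * \<bar>u K\<bar> powr \<gamma>
        = (measure lborel K * \<bar>u K\<bar> powr p) powr (1 / p) * (measure lborel K * \<bar>u K\<bar> powr r) powr y" for K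
    proof -
      have "(measure lborel K * \<bar>u K\<bar> powr p) powr (1 / p) * (measure lborel K * \<bar>u K\<bar> powr r) powr y
          = (measure lborel K powr (1 / p) * measure lborel K powr y) * ((\<bar>u K\<bar> powr p) powr (1 / p) * (\<bar>u K\<bar> powr r) powr y)"
        by (simp add: powr_mult)
      also have "measure lborel K powr (1 / p) * measure lborel K powr y = measure lborel K"
        using y(3) by (simp add: powr_add[symmetric])
      also have "(\<bar>u K\<bar> powr p) powr (1 / p) = \<bar>u K\<bar>" using p by (simp add: powr_powr)
      finally show ?thesis by (simp add: exps)
    qed
    then show ?thesis
      unfolding P_def using y finite_cells
      by (simp only:) (intro holder_sum_powr, auto)
  qed
  have jumps: "(\<Sum>(K, L, \<sigma>)\<in>J. face_measure \<sigma> * max (\<bar>u K\<bar> powr \<gamma> - \<bar>u L\<bar> powr \<gamma>) 0)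
      \<le> \<gamma> * (2 * semi * (2 ^ DIM('a) * B) * P r powr y)"
  proof -
    \<comment> \<open>The weights d powr (1 - p) in f and d in g cancel in the product of the powers 1/p and 1 - 1/p.\<close>
    define f where "f i = (case i of (K, L, \<sigma>) \<Rightarrow>
      face_measure \<sigma> / dist (x K) (x L) powr (p - 1) * \<bar>u L - u K\<bar> powr p)"
      for i :: "'a set \<times> 'a set \<times> 'a set"
    define g where "g i = (case i of (K, L, \<sigma>) \<Rightarrow>
      face_measure \<sigma> * dist (x K) (x L) * \<bar>u K\<bar> powr r)"
      for i :: "'a set \<times> 'a set \<times> 'a set"
    have "(\<Sum>(K, L, \<sigma>)\<in>J. face_measure \<sigma> * max (\<bar>u K\<bar> powr \<gamma> - \<bar>u L\<bar> powr \<gamma>) 0)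
        \<le> (\<Sum>i\<in>J. \<gamma> * (f i powr (1 / p) * g i powr y))"
    proof (intro sum_mono)
      fix i assume "i \<in> J"
      then obtain K L \<sigma> where i: "i = (K, L, \<sigma>)" and I: "interface M E K L \<sigma>" by (auto simp: J_def)
      define a where "a = face_measure \<sigma>"
      define d where "d = dist (x K) (x L)"
      have a: "a \<ge> 0" by (simp add: a_def face_measure_def)
      have d: "d > 0" using points_distinct[OF I] by (simp add: d_def)
      have "max (\<bar>u K\<bar> powr \<gamma> - \<bar>u L\<bar> powr \<gamma>) 0 \<le> \<gamma> * \<bar>\<bar>u K\<bar> - \<bar>u L\<bar>\<bar> * \<bar>u K\<bar> powr (\<gamma> - 1)"
        using \<gamma> by (intro powr_diff_le) auto
      also have "\<dots> \<le> \<gamma> * \<bar>u L - u K\<bar> * \<bar>u K\<bar> powr (\<gamma> - 1)"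
        using \<gamma> by (intro mult_right_mono mult_left_mono) auto
      finally have "a * max (\<bar>u K\<bar> powr \<gamma> - \<bar>u L\<bar> powr \<gamma>) 0
          \<le> a * (\<gamma> * \<bar>u L - u K\<bar> * \<bar>u K\<bar> powr (\<gamma> - 1))"
        using a by (rule mult_left_mono)
      also have "\<dots> = \<gamma> * (f i powr (1 / p) * g i powr y)"
      proof -
        have "f i powr (1 / p) = a powr (1 / p) / d powr y * \<bar>u L - u K\<bar>"
          using p y a d by (simp add: f_def i a_def[symmetric] d_def[symmetric] powr_mult powr_divide powr_powr)
        moreover have "g i powr y = a powr y * d powr y * \<bar>u K\<bar> powr (\<gamma> - 1)"
          using a d by (simp add: g_def i a_def[symmetric] d_def[symmetric] powr_mult exps)
        ultimately have "f i powr (1 / p) * g i powr y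
            = (a powr (1 / p) * a powr y) * \<bar>u L - u K\<bar> * \<bar>u K\<bar> powr (\<gamma> - 1)"
          using d by simp
        also have "a powr (1 / p) * a powr y = a" using a y(3) by (simp add: powr_add[symmetric])
        finally show ?thesis by (simp add: mult_ac)
      qed
      finally show "(case i of (K, L, \<sigma>) \<Rightarrow> face_measure \<sigma> * max (\<bar>u K\<bar> powr \<gamma> - \<bar>u L\<bar> powr \<gamma>) 0)
          \<le> \<gamma> * (f i powr (1 / p) * g i powr y)" by (simp add: i a_def)
    qed
    also have "\<dots> = \<gamma> * (\<Sum>i\<in>J. f i powr (1 / p) * g i powr y)" by (simp add: sum_distrib_left)
    also have "\<dots> \<le> \<gamma> * (sum f J powr (1 / p) * sum g J powr y)"
      using \<gamma> y finJ by (intro mult_left_mono holder_sum_powr)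
        (auto simp: f_def g_def face_measure_def split: prod.splits)
    also have "\<dots> \<le> \<gamma> * ((2 * semi) * ((2 ^ DIM('a) * B) * P r powr y))"
    proof (intro mult_left_mono mult_mono)
      show "sum f J powr (1 / p) \<le> 2 * semi"
        using sum_le_mesh_seminorm[of p u] p by (simp add: f_def[abs_def] J_def semi_def)
      have "sum g J \<le> 2 ^ DIM('a) / \<xi> * P r"
        using sum_interfaces_le_cells[of "\<lambda>K. \<bar>u K\<bar> powr r"] by (simp add: g_def[abs_def] J_def P_def)
      moreover have "sum g J \<ge> 0"
        by (intro sum_nonneg) (auto simp: g_def face_measure_def split: prod.splits)
      ultimately have "sum g J powr y \<le> (2 ^ DIM('a) / \<xi> * P r) powr y"
        using y by (intro powr_mono2) auto
      also have "\<dots> = (2 ^ DIM('a)) powr y * (1 / \<xi> powr y) * P r powr y"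
        using \<xi> P0[of r] by (simp add: powr_mult powr_divide)
      also have "\<dots> \<le> (2 ^ DIM('a)) * (1 / \<xi> powr y) * P r powr y"
        using powr_mono[of y 1 "2 ^ DIM('a)"] y \<xi> by (intro mult_right_mono) auto
      finally show "sum g J powr y \<le> (2 ^ DIM('a) * B) * P r powr y" using y(5) by (simp add: B_def)
    qed (use \<gamma> semi in auto)
    finally show ?thesis by (simp add: mult_ac)
  qed
  have norm_eq: "mesh_norm \<Omega> M E x p u = P p powr (1 / p) + semi"
    using p by (simp add: mesh_norm_def Lp_norm_step_fun P_def semi_def)
  have "(\<Sum>K\<in>M. measure lborel K * \<bar>u K\<bar> powr q) powr \<alpha>
      = (\<Sum>K\<in>M. measure lborel K * (\<bar>u K\<bar> powr \<gamma>) powr (1 / \<alpha>)) powr \<alpha>"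
    using \<alpha> q by (simp add: powr_powr \<alpha>_def)
  also have "\<dots> \<le> C * ((\<Sum>K\<in>M. measure lborel K * \<bar>u K\<bar> powr \<gamma>)
      + (\<Sum>(K, L, \<sigma>)\<in>J. face_measure \<sigma> * max (\<bar>u K\<bar> powr \<gamma> - \<bar>u L\<bar> powr \<gamma>) 0))"
    unfolding \<alpha>_def J_def by (rule bv) simp
  also have "\<dots> \<le> C * (P p powr (1 / p) * P r powr y + \<gamma> * (2 * semi * (2 ^ DIM('a) * B) * P r powr y))"
    using mass jumps C by (intro mult_left_mono add_mono) auto
  also have "\<dots> \<le> C * ((1 + \<gamma> * (2 * 2 ^ DIM('a))) * (B * (P p powr (1 / p) + semi)) * P r powr y)"
  proof (intro mult_left_mono)
    define c where "c = \<gamma> * (2 * 2 ^ DIM('a))"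
    have c: "c \<ge> 0" using \<gamma> by (simp add: c_def)
    have "P p powr (1 / p) + c * B * semi \<le> (1 + c) * (B * (P p powr (1 / p) + semi))"
    proof -
      have "P p powr (1 / p) \<le> B * P p powr (1 / p)" using B mult_right_mono[of 1 B "P p powr (1 / p)"] by simp
      moreover have "0 \<le> c * (B * P p powr (1 / p)) + B * semi" using c B semi by simp
      ultimately show ?thesis by (simp add: algebra_simps)
    qed
    then have "(P p powr (1 / p) + c * B * semi) * P r powr y
        \<le> ((1 + c) * (B * (P p powr (1 / p) + semi))) * P r powr y" by (rule mult_right_mono) simp
    then show "P p powr (1 / p) * P r powr y + \<gamma> * (2 * semi * (2 ^ DIM('a) * B) * P r powr y)
        \<le> (1 + \<gamma> * (2 * 2 ^ DIM('a))) * (B * (P p powr (1 / p) + semi)) * P r powr y"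
      by (simp add: c_def algebra_simps)
  qed (use C in simp)
  finally show ?thesis unfolding norm_eq P_def \<alpha>_def y_def B_def by (simp only: mult.assoc)
qed simp

text \<open>
For $p = 1$ no Hoelder inequality is involved, and the embedding applies to $|u|$ itself.
\<close>

lemma sobolev_sum_exponent_one:
  fixes u :: "'a set \<Rightarrow> real"
  assumes C: "C > 0"
    and bv: "\<And>v. (\<And>K. K \<in> M \<Longrightarrow> 0 \<le> v K) \<Longrightarrow>
      (\<Sum>K\<in>M. measure lborel K * v K powr (1 / (1 - 1 / real DIM('a)))) powr (1 - 1 / real DIM('a))
      \<le> C * ((\<Sum>K\<in>M. measure lborel K * v K)
        + (\<Sum>(K, L, \<sigma>)\<in>{(K, L, \<sigma>). interface M E K L \<sigma>}. face_measure \<sigma> * max (v K - v L) 0))"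
  shows "(\<Sum>K\<in>M. measure lborel K * \<bar>u K\<bar> powr (1 / (1 - 1 / real DIM('a)))) powr (1 - 1 / real DIM('a))
    \<le> C * 2 * mesh_norm \<Omega> M E x 1 u"
proof -
  define J where "J = {(K, L, \<sigma>). interface M E K L \<sigma>}"
  define T where "T = (\<Sum>(K, L, \<sigma>)\<in>J. face_measure \<sigma> * \<bar>u L - u K\<bar>)"
  have T0: "T \<ge> 0" unfolding T_def by (intro sum_nonneg) (auto simp: face_measure_def)
  have "(\<Sum>(K, L, \<sigma>)\<in>J. face_measure \<sigma> * max (\<bar>u K\<bar> - \<bar>u L\<bar>) 0) \<le> T"
    unfolding T_def by (intro sum_mono) (auto simp: face_measure_def intro!: mult_left_mono)
  moreover have "T = 2 * mesh_seminorm M E x 1 u"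
  proof -
    have "(\<Sum>(K, L, \<sigma>)\<in>J. face_measure \<sigma> / dist (x K) (x L) powr (1 - 1) * \<bar>u L - u K\<bar> powr 1) = T"
      unfolding T_def
    proof (rule sum.cong[OF refl])
      fix i assume "i \<in> J"
      then obtain K L \<sigma> where i: "i = (K, L, \<sigma>)" and I: "interface M E K L \<sigma>" by (auto simp: J_def)
      show "(case i of (K, L, \<sigma>) \<Rightarrow> face_measure \<sigma> / dist (x K) (x L) powr (1 - 1) * \<bar>u L - u K\<bar> powr 1)
          = (case i of (K, L, \<sigma>) \<Rightarrow> face_measure \<sigma> * \<bar>u L - u K\<bar>)"
        using points_distinct[OF I] by (simp add: i)
    qed
    then show ?thesis using T0 by (simp add: mesh_seminorm_def J_def)
  qed
  moreover have "(\<Sum>K\<in>M. measure lborel K * \<bar>u K\<bar>) = Lp_norm \<Omega> 1 (step_fun M u)"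
    by (simp add: Lp_norm_step_fun sum_nonneg)
  moreover have "Lp_norm \<Omega> 1 (step_fun M u) \<ge> 0" by (simp add: Lp_norm_def)
  ultimately have "(\<Sum>K\<in>M. measure lborel K * \<bar>u K\<bar>)
      + (\<Sum>(K, L, \<sigma>)\<in>J. face_measure \<sigma> * max (\<bar>u K\<bar> - \<bar>u L\<bar>) 0) \<le> 2 * mesh_norm \<Omega> M E x 1 u"
    by (simp add: mesh_norm_def)
  then have "C * ((\<Sum>K\<in>M. measure lborel K * \<bar>u K\<bar>)
      + (\<Sum>(K, L, \<sigma>)\<in>J. face_measure \<sigma> * max (\<bar>u K\<bar> - \<bar>u L\<bar>) 0)) \<le> C * (2 * mesh_norm \<Omega> M E x 1 u)"
    using C by (intro mult_left_mono) auto
  then show ?thesis using bv[of "\<lambda>K. \<bar>u K\<bar>"] by (simp add: J_def mult.assoc)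
qed

lemma sum_powr_pos:
  assumes "\<exists>K\<in>M. u K \<noteq> 0"
  shows "(\<Sum>K\<in>M. measure lborel K * \<bar>u K\<bar> powr t) > 0"
proof -
  obtain K where K: "K \<in> M" "u K \<noteq> 0" using assms by blast
  then show ?thesis
    using measure_cell_pos[of K] finite_cells by (intro sum_pos2[where i = K]) auto
qed

lemma Lp_norm_step_fun_pos:
  assumes u: "\<exists>K\<in>M. u K \<noteq> 0" and t: "t > 0"
  shows "Lp_norm \<Omega> t (step_fun M u) > 0"
  using sum_powr_pos[OF u, of t] t by (simp add: Lp_norm_step_fun)

lemma mesh_norm_pos:
  assumes u: "\<exists>K\<in>M. u K \<noteq> 0" and t: "t > 0"
  shows "mesh_norm \<Omega> M E x t u > 0"
  using Lp_norm_step_fun_pos[OF u t] by (simp add: mesh_norm_def mesh_seminorm_def add_pos_nonneg)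

lemma gagliardo_nirenberg_of_sobolev:
  fixes u :: "'a set \<Rightarrow> real"
  assumes u: "\<exists>K\<in>M. u K \<noteq> 0" and s: "1 \<le> s" "s < m" "m \<le> q" and r: "s \<le> r" "r \<le> q"
    and p: "1 \<le> p" and D: "1 / s + 1 / real DIM('a) - 1 / p > 0"
    and \<theta>: "\<theta> = (1 / s - 1 / m) / (1 / s + 1 / real DIM('a) - 1 / p)"
    and rq: "r * (1 - 1 / p) = q * (1 - 1 / real DIM('a)) - 1"
    and A: "A > 0"
    and sob: "(\<Sum>K\<in>M. measure lborel K * \<bar>u K\<bar> powr q) powr (1 - 1 / real DIM('a))
      \<le> A * (\<Sum>K\<in>M. measure lborel K * \<bar>u K\<bar> powr r) powr (1 - 1 / p)"
  shows "Lp_norm \<Omega> m (step_fun M u) \<le> A powr \<theta> * Lp_norm \<Omega> s (step_fun M u) powr (1 - \<theta>)"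
proof -
  define P where "P t = (\<Sum>K\<in>M. measure lborel K * \<bar>u K\<bar> powr t)" for t
  have P: "P t > 0" for t unfolding P_def by (rule sum_powr_pos[OF u])
  note interp = interpolation_sum_powr[OF finite_cells _ sum_powr_pos[OF u], folded P_def]
  have "P q powr (1 - 1 / real DIM('a)) \<le> A * P r powr (1 - 1 / p)"
    using sob by (simp only: P_def)
  then have "ln (P q powr (1 - 1 / real DIM('a))) \<le> ln (A * P r powr (1 - 1 / p))"
    using A P[of q] P[of r] by (intro ln_mono) auto
  then have "(1 - 1 / real DIM('a)) * ln (P q) \<le> ln A + (1 - 1 / p) * ln (P r)"
    using A P[of q] P[of r] by (simp add: ln_mult ln_powr)
  then have "ln (P m) / m \<le> \<theta> * ln A + (1 - \<theta>) * (ln (P s) / s)"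
    using s r by (intro interpolation_exponents[OF s p D \<theta> rq]) (auto intro!: interp)
  then have "exp (ln (P m) / m) \<le> exp (\<theta> * ln A + (1 - \<theta>) * (ln (P s) / s))" by simp
  moreover have "Lp_norm \<Omega> t (step_fun M u) = exp (ln (P t) / t)" if t: "t > 0" for t
  proof -
    have "Lp_norm \<Omega> t (step_fun M u) = P t powr (1 / t)"
      using Lp_norm_step_fun[OF t] by (simp only: P_def)
    also have "\<dots> = exp (ln (P t) / t)" using P[of t] by (simp add: powr_def)
    finally show ?thesis .
  qed
  moreover have "s > 0" "m > 0" using s by auto
  ultimately show ?thesis using A by (simp add: powr_def exp_add)
qed

end

text \<open>
The volume of a union of cells is the sum of their volumes, so the isoperimetric inequality is
the hypothesis of the layer-cake argument.
\<close>

lemma discrete_BV_embedding: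
  fixes \<Omega> :: "'a::euclidean_space set"
  assumes N: "2 \<le> DIM('a)" and L: "lipschitz_domain \<Omega>" and bd: "bounded \<Omega>"
  shows "\<exists>C>0. \<forall>M E EK x \<xi> v. regular_mesh \<Omega> M E EK x \<xi> \<longrightarrow> (\<forall>K\<in>M. 0 \<le> v K) \<longrightarrow>
    (\<Sum>K\<in>M. measure lborel K * v K powr (1 / (1 - 1 / real DIM('a)))) powr (1 - 1 / real DIM('a))
      \<le> C * ((\<Sum>K\<in>M. measure lborel K * v K)
        + (\<Sum>(K, L, \<sigma>)\<in>{(K, L, \<sigma>). interface M E K L \<sigma>}. face_measure \<sigma> * max (v K - v L) 0))"
proof -
  obtain C where C: "C > 0" and iso: "\<And>M E EK x \<xi> S. regular_mesh \<Omega> M E EK x \<xi> \<Longrightarrow> S \<subseteq> M \<Longrightarrow>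
    measure lborel (\<Union>S) powr (1 - 1 / real DIM('a)) \<le> C * (measure lborel (\<Union>S) + perimeter M E S)"
    using isoperimetric_inequality[OF L bd] by blast
  have "(\<Sum>K\<in>M. measure lborel K * v K powr (1 / (1 - 1 / real DIM('a)))) powr (1 - 1 / real DIM('a))
      \<le> C * ((\<Sum>K\<in>M. measure lborel K * v K)
        + (\<Sum>(K, L, \<sigma>)\<in>{(K, L, \<sigma>). interface M E K L \<sigma>}. face_measure \<sigma> * max (v K - v L) 0))"
    if mesh: "regular_mesh \<Omega> M E EK x \<xi>" and v: "\<forall>K\<in>M. 0 \<le> v K" for M E EK x \<xi> and v :: "'a set \<Rightarrow> real"
  proof -
    interpret regular_mesh \<Omega> M E EK x \<xi> by (rule mesh)
    have "sum (measure lborel) S powr (1 - 1 / real DIM('a)) \<le> C * (sum (measure lborel) S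
        + (\<Sum>(K, L, \<sigma>)\<in>{(K, L, \<sigma>). (K, L, \<sigma>) \<in> {(K, L, \<sigma>). interface M E K L \<sigma>} \<and> K \<in> S \<and> L \<notin> S}. face_measure \<sigma>))"
      if S: "S \<subseteq> M" for S
    proof -
      have sets: "K \<in> sets lborel" "emeasure lborel K \<noteq> \<infinity>" if "K \<in> S" for K
        using that S fmeasurableD[OF cell_fmeasurable] fmeasurableD2[OF cell_fmeasurable] by auto
      have "disjoint_family_on (\<lambda>K. K) S"
        using S cells_disjoint by (auto simp: disjoint_family_on_def)
      then have "measure lborel (\<Union>S) = sum (measure lborel) S"
        using measure_finite_Union[of S "\<lambda>K. K" lborel] sets finite_subset[OF S finite_cells] by auto
      then show ?thesis using iso[OF mesh S] by (simp add: perimeter_def)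
    qed
    then show ?thesis
      using N v finite_cells finite_interfaces
      by (intro layer_cake_inequality) (auto simp: interface_def)
  qed
  then show ?thesis using C by blast
qed

text \<open>
For $p < N$ both \<open>q\<close> and \<open>r\<close> are the critical exponent $pN/(N-p)$. For
$p \ge N$ there is no critical exponent and any large \<open>q\<close> will do; since $p \ge N$, the
corresponding \<open>r\<close> is at most \<open>q\<close>.
\<close>

lemma exponents_exist:
  fixes p s m :: real and N :: nat
  assumes N: "2 \<le> N" and s: "1 \<le> s" "s < m"
    and cases: "(1 \<le> p \<and> p < real N \<and> m \<le> p * real N / (real N - p)) \<or> real N \<le> p"
  obtains q r where "m \<le> q" "s \<le> r" "r \<le> q" "r * (1 - 1 / p) = q * (1 - 1 / real N) - 1"
    "1 < p \<longrightarrow> 1 < q * (1 - 1 / real N)" "p = 1 \<longrightarrow> q = 1 / (1 - 1 / real N)"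
    "1 / s + 1 / real N - 1 / p > 0"
  using cases
proof
  assume p: "1 \<le> p \<and> p < real N \<and> m \<le> p * real N / (real N - p)"
  define q where "q = p * real N / (real N - p)"
  have N0: "real N > 0" "real N - p > 0" using p N by auto
  have q0: "q > 0" "q \<ge> m" "q > s" using p N s by (auto simp: q_def)
  have qN: "q * (1 - 1 / real N) = p * (real N - 1) / (real N - p)"
    using N0 by (simp add: q_def field_simps)
  have "q * (1 - 1 / p) = q * (1 - 1 / real N) - 1"
    unfolding qN using N0 p by (simp add: q_def field_simps)
  moreover have "1 < p \<longrightarrow> 1 < q * (1 - 1 / real N)"
  proof
    assume "1 < p"
    have "real N - p < p * (real N - 1)"
      using mult_strict_right_mono[OF \<open>1 < p\<close>, of "real N"] N0 by (simp add: algebra_simps)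
    then show "1 < q * (1 - 1 / real N)" unfolding qN using N0 by simp
  qed
  moreover have "p = 1 \<longrightarrow> q = 1 / (1 - 1 / real N)" using N0 by (auto simp: q_def field_simps)
  moreover have "1 / s + 1 / real N - 1 / p > 0"
  proof -
    have "1 / q = 1 / p - 1 / real N" using N0 p by (simp add: q_def field_simps)
    moreover have "1 / q < 1 / s" using q0 s by (intro divide_strict_left_mono) auto
    ultimately show ?thesis by linarith
  qed
  ultimately show ?thesis using that[of q q] q0 by auto
next
  assume p: "real N \<le> p"
  \<comment> \<open>Large enough for r \<ge> s, because 1 - 1/N \<ge> 1/2.\<close>
  define q where "q = m + 2 * s + 2"
  define r where "r = (q * (1 - 1 / real N) - 1) / (1 - 1 / p)"
  have p2: "p \<ge> 2" using p N by linarith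
  have c: "1 - 1 / real N \<ge> 1 / 2" "0 < 1 - 1 / p" "1 - 1 / p \<le> 1" "1 - 1 / real N \<le> 1 - 1 / p"
    using N p p2 by (auto simp: field_simps)
  have q0: "q \<ge> m" "q > 0" using s by (auto simp: q_def)
  have half: "q * (1 - 1 / real N) \<ge> s + 1 + m / 2"
  proof -
    have "q * (1 / 2) \<le> q * (1 - 1 / real N)" using c(1) q0 by (intro mult_left_mono) auto
    moreover have "q * (1 / 2) = s + 1 + m / 2" by (simp add: q_def field_simps)
    ultimately show ?thesis by linarith
  qed
  have "s * (1 - 1 / p) \<le> s * 1" using c s by (intro mult_left_mono) auto
  then have "s * (1 - 1 / p) \<le> q * (1 - 1 / real N) - 1" using half s by linarith
  then have "s \<le> r" using c(2) by (simp only: r_def pos_le_divide_eq)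
  moreover have "r \<le> q"
  proof -
    have "q * (1 - 1 / real N) - 1 \<le> q * (1 - 1 / p)"
      using mult_left_mono[OF c(4), of q] q0 by linarith
    then show ?thesis using c(2) by (simp only: r_def pos_divide_le_eq)
  qed
  moreover have "r * (1 - 1 / p) = q * (1 - 1 / real N) - 1"
    using c(2) unfolding r_def by (metis less_irrefl nonzero_eq_divide_eq)
  moreover have "1 < q * (1 - 1 / real N)" using half s by linarith
  moreover have "1 / s + 1 / real N - 1 / p > 0"
  proof -
    have "1 / p \<le> 1 / real N" using p N by (intro divide_left_mono) auto
    moreover have "1 / s > 0" using s by simp
    ultimately show ?thesis by linarith
  qed
  ultimately show ?thesis using that[of q r] q0 p2 by auto
qed

theorem theorem4:
  fixes \<Omega> :: "'a::euclidean_space set" and p s m \<theta> :: real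
  assumes "DIM('a) \<ge> 2"
    and "lipschitz_domain \<Omega>" and "bounded \<Omega>" and "open_polyhedral \<Omega>"
    and "(1 \<le> p \<and> p < real DIM('a) \<and> 1 \<le> s \<and> s \<le> m \<and> m \<le> p * real DIM('a) / (real DIM('a) - p)) \<or>
         (real DIM('a) \<le> p \<and> 1 \<le> s \<and> s \<le> m)"
    and "\<theta> = (1 / s - 1 / m) / (1 / s + 1 / real DIM('a) - 1 / p)"
  shows "\<exists>C>0. \<forall>M E EK x \<xi>.
           mesh \<Omega> M E EK x \<longrightarrow> \<xi> > 0 \<longrightarrow> mesh_regular \<Omega> M E EK x \<xi> \<longrightarrow>
           (\<forall>uK. Lp_norm \<Omega> m (step_fun M uK)
                 \<le> C / \<xi> powr ((p - 1) * \<theta> / p)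
                   * mesh_norm \<Omega> M E x p uK powr \<theta> * Lp_norm \<Omega> s (step_fun M uK) powr (1 - \<theta>))"
proof -
  have p: "p \<ge> 1" and s: "1 \<le> s" "s \<le> m" using assms(1,5) by auto
  have regular_meshI: "regular_mesh \<Omega> M E EK x \<xi>"
    if "mesh \<Omega> M E EK x" "\<xi> > 0" "mesh_regular \<Omega> M E EK x \<xi>" for M E EK x \<xi>
    using that assms(2,3) by (auto simp: regular_mesh_def regular_mesh_axioms_def lipschitz_domain_def)
  have "\<exists>K0>0. \<forall>M E EK x \<xi> u. regular_mesh \<Omega> M E EK x \<xi> \<longrightarrow> (\<exists>K\<in>M. u K \<noteq> 0) \<longrightarrow>
      Lp_norm \<Omega> m (step_fun M u) \<le> (K0 * (1 / \<xi> powr ((p - 1) / p) * mesh_norm \<Omega> M E x p u)) powr \<theta>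
          * Lp_norm \<Omega> s (step_fun M u) powr (1 - \<theta>)"
  \<comment> \<open>For s = m the exponent \<theta> is 0, even if its denominator vanishes, and the bound is the norm on the left.\<close>
  proof (cases "s = m")
    case True
    have "Lp_norm \<Omega> m (step_fun M u) \<le> (1 * (1 / \<xi> powr ((p - 1) / p) * mesh_norm \<Omega> M E x p u)) powr \<theta>
          * Lp_norm \<Omega> s (step_fun M u) powr (1 - \<theta>)"
      if mesh: "regular_mesh \<Omega> M E EK x \<xi>" and u: "\<exists>K\<in>M. u K \<noteq> 0" for M E EK x \<xi> u
    proof -
      interpret regular_mesh \<Omega> M E EK x \<xi> by (rule mesh)
      have "mesh_norm \<Omega> M E x p u > 0" using mesh_norm_pos[OF u] p by simp
      moreover have "Lp_norm \<Omega> s (step_fun M u) > 0" using Lp_norm_step_fun_pos[OF u] s by simp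
      ultimately show ?thesis using True \<xi>_pos by (simp add: assms(6))
    qed
    then show ?thesis by (intro exI[of _ 1]) auto
  next
    case False
    then have sm: "s < m" using s by simp
    obtain q r where qr: "m \<le> q" "s \<le> r" "r \<le> q" "r * (1 - 1 / p) = q * (1 - 1 / real DIM('a)) - 1"
      "1 < p \<longrightarrow> 1 < q * (1 - 1 / real DIM('a))" "p = 1 \<longrightarrow> q = 1 / (1 - 1 / real DIM('a))"
      and D: "1 / s + 1 / real DIM('a) - 1 / p > 0"
      using exponents_exist[OF assms(1) s(1) sm, of p] assms(5) by metis
    obtain C where C: "C > 0" and bv: "\<And>M E EK x \<xi> v. regular_mesh \<Omega> M E EK x \<xi> \<Longrightarrow> (\<forall>K\<in>M. 0 \<le> v K) \<Longrightarrow>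
      (\<Sum>K\<in>M. measure lborel K * v K powr (1 / (1 - 1 / real DIM('a)))) powr (1 - 1 / real DIM('a))
      \<le> C * ((\<Sum>K\<in>M. measure lborel K * v K)
        + (\<Sum>(K, L, \<sigma>)\<in>{(K, L, \<sigma>). interface M E K L \<sigma>}. face_measure \<sigma> * max (v K - v L) 0))"
      using discrete_BV_embedding[OF assms(1-3)] by blast
    define K0 where "K0 = (if p = 1 then C * 2 else C * (1 + q * (1 - 1 / real DIM('a)) * (2 * 2 ^ DIM('a))))"
    have K0: "K0 > 0"
    proof (cases "p = 1")
      case False
      then have "1 < q * (1 - 1 / real DIM('a))" using qr(5) p by simp
      then have "0 < q * (1 - 1 / real DIM('a))" by linarith
      then have "0 < q * (1 - 1 / real DIM('a)) * (2 * 2 ^ DIM('a))" by (rule mult_pos_pos) simp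
      then have "0 < 1 + q * (1 - 1 / real DIM('a)) * (2 * 2 ^ DIM('a))" by linarith
      then show ?thesis using C False by (simp add: K0_def)
    qed (use C in \<open>simp add: K0_def\<close>)
    have "Lp_norm \<Omega> m (step_fun M u) \<le> (K0 * (1 / \<xi> powr ((p - 1) / p) * mesh_norm \<Omega> M E x p u)) powr \<theta>
          * Lp_norm \<Omega> s (step_fun M u) powr (1 - \<theta>)"
      if mesh: "regular_mesh \<Omega> M E EK x \<xi>" and u: "\<exists>K\<in>M. u K \<noteq> 0" for M E EK x \<xi> u
    proof -
      interpret regular_mesh \<Omega> M E EK x \<xi> by (rule mesh)
      have pos: "K0 * (1 / \<xi> powr ((p - 1) / p) * mesh_norm \<Omega> M E x p u) > 0"
        using mesh_norm_pos[OF u, of p] p K0 \<xi>_pos by simp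
      have bv': "(\<Sum>K\<in>M. measure lborel K * v K powr (1 / (1 - 1 / real DIM('a)))) powr (1 - 1 / real DIM('a))
        \<le> C * ((\<Sum>K\<in>M. measure lborel K * v K)
          + (\<Sum>(K, L, \<sigma>)\<in>{(K, L, \<sigma>). interface M E K L \<sigma>}. face_measure \<sigma> * max (v K - v L) 0))"
        if "\<And>K. K \<in> M \<Longrightarrow> 0 \<le> v K" for v using bv[OF mesh] that by blast
      have sob: "(\<Sum>K\<in>M. measure lborel K * \<bar>u K\<bar> powr q) powr (1 - 1 / real DIM('a))
        \<le> K0 * (1 / \<xi> powr ((p - 1) / p) * mesh_norm \<Omega> M E x p u)
          * (\<Sum>K\<in>M. measure lborel K * \<bar>u K\<bar> powr r) powr (1 - 1 / p)"
      proof (cases "p = 1")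
        case True
        have "q = 1 / (1 - 1 / real DIM('a))" using qr(6) True by simp
        moreover have "(\<Sum>K\<in>M. measure lborel K * \<bar>u K\<bar> powr r) powr (1 - 1 / p) = 1"
          using sum_powr_pos[OF u, of r] True by simp
        moreover have "K0 = C * 2" "1 / \<xi> powr ((p - 1) / p) = 1" using True \<xi>_pos by (simp_all add: K0_def)
        ultimately show ?thesis using sobolev_sum_exponent_one[OF C bv'] by (simp only: True mult_1 mult_1_right)
      next
        case False
        then have p1: "1 < p" using p by simp
        have "1 < q * (1 - 1 / real DIM('a))" using qr(5) p1 by simp
        from sobolev_power_sum[OF p1 this qr(4) refl assms(1) C bv'] False
        show ?thesis by (simp only: K0_def if_False)
      qed
      show ?thesis
        by (rule gagliardo_nirenberg_of_sobolev[OF u s(1) sm qr(1-3) p D assms(6) qr(4) pos sob])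
    qed
    then show ?thesis using K0 by blast
  qed
  then obtain K0 where K0: "K0 > 0" and main: "\<And>M E EK x \<xi> u. regular_mesh \<Omega> M E EK x \<xi> \<Longrightarrow>
      (\<exists>K\<in>M. u K \<noteq> 0) \<Longrightarrow> Lp_norm \<Omega> m (step_fun M u)
        \<le> (K0 * (1 / \<xi> powr ((p - 1) / p) * mesh_norm \<Omega> M E x p u)) powr \<theta>
          * Lp_norm \<Omega> s (step_fun M u) powr (1 - \<theta>)"
    by blast
  have "Lp_norm \<Omega> m (step_fun M u) \<le> K0 powr \<theta> / \<xi> powr ((p - 1) * \<theta> / p)
      * mesh_norm \<Omega> M E x p u powr \<theta> * Lp_norm \<Omega> s (step_fun M u) powr (1 - \<theta>)"
    if mesh: "mesh \<Omega> M E EK x" "\<xi> > 0" "mesh_regular \<Omega> M E EK x \<xi>" for M E EK x \<xi> u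
  proof -
    interpret regular_mesh \<Omega> M E EK x \<xi> by (rule regular_meshI[OF mesh])
    show ?thesis
    proof (cases "\<exists>K\<in>M. u K \<noteq> 0")
      case True
      have "(K0 * (1 / \<xi> powr ((p - 1) / p) * mesh_norm \<Omega> M E x p u)) powr \<theta>
          = K0 powr \<theta> / \<xi> powr ((p - 1) * \<theta> / p) * mesh_norm \<Omega> M E x p u powr \<theta>"
        by (simp add: powr_mult powr_divide powr_powr)
      then show ?thesis using main[OF regular_meshI[OF mesh] True] by simp
    next
      case False
      then have "Lp_norm \<Omega> m (step_fun M u) = 0" using s by (simp add: Lp_norm_step_fun)
      then show ?thesis by simp
    qed
  qed
  moreover have "K0 powr \<theta> > 0" using K0 by simp
  ultimately show ?thesis by blast
qed

end
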